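(* Let $K$ be a field of characteristic $p>0$ and $\alpha,\beta\in K$. Let $P=P_{\alpha,\beta}$ be the $U_2$-torsor given by $$P(R)=\left\{(y,z)\in R^2\mid y^{p^2}=\alpha\text{ and }z^p=\beta+\alpha y^p\right\},$$ with $U_2$-action $(\lambda_1,\lambda_2)\cdot(y,z)=(\lambda_1+y,\ \lambda_2+z+\lambda_1y^p)$. Then the additive polynomials $$\Phi(u)=u^{p^2}\quad\text{and}\quad\Psi(u)=u-\alpha u^p-\beta^pu^{p^2}$$ give the twisted form ${}^P\!\mathbb{G}_a=U_{\Phi,\Psi}$.
   Context: For a commutative $K$-algebra $R$, let $R[F;\sigma]$ be the skew polynomial ring with $F\lambda=\lambda^pF$. The group scheme $U_2$ is $U_2(R)=\{1+\lambda_1F+\lambda_2F^2\mid\lambda_1^{p^2}=0,\ \lambda_2^p=0\}\subset R[F;\sigma]^\times$, with elements written $(\lambda_1,\lambda_2)$. It acts on $\mathbb{G}_a$ by group automorphisms via $x\mapsto x+\lambda_1x^p+\lambda_2x^{p^2}$. The twist ${}^P\!\mathbb{G}_a=U_2\backslash(P\times\mathbb{G}_a)$ is the quotient by the diagonal action, a group scheme over $K$. An additive polynomial is one of the form $\sum_i\lambda_iu^{p^i}\in K[u]$. For additive polynomials $\Phi,\Psi\in K[u]$, not both zero, $U_{\Phi,\Psi}$ is the kernel of the homomorphism $\mathbb{G}_a^{\oplus2}\to\mathbb{G}_a$, $(u,v)\mapsto\Phi(u)-\Psi(v)$. Equality ${}^P\!\mathbb{G}_a=U_{\Phi,\Psi}$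 means isomorphism of group schemes. *)

theory Defs
  imports "HOL-Algebra.UnivPoly" "HOL-Computational_Algebra.Primes"
begin

text \<open>
  Schemes over \<open>K\<close> are treated through their functors of points. A commutative \<open>K\<close>-algebra is a
  model of the locale \<^locale>\<open>algebra\<close>; the algebras considered are those with carrier
  contained in a type \<open>'u\<close>, which plays the role of a universe. If \<open>'u\<close> is infinite and
  \<open>K\<close> embeds into it, then every finitely generated \<open>K\<close>-algebra has a copy there. The zero ring
  is allowed as an algebra.
\<close>

definition alg_hom ::
  "('k, 'm) ring_scheme \<Rightarrow> ('k, 'u) module \<Rightarrow> ('k, 'u) module \<Rightarrow> ('u \<Rightarrow> 'u) set" where
  "alg_hom K A B = {f \<in> ring_hom A B.
     \<forall>c\<in>carrier K. \<forall>a\<in>carrier A. f (c \<odot>\<^bsub>A\<^esub> a) = c \<odot>\<^bsub>B\<^esub> f a}"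

section \<open>Functors of points\<close>

text \<open>
  The map \<open>X(A) \<rightarrow> X(B)\<close> induced by \<open>f\<close> is \<open>mor X f\<close>. Functions representing algebra
  homomorphisms are only relevant on the carrier of their domain, so the functor laws are stated
  for functions that agree there.
\<close>

record ('k, 'u, 'x) set_functor =
  pts :: "('k, 'u) module \<Rightarrow> 'x set"
  mor :: "('u \<Rightarrow> 'u) \<Rightarrow> 'x \<Rightarrow> 'x"

definition is_set_functor ::
  "('k, 'm) ring_scheme \<Rightarrow> ('k, 'u, 'x) set_functor \<Rightarrow> bool" where
  "is_set_functor K X \<longleftrightarrow>
     (\<forall>A B f. algebra K A \<longrightarrow> algebra K B \<longrightarrow> f \<in> alg_hom K A B \<longrightarrow>
        mor X f \<in> pts X A \<rightarrow> pts X B) \<and>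
     (\<forall>A f x. algebra K A \<longrightarrow> f \<in> alg_hom K A A \<longrightarrow> (\<forall>a\<in>carrier A. f a = a) \<longrightarrow>
        x \<in> pts X A \<longrightarrow> mor X f x = x) \<and>
     (\<forall>A B C f g h x. algebra K A \<longrightarrow> algebra K B \<longrightarrow> algebra K C \<longrightarrow>
        f \<in> alg_hom K A B \<longrightarrow> g \<in> alg_hom K B C \<longrightarrow> h \<in> alg_hom K A C \<longrightarrow>
        (\<forall>a\<in>carrier A. h a = g (f a)) \<longrightarrow> x \<in> pts X A \<longrightarrow> mor X h x = mor X g (mor X f x))"

text \<open>
  \<open>X\<close> is represented by \<open>B\<close> with universal point \<open>\<xi>\<close>, that is, \<open>X = Spec B\<close>.
\<close>

definition is_affine_scheme ::
  "('k, 'm) ring_scheme \<Rightarrow> ('k, 'u, 'x) set_functor \<Rightarrow> bool" where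
  "is_affine_scheme K X \<longleftrightarrow> is_set_functor K X \<and>
     (\<exists>B \<xi>. algebra K B \<and> \<xi> \<in> pts X B \<and>
        (\<forall>A x. algebra K A \<longrightarrow> x \<in> pts X A \<longrightarrow>
           (\<exists>f\<in>alg_hom K B A. mor X f \<xi> = x \<and>
              (\<forall>g\<in>alg_hom K B A. mor X g \<xi> = x \<longrightarrow> (\<forall>b\<in>carrier B. g b = f b)))))"

definition prod_functor ::
  "('k, 'u, 'x) set_functor \<Rightarrow> ('k, 'u, 'y) set_functor \<Rightarrow> ('k, 'u, 'x \<times> 'y) set_functor" where
  "prod_functor X Y = \<lparr>pts = (\<lambda>A. pts X A \<times> pts Y A), mor = (\<lambda>f. map_prod (mor X f) (mor Y f))\<rparr>"

definition nat_trans ::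
  "('k, 'm) ring_scheme \<Rightarrow> ('k, 'u, 'x) set_functor \<Rightarrow> ('k, 'u, 'y) set_functor \<Rightarrow>
   (('k, 'u) module \<Rightarrow> 'x \<Rightarrow> 'y) \<Rightarrow> bool" where
  "nat_trans K X Y \<tau> \<longleftrightarrow>
     (\<forall>A. algebra K A \<longrightarrow> \<tau> A \<in> pts X A \<rightarrow> pts Y A) \<and>
     (\<forall>A B f x. algebra K A \<longrightarrow> algebra K B \<longrightarrow> f \<in> alg_hom K A B \<longrightarrow> x \<in> pts X A \<longrightarrow>
        \<tau> B (mor X f x) = mor Y f (\<tau> A x))"

record ('k, 'u, 'x) group_functor =
  grp :: "('k, 'u) module \<Rightarrow> 'x monoid"
  gmor :: "('u \<Rightarrow> 'u) \<Rightarrow> 'x \<Rightarrow> 'x"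

definition underlying :: "('k, 'u, 'x) group_functor \<Rightarrow> ('k, 'u, 'x) set_functor" where
  "underlying G = \<lparr>pts = (\<lambda>A. carrier (grp G A)), mor = gmor G\<rparr>"

definition is_affine_group_scheme ::
  "('k, 'm) ring_scheme \<Rightarrow> ('k, 'u, 'x) group_functor \<Rightarrow> bool" where
  "is_affine_group_scheme K G \<longleftrightarrow> is_affine_scheme K (underlying G) \<and>
     (\<forall>A. algebra K A \<longrightarrow> group (grp G A)) \<and>
     (\<forall>A B f. algebra K A \<longrightarrow> algebra K B \<longrightarrow> f \<in> alg_hom K A B \<longrightarrow>
        gmor G f \<in> hom (grp G A) (grp G B))"

section \<open>Faithfully flat homomorphisms\<close>

text \<open>
  Flatness is expressed without tensor products: every linear relation with coefficients in
  \<open>A\<close> between elements of \<open>B\<close> is a consequence of relations in \<open>A\<close> (the equational criterion).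
  Given flatness, faithfulness means that \<open>\<mm>B \<noteq> B\<close> for all maximal ideals \<open>\<mm>\<close> of \<open>A\<close>.
\<close>

definition flat_hom :: "('a, 'm) ring_scheme \<Rightarrow> ('b, 'n) ring_scheme \<Rightarrow> ('a \<Rightarrow> 'b) \<Rightarrow> bool" where
  "flat_hom A B f \<longleftrightarrow> f \<in> ring_hom A B \<and>
     (\<forall>(n::nat) r b. r \<in> {..<n} \<rightarrow> carrier A \<longrightarrow> b \<in> {..<n} \<rightarrow> carrier B \<longrightarrow>
        (\<Oplus>\<^bsub>B\<^esub>i\<in>{..<n}. f (r i) \<otimes>\<^bsub>B\<^esub> b i) = \<zero>\<^bsub>B\<^esub> \<longrightarrow>
        (\<exists>(m::nat) c d. (\<forall>i<n. \<forall>j<m. c i j \<in> carrier A) \<and> d \<in> {..<m} \<rightarrow> carrier B \<and>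
           (\<forall>i<n. b i = (\<Oplus>\<^bsub>B\<^esub>j\<in>{..<m}. f (c i j) \<otimes>\<^bsub>B\<^esub> d j)) \<and>
           (\<forall>j<m. (\<Oplus>\<^bsub>A\<^esub>i\<in>{..<n}. r i \<otimes>\<^bsub>A\<^esub> c i j) = \<zero>\<^bsub>A\<^esub>)))"

definition faithfully_flat_hom ::
  "('a, 'm) ring_scheme \<Rightarrow> ('b, 'n) ring_scheme \<Rightarrow> ('a \<Rightarrow> 'b) \<Rightarrow> bool" where
  "faithfully_flat_hom A B f \<longleftrightarrow> flat_hom A B f \<and>
     (\<forall>M. maximalideal M A \<longrightarrow> Idl\<^bsub>B\<^esub> (f ` M) \<noteq> carrier B)"

definition flat_cover ::
  "('k, 'm) ring_scheme \<Rightarrow> ('k, 'u) module \<Rightarrow> ('k, 'u) module \<Rightarrow> ('u \<Rightarrow> 'u) \<Rightarrow> bool" where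
  "flat_cover K A B f \<longleftrightarrow> algebra K B \<and> f \<in> alg_hom K A B \<and> faithfully_flat_hom A B f"

section \<open>Actions, torsors, quotients and twists\<close>

definition is_action ::
  "('k, 'm) ring_scheme \<Rightarrow> ('k, 'u, 'g) group_functor \<Rightarrow> ('k, 'u, 'x) set_functor \<Rightarrow>
   (('k, 'u) module \<Rightarrow> 'g \<Rightarrow> 'x \<Rightarrow> 'x) \<Rightarrow> bool" where
  "is_action K G X act \<longleftrightarrow>
     nat_trans K (prod_functor (underlying G) X) X (\<lambda>A (g, x). act A g x) \<and>
     (\<forall>A x. algebra K A \<longrightarrow> x \<in> pts X A \<longrightarrow> act A \<one>\<^bsub>grp G A\<^esub> x = x) \<and>
     (\<forall>A g h x. algebra K A \<longrightarrow> g \<in> carrier (grp G A) \<longrightarrow> h \<in> carrier (grp G A) \<longrightarrow>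
        x \<in> pts X A \<longrightarrow> act A (g \<otimes>\<^bsub>grp G A\<^esub> h) x = act A g (act A h x))"

definition acts_by_group_automorphisms ::
  "('k, 'm) ring_scheme \<Rightarrow> ('k, 'u, 'g) group_functor \<Rightarrow> ('k, 'u, 'x) group_functor \<Rightarrow>
   (('k, 'u) module \<Rightarrow> 'g \<Rightarrow> 'x \<Rightarrow> 'x) \<Rightarrow> bool" where
  "acts_by_group_automorphisms K G H act \<longleftrightarrow> is_action K G (underlying H) act \<and>
     (\<forall>A. algebra K A \<longrightarrow> (\<forall>g\<in>carrier (grp G A). act A g \<in> iso (grp H A) (grp H A)))"

definition is_torsor ::
  "('k, 'm) ring_scheme \<Rightarrow> ('k, 'u, 'g) group_functor \<Rightarrow> ('k, 'u, 'x) set_functor \<Rightarrow>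
   (('k, 'u) module \<Rightarrow> 'g \<Rightarrow> 'x \<Rightarrow> 'x) \<Rightarrow> bool" where
  "is_torsor K G P act \<longleftrightarrow>
     is_affine_group_scheme K G \<and> is_affine_scheme K P \<and> is_action K G P act \<and>
     (\<forall>A. algebra K A \<longrightarrow>
        (\<forall>x\<in>pts P A. \<forall>y\<in>pts P A. \<exists>!g. g \<in> carrier (grp G A) \<and> act A g x = y)) \<and>
     (\<forall>A. algebra K A \<longrightarrow> (\<exists>B f. flat_cover K A B f \<and> pts P B \<noteq> {}))"

text \<open>
  \<open>Q\<close> together with \<open>\<pi>\<close> is the quotient \<open>G\X\<close> in the sense of sheaves for the faithfully flat
  topology: affine schemes are sheaves, and \<open>\<pi>\<close> exhibits \<open>Q\<close> as the sheaf associated with the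
  presheaf of orbits \<open>A \<mapsto> G(A)\X(A)\<close>. This determines \<open>(Q, \<pi>)\<close> up to unique isomorphism.
\<close>

definition is_quotient ::
  "('k, 'm) ring_scheme \<Rightarrow> ('k, 'u, 'g) group_functor \<Rightarrow> ('k, 'u, 'x) set_functor \<Rightarrow>
   (('k, 'u) module \<Rightarrow> 'g \<Rightarrow> 'x \<Rightarrow> 'x) \<Rightarrow> ('k, 'u, 'q) set_functor \<Rightarrow>
   (('k, 'u) module \<Rightarrow> 'x \<Rightarrow> 'q) \<Rightarrow> bool" where
  "is_quotient K G X act Q \<pi> \<longleftrightarrow>
     is_action K G X act \<and> is_affine_scheme K Q \<and> nat_trans K X Q \<pi> \<and>
     (\<forall>A. algebra K A \<longrightarrow>
        (\<forall>g\<in>carrier (grp G A). \<forall>x\<in>pts X A. \<pi> A (act A g x) = \<pi> A x)) \<and>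
     (\<forall>A. algebra K A \<longrightarrow> (\<forall>x\<in>pts X A. \<forall>y\<in>pts X A. \<pi> A x = \<pi> A y \<longrightarrow>
        (\<exists>B f. flat_cover K A B f \<and>
           (\<exists>g\<in>carrier (grp G B). act B g (mor X f x) = mor X f y)))) \<and>
     (\<forall>A. algebra K A \<longrightarrow> (\<forall>q\<in>pts Q A.
        (\<exists>B f. flat_cover K A B f \<and> (\<exists>x\<in>pts X B. \<pi> B x = mor Q f q))))"

text \<open>
  For a \<open>G\<close>-torsor \<open>P\<close> and a group scheme \<open>H\<close> on which \<open>G\<close> acts by automorphisms,
  the twist \<open>G\(P \<times> H)\<close> is the quotient by the diagonal action. Its group law is the one for
  which \<open>H(A) \<rightarrow> T(A)\<close>, \<open>a \<mapsto> \<pi>(s, a)\<close>, is a homomorphism for every \<open>s \<in> P(A)\<close>. Being a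
  quotient, the twist is only defined up to isomorphism of group schemes, so the predicate below
  says that \<open>T\<close> is isomorphic to it.
\<close>

definition is_twist ::
  "('k, 'm) ring_scheme \<Rightarrow> ('k, 'u, 'g) group_functor \<Rightarrow>
   ('k, 'u, 'x) set_functor \<Rightarrow> (('k, 'u) module \<Rightarrow> 'g \<Rightarrow> 'x \<Rightarrow> 'x) \<Rightarrow>
   ('k, 'u, 'y) group_functor \<Rightarrow> (('k, 'u) module \<Rightarrow> 'g \<Rightarrow> 'y \<Rightarrow> 'y) \<Rightarrow>
   ('k, 'u, 't) group_functor \<Rightarrow> bool" where
  "is_twist K G P actP H actH T \<longleftrightarrow>
     is_torsor K G P actP \<and>
     is_affine_group_scheme K H \<and> acts_by_group_automorphisms K G H actH \<and>
     is_affine_group_scheme K T \<and>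
     (\<exists>\<pi>. is_quotient K G (prod_functor P (underlying H))
            (\<lambda>A g (s, a). (actP A g s, actH A g a)) (underlying T) \<pi> \<and>
          (\<forall>A. algebra K A \<longrightarrow> (\<forall>s\<in>pts P A. (\<lambda>a. \<pi> A (s, a)) \<in> hom (grp H A) (grp T A))))"

section \<open>The additive group, its subgroup schemes, and \<open>U\<^sub>2\<close>\<close>

definition add_group :: "('a, 'm) ring_scheme \<Rightarrow> 'a monoid" where
  "add_group R = \<lparr>carrier = carrier R, monoid.mult = add R, one = zero R\<rparr>"

definition Ga :: "('k, 'u, 'u) group_functor" where
  "Ga = \<lparr>grp = add_group, gmor = (\<lambda>f. f)\<rparr>"

definition additive_poly :: "nat \<Rightarrow> ('k, 'm) ring_scheme \<Rightarrow> (nat \<Rightarrow> 'k) \<Rightarrow> bool" where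
  "additive_poly p K \<Phi> \<longleftrightarrow> \<Phi> \<in> carrier (UP K) \<and>
     (\<forall>n. coeff (UP K) \<Phi> n \<noteq> \<zero>\<^bsub>K\<^esub> \<longrightarrow> (\<exists>i. n = p ^ i))"

definition eval_in ::
  "('k, 'm) ring_scheme \<Rightarrow> ('k, 'u) module \<Rightarrow> (nat \<Rightarrow> 'k) \<Rightarrow> 'u \<Rightarrow> 'u" where
  "eval_in K A \<Phi> u = eval K A (\<lambda>c. c \<odot>\<^bsub>A\<^esub> \<one>\<^bsub>A\<^esub>) u \<Phi>"

definition U_ker ::
  "('k, 'm) ring_scheme \<Rightarrow> (nat \<Rightarrow> 'k) \<Rightarrow> (nat \<Rightarrow> 'k) \<Rightarrow> ('k, 'u, 'u \<times> 'u) group_functor" where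
  "U_ker K \<Phi> \<Psi> = \<lparr>
     grp = (\<lambda>A. (add_group A \<times>\<times> add_group A)
       \<lparr>carrier := kernel (add_group A \<times>\<times> add_group A) (add_group A)
          (\<lambda>(u, v). eval_in K A \<Phi> u \<ominus>\<^bsub>A\<^esub> eval_in K A \<Psi> v)\<rparr>),
     gmor = (\<lambda>f. map_prod f f)\<rparr>"

text \<open>
  The skew polynomial ring \<open>R[F;\<sigma>]\<close> with \<open>F \<lambda> = \<lambda>\<^sup>p F\<close>; the function \<open>a\<close> stands for
  \<open>\<Sum>i. a i F\<^sup>i\<close> with the coefficients on the left.
\<close>

definition skew_poly_ring :: "nat \<Rightarrow> ('a, 'm) ring_scheme \<Rightarrow> (nat \<Rightarrow> 'a) ring" where
  "skew_poly_ring p R = \<lparr>carrier = up R,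
     monoid.mult = (\<lambda>a b n. \<Oplus>\<^bsub>R\<^esub>i\<in>{..n}. a i \<otimes>\<^bsub>R\<^esub> b (n - i) [^]\<^bsub>R\<^esub> (p ^ i)),
     one = (\<lambda>i. if i = 0 then \<one>\<^bsub>R\<^esub> else \<zero>\<^bsub>R\<^esub>),
     zero = (\<lambda>i. \<zero>\<^bsub>R\<^esub>),
     add = (\<lambda>a b i. a i \<oplus>\<^bsub>R\<^esub> b i)\<rparr>"

definition U2_elem :: "('a, 'm) ring_scheme \<Rightarrow> 'a \<Rightarrow> 'a \<Rightarrow> nat \<Rightarrow> 'a" where
  "U2_elem R l1 l2 =
     (\<lambda>i. if i = 0 then \<one>\<^bsub>R\<^esub> else if i = 1 then l1 else if i = 2 then l2 else \<zero>\<^bsub>R\<^esub>)"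

definition U2 :: "nat \<Rightarrow> ('k, 'u, nat \<Rightarrow> 'u) group_functor" where
  "U2 p = \<lparr>
     grp = (\<lambda>A. (units_of (skew_poly_ring p A))
       \<lparr>carrier := {U2_elem A l1 l2 | l1 l2. l1 \<in> carrier A \<and> l2 \<in> carrier A \<and>
          l1 [^]\<^bsub>A\<^esub> (p ^ 2) = \<zero>\<^bsub>A\<^esub> \<and> l2 [^]\<^bsub>A\<^esub> p = \<zero>\<^bsub>A\<^esub>}\<rparr>),
     gmor = (\<lambda>f a. f \<circ> a)\<rparr>"

text \<open>In the two actions below, \<open>(g 1, g 2)\<close> are the coordinates \<open>(\<lambda>\<^sub>1, \<lambda>\<^sub>2)\<close> of \<open>g\<close>.\<close>

definition U2_act_Ga :: "nat \<Rightarrow> ('k, 'u) module \<Rightarrow> (nat \<Rightarrow> 'u) \<Rightarrow> 'u \<Rightarrow> 'u" where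
  "U2_act_Ga p A g x =
     x \<oplus>\<^bsub>A\<^esub> g 1 \<otimes>\<^bsub>A\<^esub> x [^]\<^bsub>A\<^esub> p \<oplus>\<^bsub>A\<^esub> g 2 \<otimes>\<^bsub>A\<^esub> x [^]\<^bsub>A\<^esub> (p ^ 2)"

definition P_torsor :: "nat \<Rightarrow> 'k \<Rightarrow> 'k \<Rightarrow> ('k, 'u, 'u \<times> 'u) set_functor" where
  "P_torsor p \<alpha> \<beta> = \<lparr>
     pts = (\<lambda>A. {(y, z). y \<in> carrier A \<and> z \<in> carrier A \<and>
       y [^]\<^bsub>A\<^esub> (p ^ 2) = \<alpha> \<odot>\<^bsub>A\<^esub> \<one>\<^bsub>A\<^esub> \<and>
       z [^]\<^bsub>A\<^esub> p = \<beta> \<odot>\<^bsub>A\<^esub> \<one>\<^bsub>A\<^esub> \<oplus>\<^bsub>A\<^esub> \<alpha> \<odot>\<^bsub>A\<^esub> (y [^]\<^bsub>A\<^esub> p)}),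
     mor = (\<lambda>f. map_prod f f)\<rparr>"

definition U2_act_P :: "nat \<Rightarrow> ('k, 'u) module \<Rightarrow> (nat \<Rightarrow> 'u) \<Rightarrow> 'u \<times> 'u \<Rightarrow> 'u \<times> 'u" where
  "U2_act_P p A g = (\<lambda>(y, z). (g 1 \<oplus>\<^bsub>A\<^esub> y, g 2 \<oplus>\<^bsub>A\<^esub> z \<oplus>\<^bsub>A\<^esub> g 1 \<otimes>\<^bsub>A\<^esub> y [^]\<^bsub>A\<^esub> p))"

end

theory Submission
  imports Defs "HOL-Algebra.Multiplicative_Group" "HOL-Algebra.Weak_Morphisms"
begin

text \<open>
  Regard a point \<open>(y, z)\<close> of \<open>P\<close> as the operator \<open>s = 1 + y F + z F\<^sup>2\<close>, so that \<open>U\<^sub>2\<close> acts on \<open>s\<close>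
  and on \<open>x\<close> by left multiplication. Then \<open>x\<^bsup>p^2\<^esup>\<close> and
  \<open>s\<^sup>-\<^sup>1 x = x - y x\<^sup>p + (y\<^bsup>p+1\<^esup> - z) x\<^bsup>p^2\<^esup>\<close> (truncated after \<open>F\<^sup>2\<close>) are invariants of
  \<open>P \<times> G\<^sub>a\<close>. With \<open>u\<close> the second and \<open>v\<close> the first, raising \<open>u\<close> to the power \<open>p\<^sup>2\<close> gives
  \<open>u\<^bsup>p^2\<^esup> = v - \<alpha> v\<^sup>p - \<beta>\<^sup>p v\<^bsup>p^2\<^esup>\<close>. For a fixed point of \<open>P\<close> the map
  \<open>x \<mapsto> (u, v)\<close> is bijective onto \<open>U\<^bsub>\<Phi>,\<Psi>\<^esub>\<close>, with inverse \<open>x = u + y u\<^sup>p + z v + \<beta> y v\<^sup>p\<close>; as \<open>P\<close>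
  has points after a finite free extension, this identifies the quotient by \<open>U\<^sub>2\<close>.
\<close>

section \<open>Identities in characteristic \<open>p\<close>\<close>

text \<open>Two obstacles lie outside the algebra of the overview. Every algebra has its carrier in
  the fixed type \<open>'u\<close>, so the representing algebras and the extensions that split P
  must be built from elements of \<open>'u\<close>; injective encodings of terms and of coefficient
  tuples provide them. And flatness is given by the equational criterion, so only extensions with an
  explicit finite basis are used, where linear relations can be compared coordinate by coordinate.
  The operator s is not a point of U_2, so its inverse in R[F;\<sigma>] may have terms beyond F^2.
  Cutting them off keeps invariance, because g = 1 + lF + mF^2 in U_2 satisfies F g = F + l^p F^2
  and F^2 g = F^2: right multiplication by g keeps the degree at most 2. The polynomial \<Psi>
  records the p^2-th powers of the coefficients of s^-1: y gives \<alpha>, and y^(p+1) - z gives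
  \<alpha>^(p+1) - (\<beta>^p + \<alpha>^(p+1)) = -\<beta>^p.\<close>

lemma (in cring) binomial_ring:
  assumes x: "x \<in> carrier R" and y: "y \<in> carrier R"
  shows "(x \<oplus> y) [^] (n::nat) =
    (\<Oplus>k\<in>{..n}. [(n choose k)] \<cdot>\<^bsub>R\<^esub> (x [^] k \<otimes> y [^] (n - k)))"
proof (induction n)
  case 0
  show ?case by simp
next
  case (Suc n)
  let ?t = "\<lambda>n k. [(n choose k)] \<cdot>\<^bsub>R\<^esub> (x [^] k \<otimes> y [^] (n - k))"
  have x_part: "(\<Oplus>k\<in>{..n}. ?t n k) \<otimes> x = (\<Oplus>k\<in>{..n}. [(n choose k)] \<cdot>\<^bsub>R\<^esub> (x [^] Suc k \<otimes> y [^] (Suc n - Suc k)))"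
    using x y by (subst finsum_ldistr) (auto intro!: finsum_cong' simp: add_pow_rdistr m_ac)
  have y_part: "(\<Oplus>k\<in>{..n}. ?t n k) \<otimes> y = (\<Oplus>k\<in>{..n}. [(n choose k)] \<cdot>\<^bsub>R\<^esub> (x [^] k \<otimes> y [^] (Suc n - k)))"
    using x y by (subst finsum_ldistr) (auto intro!: finsum_cong' simp: add_pow_ldistr m_assoc Suc_diff_le)
  \<comment> \<open>The term k = n + 1 is added for free, its binomial coefficient being 0, and the
    term k = 0 is split off at the other end; after this shift Pascal's rule applies summand by
    summand.\<close>
  have y_shift: "(\<Oplus>k\<in>{..n}. [(n choose k)] \<cdot>\<^bsub>R\<^esub> (x [^] k \<otimes> y [^] (Suc n - k))) =
    (\<Oplus>k\<in>{..n}. [(n choose Suc k)] \<cdot>\<^bsub>R\<^esub> (x [^] Suc k \<otimes> y [^] (Suc n - Suc k))) \<oplus> y [^] Suc n"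
  proof -
    have "(\<Oplus>k\<in>{..n}. [(n choose k)] \<cdot>\<^bsub>R\<^esub> (x [^] k \<otimes> y [^] (Suc n - k))) =
      (\<Oplus>k\<in>{..Suc n}. [(n choose k)] \<cdot>\<^bsub>R\<^esub> (x [^] k \<otimes> y [^] (Suc n - k)))"
      using x y by (subst finsum_Suc) (auto simp: binomial_eq_0)
    also have "\<dots> = (\<Oplus>k\<in>{..n}. [(n choose Suc k)] \<cdot>\<^bsub>R\<^esub> (x [^] Suc k \<otimes> y [^] (Suc n - Suc k))) \<oplus>
      [(n choose 0)] \<cdot>\<^bsub>R\<^esub> (x [^] (0::nat) \<otimes> y [^] (Suc n - 0))"
      using x y by (subst finsum_Suc2) auto
    finally show ?thesis using x y by simp
  qed
  have "(x \<oplus> y) [^] Suc n = (\<Oplus>k\<in>{..n}. ?t n k) \<otimes> x \<oplus> (\<Oplus>k\<in>{..n}. ?t n k) \<otimes> y"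
    using x y Suc by (simp add: r_distr)
  also have "\<dots> = (\<Oplus>k\<in>{..n}. [(n choose k)] \<cdot>\<^bsub>R\<^esub> (x [^] Suc k \<otimes> y [^] (Suc n - Suc k)) \<oplus>
      [(n choose Suc k)] \<cdot>\<^bsub>R\<^esub> (x [^] Suc k \<otimes> y [^] (Suc n - Suc k))) \<oplus> y [^] Suc n"
    unfolding x_part y_part y_shift using x y by (subst finsum_addf) (auto simp: a_assoc)
  also have "\<dots> = (\<Oplus>k\<in>{..n}. ?t (Suc n) (Suc k)) \<oplus> ?t (Suc n) 0"
    using x y by (auto intro!: arg_cong2[where f = "(\<oplus>)"] finsum_cong' simp: add.nat_pow_mult)
  also have "\<dots> = (\<Oplus>k\<in>{..Suc n}. ?t (Suc n) k)"
    using x y by (subst finsum_Suc2) auto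
  finally show ?case .
qed

lemma (in ring) add_pow_dvd_eq_zero:
  assumes "[(p::nat)] \<cdot>\<^bsub>R\<^esub> \<one> = \<zero>" "x \<in> carrier R" "p dvd (n::nat)"
  shows "[n] \<cdot>\<^bsub>R\<^esub> x = \<zero>"
proof -
  obtain k where "n = p * k" using assms(3) by auto
  moreover have "[p] \<cdot>\<^bsub>R\<^esub> ([k] \<cdot>\<^bsub>R\<^esub> x) = ([p] \<cdot>\<^bsub>R\<^esub> \<one>) \<otimes> ([k] \<cdot>\<^bsub>R\<^esub> x)"
    using assms(2) by (simp add: add_pow_ldistr)
  ultimately show ?thesis using assms(1,2) by (simp add: add.nat_pow_pow mult.commute)
qed

lemma (in cring) frobenius_add:
  assumes p: "prime (p::nat)" "[p] \<cdot>\<^bsub>R\<^esub> \<one> = \<zero>" and x: "x \<in> carrier R" and y: "y \<in> carrier R"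
  shows "(x \<oplus> y) [^] p = x [^] p \<oplus> y [^] p"
proof -
  \<comment> \<open>With p = q + 2, the inner terms k = 1, ..., p - 1 are indexed by
    \<open>Suc k\<close> for k \<le> q; their binomial coefficients are divisible by p.\<close>
  obtain q where q: "p = Suc (Suc q)"
    using prime_ge_2_nat[OF p(1)] by (metis add_2_eq_Suc le_Suc_ex)
  let ?t = "\<lambda>k. [(p choose k)] \<cdot>\<^bsub>R\<^esub> (x [^] k \<otimes> y [^] (p - k))"
  have van: "(\<Oplus>k\<in>{..q}. ?t (Suc k)) = \<zero>"
  proof -
    have "(\<Oplus>k\<in>{..q}. ?t (Suc k)) = (\<Oplus>k\<in>{..q}. \<zero>)"
      using x y p q by (intro finsum_cong' add_pow_dvd_eq_zero[OF p(2)] dvd_choose_prime) auto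
    then show ?thesis by simp
  qed
  have "(x \<oplus> y) [^] p = (\<Oplus>k\<in>{..Suc (Suc q)}. ?t k)"
    using binomial_ring[OF x y, of p] q by simp
  also have "\<dots> = ?t p \<oplus> (\<Oplus>k\<in>{..Suc q}. ?t k)"
    using x y unfolding q by (subst finsum_Suc) auto
  also have "(\<Oplus>k\<in>{..Suc q}. ?t k) = (\<Oplus>k\<in>{..q}. ?t (Suc k)) \<oplus> ?t 0"
    using x y by (subst finsum_Suc2) auto
  finally show ?thesis using x y van by simp
qed

lemma (in ring) eq_if_diff: "x \<in> carrier R \<Longrightarrow> y \<in> carrier R \<Longrightarrow> x \<ominus> y = \<zero> \<Longrightarrow> x = y"
  by simp

section \<open>Rings of characteristic p, with U_2, P and the invariants in coordinates\<close>

locale char_p_ring = cring +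
  fixes p :: nat
  assumes prime_p: "prime p" and char_p: "[p] \<cdot>\<^bsub>R\<^esub> \<one> = \<zero>"
begin

lemma p_pos: "p > 0"
  using prime_p by (simp add: prime_gt_0_nat)

lemma frob_add: "x \<in> carrier R \<Longrightarrow> y \<in> carrier R \<Longrightarrow> (x \<oplus> y) [^] p = x [^] p \<oplus> y [^] p"
  using frobenius_add[OF prime_p char_p] .

lemma frob_zero: "\<zero> [^] p = \<zero>"
  using p_pos by (simp add: nat_pow_zero)

lemma frob_minus:
  assumes "x \<in> carrier R"
  shows "(\<ominus> x) [^] p = \<ominus> (x [^] p)"
proof -
  have "(\<ominus> x) [^] p \<oplus> x [^] p = \<zero>"
    using assms frob_zero by (simp add: frob_add[symmetric] l_neg)
  then show ?thesis using assms by (intro minus_equality[symmetric]) auto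
qed

lemma frob_diff: "x \<in> carrier R \<Longrightarrow> y \<in> carrier R \<Longrightarrow> (x \<ominus> y) [^] p = x [^] p \<ominus> y [^] p"
  by (simp add: a_minus_def frob_add frob_minus)

lemma frob_mult: "x \<in> carrier R \<Longrightarrow> y \<in> carrier R \<Longrightarrow> (x \<otimes> y) [^] p = x [^] p \<otimes> y [^] p"
  by (rule nat_pow_distrib)

lemma pow_p2: "x \<in> carrier R \<Longrightarrow> x [^] (p ^ 2) = (x [^] p) [^] p"
  using nat_pow_pow[of x p p] monoid_mult_class.power2_eq_square[of p] by (simp only:)

text \<open>\<open>pow_p2\<close> splits the exponent \<open>p ^ 2\<close> into two Frobenius steps,
  on which the other rules act.\<close>

lemmas frob_simps = pow_p2 frob_add frob_diff frob_minus frob_mult frob_zero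

text \<open>Points of \<open>U\<^sub>2\<close> and of the torsor in coordinates; \<open>a\<close> and \<open>b\<close> are the images of \<open>\<alpha>\<close> and \<open>\<beta>\<close>.\<close>

definition u2_pt :: "'a \<Rightarrow> 'a \<Rightarrow> bool" where
  "u2_pt l m \<longleftrightarrow> l \<in> carrier R \<and> m \<in> carrier R \<and> l [^] (p ^ 2) = \<zero> \<and> m [^] p = \<zero>"

definition torsor_pt :: "'a \<Rightarrow> 'a \<Rightarrow> 'a \<Rightarrow> 'a \<Rightarrow> bool" where
  "torsor_pt a b y z \<longleftrightarrow> y \<in> carrier R \<and> z \<in> carrier R \<and>
     y [^] (p ^ 2) = a \<and> z [^] p = b \<oplus> a \<otimes> y [^] p"

definition u2_act :: "'a \<Rightarrow> 'a \<Rightarrow> 'a \<Rightarrow> 'a" where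
  "u2_act l m x = x \<oplus> l \<otimes> x [^] p \<oplus> m \<otimes> x [^] (p ^ 2)"

definition proj_u :: "'a \<Rightarrow> 'a \<Rightarrow> 'a \<Rightarrow> 'a" where
  "proj_u y z x = x \<ominus> y \<otimes> x [^] p \<oplus> (y \<otimes> y [^] p \<ominus> z) \<otimes> x [^] (p ^ 2)"

text \<open>\<open>lift_x b y z\<close> inverts \<open>x \<mapsto> (proj_u y z x, x\<^bsup>p^2\<^esup>)\<close>: solve \<open>u = proj_u y z x\<close> for \<open>x\<close>, with
  \<open>x\<^sup>p = u\<^sup>p + y\<^sup>p v + b v\<^sup>p\<close> and \<open>v = x\<^bsup>p^2\<^esup>\<close>.\<close>

definition lift_x :: "'a \<Rightarrow> 'a \<Rightarrow> 'a \<Rightarrow> 'a \<Rightarrow> 'a \<Rightarrow> 'a" where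
  "lift_x b y z u v = u \<oplus> y \<otimes> u [^] p \<oplus> z \<otimes> v \<oplus> b \<otimes> y \<otimes> v [^] p"

text \<open>The pair is read off from (1 + lF + mF^2)(1 + l'F + m'F^2) with F l' = l'^p F. The new
  summand l l'^p has p-th power l^p l'^(p^2) = 0, so the condition on the second coordinate
  persists.\<close>

lemma u2_pt_mult:
  assumes "u2_pt l m" "u2_pt l' m'"
  shows "u2_pt (l \<oplus> l') (m \<oplus> m' \<oplus> l \<otimes> l' [^] p)"
  using assms by (auto simp: u2_pt_def frob_simps)

text \<open>The coefficients come from 1 - (lF + mF^2) + (lF)^2, the geometric series for the
  inverse up to degree 2; here l^(p+1) has p-th power l^p l^(p^2) = 0.\<close>

lemma u2_pt_inv:
  assumes "u2_pt l m"
  shows "u2_pt (\<ominus> l) (l \<otimes> l [^] p \<ominus> m)"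
  using assms by (auto simp: u2_pt_def frob_simps a_minus_def)

lemma u2_pt_zero: "u2_pt \<zero> \<zero>"
  by (simp add: u2_pt_def frob_simps)

text \<open>The second equation of P has the right shape for this: (l y^p)^p = l^p y^(p^2) = a l^p
  is exactly the change of a y^p when y moves to l + y.\<close>

lemma torsor_pt_act:
  assumes "u2_pt l m" "torsor_pt a b y z" "a \<in> carrier R" "b \<in> carrier R"
  shows "torsor_pt a b (l \<oplus> y) (m \<oplus> z \<oplus> l \<otimes> y [^] p)"
  using assms by (auto simp: u2_pt_def torsor_pt_def frob_simps r_distr m_comm a_ac)

text \<open>Solving the action formulas for the group element that carries (y, z) to (y', z') gives
  these coordinates. In the p-th power of the second one, the difference a (y'^p - y^p) of the two
  torsor equations cancels against ((y' - y) y^p)^p.\<close>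

lemma torsor_pt_diff:
  assumes "torsor_pt a b y z" "torsor_pt a b y' z'" "a \<in> carrier R" "b \<in> carrier R"
  shows "u2_pt (y' \<ominus> y) (z' \<ominus> z \<ominus> (y' \<ominus> y) \<otimes> y [^] p)"
proof -
  have c: "y \<in> carrier R" "z \<in> carrier R" "y' \<in> carrier R" "z' \<in> carrier R"
    and e: "(y [^] p) [^] p = a" "(y' [^] p) [^] p = a"
      "z [^] p = b \<oplus> a \<otimes> y [^] p" "z' [^] p = b \<oplus> a \<otimes> y' [^] p"
    using assms by (auto simp: torsor_pt_def pow_p2)
  \<comment> \<open>The powers y^p and y'^p are generalised to variables, which leaves a polynomial
    identity of low degree for \<open>algebra\<close>; the same device serves in the lemmas
    below.\<close>
  have id: "b \<oplus> a \<otimes> Y' \<ominus> (b \<oplus> a \<otimes> Y) \<ominus> (Y' \<ominus> Y) \<otimes> a = \<zero>"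
    if "Y \<in> carrier R" "Y' \<in> carrier R" for Y Y'
    using that assms(3,4) by algebra
  show ?thesis
    using c e assms(3,4) id[of "y [^] p" "y' [^] p"]
    by (simp add: u2_pt_def frob_simps)
qed

lemma u2_act_closed [simp]:
  "l \<in> carrier R \<Longrightarrow> m \<in> carrier R \<Longrightarrow> x \<in> carrier R \<Longrightarrow> u2_act l m x \<in> carrier R"
  by (simp add: u2_act_def)

lemma u2_act_add:
  assumes "l \<in> carrier R" "m \<in> carrier R" "x \<in> carrier R" "x' \<in> carrier R"
  shows "u2_act l m (x \<oplus> x') = u2_act l m x \<oplus> u2_act l m x'"
  using assms by (simp add: u2_act_def frob_simps r_distr a_ac)

text \<open>In the skew ring this is F g = F + l^p F^2 and F^2 g = F^2, from m^p = 0 and l^(p^2) =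
  0.\<close>

lemma u2_act_frob:
  assumes "u2_pt l m" "x \<in> carrier R"
  shows "u2_act l m x [^] p = x [^] p \<oplus> l [^] p \<otimes> x [^] (p ^ 2)"
    and "u2_act l m x [^] (p ^ 2) = x [^] (p ^ 2)"
  using assms by (auto simp: u2_act_def u2_pt_def frob_simps)

lemma u2_act_mult:
  assumes "u2_pt l m" "u2_pt l' m'" "x \<in> carrier R"
  shows "u2_act l m (u2_act l' m' x) = u2_act (l \<oplus> l') (m \<oplus> m' \<oplus> l \<otimes> l' [^] p) x"
proof -
  have c: "l \<in> carrier R" "m \<in> carrier R" "l' \<in> carrier R" "m' \<in> carrier R"
    using assms by (auto simp: u2_pt_def)
  have id: "x \<oplus> l' \<otimes> X \<oplus> m' \<otimes> W \<oplus> l \<otimes> (X \<oplus> L' \<otimes> W) \<oplus> m \<otimes> W =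
      x \<oplus> (l \<oplus> l') \<otimes> X \<oplus> (m \<oplus> m' \<oplus> l \<otimes> L') \<otimes> W"
    if "X \<in> carrier R" "W \<in> carrier R" "L' \<in> carrier R" for X W L'
    using that c assms(3) by algebra
  show ?thesis
    unfolding u2_act_def[of l m "u2_act l' m' x"] u2_act_frob[OF assms(2,3)]
    unfolding u2_act_def by (rule id) (use c assms(3) in auto)
qed

lemma u2_act_zero: "x \<in> carrier R \<Longrightarrow> u2_act \<zero> \<zero> x = x"
  by (simp add: u2_act_def)

lemma proj_u_closed [simp]:
  "y \<in> carrier R \<Longrightarrow> z \<in> carrier R \<Longrightarrow> x \<in> carrier R \<Longrightarrow> proj_u y z x \<in> carrier R"
  by (simp add: proj_u_def)

lemma proj_u_add:
  assumes "y \<in> carrier R" "z \<in> carrier R" "x \<in> carrier R" "x' \<in> carrier R"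
  shows "proj_u y z (x \<oplus> x') = proj_u y z x \<oplus> proj_u y z x'"
proof -
  have id: "x \<oplus> x' \<ominus> y \<otimes> (X \<oplus> X') \<oplus> (y \<otimes> Y \<ominus> z) \<otimes> (W \<oplus> W') =
      (x \<ominus> y \<otimes> X \<oplus> (y \<otimes> Y \<ominus> z) \<otimes> W) \<oplus> (x' \<ominus> y \<otimes> X' \<oplus> (y \<otimes> Y \<ominus> z) \<otimes> W')"
    if "X \<in> carrier R" "W \<in> carrier R" "X' \<in> carrier R" "W' \<in> carrier R" "Y \<in> carrier R" for X W X' W' Y
    using that assms by algebra
  show ?thesis
    using id[of "x [^] p" "x [^] (p ^ 2)" "x' [^] p" "x' [^] (p ^ 2)" "y [^] p"] assms
    by (simp add: proj_u_def frob_simps)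
qed

text \<open>The reason is (g s)^-1 g = s^-1 modulo F^3. By \<open>u2_act_frob\<close>, applying the
  truncated (g s)^-1 to g x produces only x, x^p and x^(p^2), so comparing these three coefficients
  suffices.\<close>

lemma proj_u_invariant:
  assumes "u2_pt l m" "y \<in> carrier R" "z \<in> carrier R" "x \<in> carrier R"
  shows "proj_u (l \<oplus> y) (m \<oplus> z \<oplus> l \<otimes> y [^] p) (u2_act l m x) = proj_u y z x"
proof -
  have c: "l \<in> carrier R" "m \<in> carrier R"
    using assms by (auto simp: u2_pt_def)
  have id: "x \<oplus> l \<otimes> X \<oplus> m \<otimes> W \<ominus> (l \<oplus> y) \<otimes> (X \<oplus> L \<otimes> W) \<oplus>
        ((l \<oplus> y) \<otimes> (L \<oplus> Y) \<ominus> (m \<oplus> z \<oplus> l \<otimes> Y)) \<otimes> W =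
      x \<ominus> y \<otimes> X \<oplus> (y \<otimes> Y \<ominus> z) \<otimes> W"
    if "X \<in> carrier R" "W \<in> carrier R" "L \<in> carrier R" "Y \<in> carrier R" for X W L Y
    using that c assms(2-4) by algebra
  show ?thesis
    using id[of "x [^] p" "x [^] (p ^ 2)" "l [^] p" "y [^] p"] assms c
    by (simp add: proj_u_def u2_act_frob frob_add) (simp add: u2_act_def)
qed

lemma torsor_ptD:
  assumes "torsor_pt a b y z" "a \<in> carrier R" "b \<in> carrier R"
  shows "y \<in> carrier R" "z \<in> carrier R" "(y [^] p) [^] p = a" "z [^] p = b \<oplus> a \<otimes> y [^] p"
    "(z [^] p) [^] p = b [^] p \<oplus> a [^] p \<otimes> a"
  using assms by (auto simp: torsor_pt_def frob_simps)

text \<open>Under the p^2-th power, y becomes a, y^(p+1) becomes a^(p+1) and z becomes b^p +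
  a^(p+1). The two powers of a cancel, which leaves -b^p as the last coefficient.\<close>

lemma proj_u_equation:
  assumes "torsor_pt a b y z" "a \<in> carrier R" "b \<in> carrier R" "x \<in> carrier R"
  defines "v \<equiv> x [^] (p ^ 2)"
  shows "proj_u y z x [^] (p ^ 2) = v \<ominus> a \<otimes> v [^] p \<ominus> b [^] p \<otimes> v [^] (p ^ 2)"
proof -
  note t = torsor_ptD[OF assms(1-3)]
  have id: "v \<ominus> a \<otimes> V \<oplus> (a \<otimes> A \<ominus> (B \<oplus> A \<otimes> a)) \<otimes> W = v \<ominus> a \<otimes> V \<ominus> B \<otimes> W"
    if "v \<in> carrier R" "V \<in> carrier R" "W \<in> carrier R" "A \<in> carrier R" "B \<in> carrier R" for v V W A B
    using that assms(2,3) by algebra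
  show ?thesis
    using id[of "v" "v [^] p" "(v [^] p) [^] p" "a [^] p" "b [^] p"] assms t(1,2,3,5)
    by (simp add: proj_u_def frob_simps t(3,5) del: t(4))
qed

text \<open>For the difference d the two hypotheses say d^(p^2) = 0 and then d = y d^p. One more
  p-th power gives d^p = y^p d^(p^2) = 0, hence d = 0.\<close>

lemma proj_u_inj:
  assumes "torsor_pt a b y z" "a \<in> carrier R" "b \<in> carrier R" "x \<in> carrier R" "x' \<in> carrier R"
    and u: "proj_u y z x = proj_u y z x'" and v: "x [^] (p ^ 2) = x' [^] (p ^ 2)"
  shows "x = x'"
proof -
  note t = torsor_ptD[OF assms(1-3)]
  define d where "d = x \<ominus> x'"
  have d: "d \<in> carrier R" using assms by (simp add: d_def)
  have "(d [^] p) [^] p = \<zero>"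
    using assms v by (simp add: d_def frob_simps)
  moreover have "proj_u y z d = \<zero>"
  proof -
    have "x = d \<oplus> x'"
      unfolding d_def using assms(4,5) by algebra
    then have "proj_u y z x' = proj_u y z d \<oplus> proj_u y z x'"
      using u proj_u_add[OF t(1,2) d assms(5)] by simp
    then show ?thesis using d assms t(1,2)
      by (simp add: add.l_cancel_one')
  qed
  ultimately have "d \<ominus> y \<otimes> d [^] p = \<zero>"
    using d t(1,2) by (simp add: proj_u_def pow_p2)
  then have *: "d = y \<otimes> d [^] p"
    using d t(1) by - (rule eq_if_diff, auto)
  then have "d [^] p = y [^] p \<otimes> (d [^] p) [^] p"
    using d t(1) frob_mult[of y "d [^] p"] by simp
  then have "d = \<zero>"
    using * \<open>(d [^] p) [^] p = \<zero>\<close> d t(1) by simp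
  then show ?thesis
    using assms(4,5) by (simp add: d_def)
qed

lemma lift_x_correct:
  assumes "torsor_pt a b y z" "a \<in> carrier R" "b \<in> carrier R" "u \<in> carrier R" "v \<in> carrier R"
    and eq: "u [^] (p ^ 2) = v \<ominus> a \<otimes> v [^] p \<ominus> b [^] p \<otimes> v [^] (p ^ 2)"
  defines "x \<equiv> lift_x b y z u v"
  shows "x \<in> carrier R" "x [^] (p ^ 2) = v" "proj_u y z x = u"
proof -
  note t = torsor_ptD[OF assms(1-3)]
  show c: "x \<in> carrier R" using assms t by (simp add: x_def lift_x_def)
  \<comment> \<open>After substituting \<open>eq\<close> for u^(p^2) and b + a y^p for z^p, the
    terms with a cancel, and the p-th power of the last summand of \<open>lift_x\<close> removes b^p
    y^p v^(p^2).\<close>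
  have xp: "x [^] p = u [^] p \<oplus> y [^] p \<otimes> v \<oplus> b \<otimes> v [^] p"
  proof -
    have id: "U \<oplus> Y \<otimes> (v \<ominus> a \<otimes> V \<ominus> B \<otimes> W) \<oplus> (b \<oplus> a \<otimes> Y) \<otimes> V \<oplus> B \<otimes> Y \<otimes> W = U \<oplus> Y \<otimes> v \<oplus> b \<otimes> V"
      if "U \<in> carrier R" "Y \<in> carrier R" "V \<in> carrier R" "W \<in> carrier R" "B \<in> carrier R" for U Y V W B
      using that assms(2,3,5) by algebra
    show ?thesis
      using id[of "u [^] p" "y [^] p" "v [^] p" "(v [^] p) [^] p" "b [^] p"] assms(2-5) t eq
      by (simp add: x_def lift_x_def frob_simps)
  qed
  \<comment> \<open>Another p-th power gives u^(p^2) + a v^p + b^p v^(p^2), which \<open>eq\<close>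
    turns into v.\<close>
  show xpp: "x [^] (p ^ 2) = v"
  proof -
    have id: "v \<ominus> a \<otimes> V \<ominus> B \<otimes> W \<oplus> a \<otimes> V \<oplus> B \<otimes> W = v"
      if "V \<in> carrier R" "W \<in> carrier R" "B \<in> carrier R" for V W B
      using that assms(2,5) by algebra
    show ?thesis
      using id[of "v [^] p" "(v [^] p) [^] p" "b [^] p"] assms(2-5) t(1,3) eq c
      by (simp add: pow_p2 xp frob_add frob_mult)
  qed
  have id: "(u \<oplus> y \<otimes> U \<oplus> z \<otimes> v \<oplus> b \<otimes> y \<otimes> V) \<ominus> y \<otimes> (U \<oplus> Y \<otimes> v \<oplus> b \<otimes> V) \<oplus> (y \<otimes> Y \<ominus> z) \<otimes> v = u"
    if "U \<in> carrier R" "Y \<in> carrier R" "V \<in> carrier R" for U Y V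
    using that assms(3-5) t(1,2) by algebra
  show "proj_u y z x = u"
    using id[of "u [^] p" "y [^] p" "v [^] p"] assms(3-5) t(1,2)
    unfolding proj_u_def xpp xp unfolding x_def lift_x_def by simp
qed

end

section \<open>Representability of functors defined by equations\<close>

lemma alg_homD:
  assumes "f \<in> alg_hom K A B"
  shows "f \<in> ring_hom A B"
    and "c \<in> carrier K \<Longrightarrow> a \<in> carrier A \<Longrightarrow> f (c \<odot>\<^bsub>A\<^esub> a) = c \<odot>\<^bsub>B\<^esub> f a"
    and "a \<in> carrier A \<Longrightarrow> f a \<in> carrier B"
    and "a \<in> carrier A \<Longrightarrow> b \<in> carrier A \<Longrightarrow> f (a \<otimes>\<^bsub>A\<^esub> b) = f a \<otimes>\<^bsub>B\<^esub> f b"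
    and "a \<in> carrier A \<Longrightarrow> b \<in> carrier A \<Longrightarrow> f (a \<oplus>\<^bsub>A\<^esub> b) = f a \<oplus>\<^bsub>B\<^esub> f b"
    and "f \<one>\<^bsub>A\<^esub> = \<one>\<^bsub>B\<^esub>"
  using assms by (auto simp: alg_hom_def ring_hom_def Pi_def)

lemma alg_hom_ring_hom_ring:
  assumes "algebra K A" "algebra K B" "f \<in> alg_hom K A B"
  shows "ring_hom_cring A B f"
  using assms
  by (auto intro!: ring_hom_cring.intro ring_hom_cring_axioms.intro algebra.M_cring dest: alg_homD(1))

lemma alg_hom_comp:
  assumes "f \<in> alg_hom K A B" "g \<in> alg_hom K B C"
  shows "(\<lambda>a. g (f a)) \<in> alg_hom K A C"
  using assms by (auto simp: alg_hom_def ring_hom_def Pi_def)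

section \<open>Terms over K and their encoding in an infinite type\<close>

datatype (term_consts: 'k) alg_term =
  TVar nat | TConst 'k | TAdd "'k alg_term" "'k alg_term"
  | TMult "'k alg_term" "'k alg_term" | TNeg "'k alg_term"

primrec eval_term :: "('k, 'u) module \<Rightarrow> (nat \<Rightarrow> 'u) \<Rightarrow> 'k alg_term \<Rightarrow> 'u" where
  "eval_term A v (TVar n) = v n"
| "eval_term A v (TConst k) = k \<odot>\<^bsub>A\<^esub> \<one>\<^bsub>A\<^esub>"
| "eval_term A v (TAdd s t) = eval_term A v s \<oplus>\<^bsub>A\<^esub> eval_term A v t"
| "eval_term A v (TMult s t) = eval_term A v s \<otimes>\<^bsub>A\<^esub> eval_term A v t"
| "eval_term A v (TNeg t) = \<ominus>\<^bsub>A\<^esub> eval_term A v t"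

text \<open>Trees are stored as nested pairs: \<open>c 0\<close> to \<open>c 4\<close> tag the five
  constructors, \<open>c n\<close> also names the n-th variable, and \<open>e\<close> names the
  constants. All that is asked of \<open>'u\<close> is an injective pairing, an injective sequence
  and room for the constants.\<close>

primrec encode_term :: "('u \<times> 'u \<Rightarrow> 'u) \<Rightarrow> (nat \<Rightarrow> 'u) \<Rightarrow> ('k \<Rightarrow> 'u) \<Rightarrow> 'k alg_term \<Rightarrow> 'u" where
  "encode_term pr c e (TVar n) = pr (c 0, c n)"
| "encode_term pr c e (TConst k) = pr (c 1, e k)"
| "encode_term pr c e (TAdd s t) = pr (c 2, pr (encode_term pr c e s, encode_term pr c e t))"
| "encode_term pr c e (TMult s t) = pr (c 3, pr (encode_term pr c e s, encode_term pr c e t))"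
| "encode_term pr c e (TNeg t) = pr (c 4, encode_term pr c e t)"

lemma infinite_pairing:
  assumes "infinite (UNIV :: 'u set)"
  shows "\<exists>pr :: 'u \<times> 'u \<Rightarrow> 'u. inj pr"
proof -
  have "(card_of (UNIV \<times> UNIV :: ('u \<times> 'u) set), card_of (UNIV :: 'u set)) \<in> ordIso"
    using assms by (rule card_of_Times_same_infinite)
  then show ?thesis
    by (auto simp flip: card_of_ordIso simp: bij_betw_def)
qed

lemma encode_term_inj:
  assumes "inj pr" "inj c" "inj_on e C"
  shows "inj_on (encode_term pr c e) {t. term_consts t \<subseteq> C}"
proof -
  have "s = t" if "encode_term pr c e s = encode_term pr c e t"
    "term_consts s \<subseteq> C" "term_consts t \<subseteq> C" for s t
    using that
  proof (induction s arbitrary: t)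
    case (TVar n t)
    then show ?case by (cases t) (auto dest!: injD[OF assms(1)] injD[OF assms(2)])
  next
    case (TConst k t)
    then show ?case by (cases t) (auto dest!: injD[OF assms(1)] injD[OF assms(2)] dest: inj_onD[OF assms(3)])
  next
    case (TAdd s1 s2 t)
    then show ?case by (cases t) (auto dest!: injD[OF assms(1)] injD[OF assms(2)])
  next
    case (TMult s1 s2 t)
    then show ?case by (cases t) (auto dest!: injD[OF assms(1)] injD[OF assms(2)])
  next
    case (TNeg s t)
    then show ?case by (cases t) (auto dest!: injD[OF assms(1)] injD[OF assms(2)])
  qed
  then show ?thesis by (auto intro!: inj_onI)
qed

lemma eval_term_closed:
  assumes "algebra K A" "\<And>i. v i \<in> carrier A" "term_consts t \<subseteq> carrier K"
  shows "eval_term A v t \<in> carrier A"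
proof -
  interpret C: cring A using assms(1) by (rule algebra.M_cring)
  interpret A: algebra K A by fact
  show ?thesis using assms(2,3) by (induction t) auto
qed

lemma eval_term_hom:
  assumes "algebra K A" "algebra K B" "f \<in> alg_hom K A B"
    "\<And>i. v i \<in> carrier A" "term_consts t \<subseteq> carrier K"
  shows "f (eval_term A v t) = eval_term B (\<lambda>i. f (v i)) t"
proof -
  interpret ring_hom_cring A B f using assms(1-3) by (rule alg_hom_ring_hom_ring)
  have cl: "term_consts t \<subseteq> carrier K \<Longrightarrow> eval_term A v t \<in> carrier A" for t
    using eval_term_closed assms by metis
  show ?thesis using assms(5) by (induction t) (auto simp: alg_homD[OF assms(3)] cl)
qed

text \<open>The ring and algebra axioms appear here as identities between terms, true under every
  valuation in every algebra. They are later read as equalities of classes of terms, where they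
  become the axioms of the representing algebra; the last one matches a constant with a scalar
  multiple of 1.\<close>

lemma eval_term_identities:
  assumes "algebra K A" "\<And>i. v i \<in> carrier A"
  shows "term_consts r \<subseteq> carrier K \<Longrightarrow> term_consts s \<subseteq> carrier K \<Longrightarrow> term_consts t \<subseteq> carrier K \<Longrightarrow>
      eval_term A v (TAdd (TAdd r s) t) = eval_term A v (TAdd r (TAdd s t))"
    "term_consts s \<subseteq> carrier K \<Longrightarrow> term_consts t \<subseteq> carrier K \<Longrightarrow>
      eval_term A v (TAdd s t) = eval_term A v (TAdd t s)"
    "term_consts t \<subseteq> carrier K \<Longrightarrow>
      eval_term A v (TAdd (TConst \<zero>\<^bsub>K\<^esub>) t) = eval_term A v t"
    "term_consts t \<subseteq> carrier K \<Longrightarrow>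
      eval_term A v (TAdd (TNeg t) t) = eval_term A v (TConst \<zero>\<^bsub>K\<^esub>)"
    "term_consts r \<subseteq> carrier K \<Longrightarrow> term_consts s \<subseteq> carrier K \<Longrightarrow> term_consts t \<subseteq> carrier K \<Longrightarrow>
      eval_term A v (TMult (TMult r s) t) = eval_term A v (TMult r (TMult s t))"
    "term_consts s \<subseteq> carrier K \<Longrightarrow> term_consts t \<subseteq> carrier K \<Longrightarrow>
      eval_term A v (TMult s t) = eval_term A v (TMult t s)"
    "term_consts t \<subseteq> carrier K \<Longrightarrow>
      eval_term A v (TMult (TConst \<one>\<^bsub>K\<^esub>) t) = eval_term A v t"
    "term_consts r \<subseteq> carrier K \<Longrightarrow> term_consts s \<subseteq> carrier K \<Longrightarrow> term_consts t \<subseteq> carrier K \<Longrightarrow>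
      eval_term A v (TMult (TAdd r s) t) = eval_term A v (TAdd (TMult r t) (TMult s t))"
    "term_consts r \<subseteq> carrier K \<Longrightarrow> term_consts s \<subseteq> carrier K \<Longrightarrow> term_consts t \<subseteq> carrier K \<Longrightarrow>
      eval_term A v (TMult r (TAdd s t)) = eval_term A v (TAdd (TMult r s) (TMult r t))"
    "term_consts t \<subseteq> carrier K \<Longrightarrow> k \<in> carrier K \<Longrightarrow> l \<in> carrier K \<Longrightarrow>
      eval_term A v (TMult (TConst (k \<oplus>\<^bsub>K\<^esub> l)) t) = eval_term A v (TAdd (TMult (TConst k) t) (TMult (TConst l) t))"
    "term_consts t \<subseteq> carrier K \<Longrightarrow> k \<in> carrier K \<Longrightarrow> l \<in> carrier K \<Longrightarrow>
      eval_term A v (TMult (TConst (k \<otimes>\<^bsub>K\<^esub> l)) t) = eval_term A v (TMult (TConst k) (TMult (TConst l) t))"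
    "k \<in> carrier K \<Longrightarrow>
      eval_term A v (TConst k) = eval_term A v (TMult (TConst k) (TConst \<one>\<^bsub>K\<^esub>))"
proof -
  interpret C: cring A using assms(1) by (rule algebra.M_cring)
  interpret A: algebra K A by fact
  note c = eval_term_closed[OF assms]
  show "term_consts r \<subseteq> carrier K \<Longrightarrow> term_consts s \<subseteq> carrier K \<Longrightarrow> term_consts t \<subseteq> carrier K \<Longrightarrow>
      eval_term A v (TAdd (TAdd r s) t) = eval_term A v (TAdd r (TAdd s t))"
    "term_consts s \<subseteq> carrier K \<Longrightarrow> term_consts t \<subseteq> carrier K \<Longrightarrow>
      eval_term A v (TAdd s t) = eval_term A v (TAdd t s)"
    "term_consts t \<subseteq> carrier K \<Longrightarrow>
      eval_term A v (TAdd (TConst \<zero>\<^bsub>K\<^esub>) t) = eval_term A v t"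
    "term_consts t \<subseteq> carrier K \<Longrightarrow>
      eval_term A v (TAdd (TNeg t) t) = eval_term A v (TConst \<zero>\<^bsub>K\<^esub>)"
    "term_consts r \<subseteq> carrier K \<Longrightarrow> term_consts s \<subseteq> carrier K \<Longrightarrow> term_consts t \<subseteq> carrier K \<Longrightarrow>
      eval_term A v (TMult (TMult r s) t) = eval_term A v (TMult r (TMult s t))"
    "term_consts s \<subseteq> carrier K \<Longrightarrow> term_consts t \<subseteq> carrier K \<Longrightarrow>
      eval_term A v (TMult s t) = eval_term A v (TMult t s)"
    "term_consts t \<subseteq> carrier K \<Longrightarrow>
      eval_term A v (TMult (TConst \<one>\<^bsub>K\<^esub>) t) = eval_term A v t"
    "term_consts r \<subseteq> carrier K \<Longrightarrow> term_consts s \<subseteq> carrier K \<Longrightarrow> term_consts t \<subseteq> carrier K \<Longrightarrow>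
      eval_term A v (TMult (TAdd r s) t) = eval_term A v (TAdd (TMult r t) (TMult s t))"
    "term_consts r \<subseteq> carrier K \<Longrightarrow> term_consts s \<subseteq> carrier K \<Longrightarrow> term_consts t \<subseteq> carrier K \<Longrightarrow>
      eval_term A v (TMult r (TAdd s t)) = eval_term A v (TAdd (TMult r s) (TMult r t))"
    "term_consts t \<subseteq> carrier K \<Longrightarrow> k \<in> carrier K \<Longrightarrow> l \<in> carrier K \<Longrightarrow>
      eval_term A v (TMult (TConst (k \<oplus>\<^bsub>K\<^esub> l)) t) = eval_term A v (TAdd (TMult (TConst k) t) (TMult (TConst l) t))"
    "term_consts t \<subseteq> carrier K \<Longrightarrow> k \<in> carrier K \<Longrightarrow> l \<in> carrier K \<Longrightarrow>
      eval_term A v (TMult (TConst (k \<otimes>\<^bsub>K\<^esub> l)) t) = eval_term A v (TMult (TConst k) (TMult (TConst l) t))"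
    "k \<in> carrier K \<Longrightarrow>
      eval_term A v (TConst k) = eval_term A v (TMult (TConst k) (TConst \<one>\<^bsub>K\<^esub>))"
    by (simp_all add: c C.a_ac C.l_neg C.r_neg C.m_ac C.l_distr C.r_distr A.smult_l_distr A.smult_assoc1 A.smult_assoc2)
qed

text \<open>
  A functor with points determined by countably many natural coordinates and cut out by conditions
  that can be tested on a jointly injective family of homomorphisms is representable: the
  representing algebra consists of the functions on points given by terms in the coordinates.
\<close>

locale coordinate_functor =
  fixes K :: "('k, 'm) ring_scheme" and X :: "('k, 'u, 'x) set_functor" and c :: "nat \<Rightarrow> 'x \<Rightarrow> 'u"
    and enc :: "'k alg_term \<Rightarrow> 'u"
  assumes K_cring: "cring K"
    and is_functor: "is_set_functor K X"
    and coord_closed: "\<And>A x i. algebra K A \<Longrightarrow> x \<in> pts X A \<Longrightarrow> c i x \<in> carrier A"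
    and coord_mor: "\<And>A B f x i. algebra K A \<Longrightarrow> algebra K B \<Longrightarrow> f \<in> alg_hom K A B \<Longrightarrow>
      x \<in> pts X A \<Longrightarrow> c i (mor X f x) = f (c i x)"
    and coord_inj: "\<And>A x y. algebra K A \<Longrightarrow> x \<in> pts X A \<Longrightarrow> y \<in> pts X A \<Longrightarrow>
      (\<And>i. c i x = c i y) \<Longrightarrow> x = y"
    and closed: "\<And>B \<xi>. algebra K B \<Longrightarrow> (\<And>i. \<xi> i \<in> carrier B) \<Longrightarrow>
      (\<And>b b'. b \<in> carrier B \<Longrightarrow> b' \<in> carrier B \<Longrightarrow>
        (\<And>A f x. algebra K A \<Longrightarrow> x \<in> pts X A \<Longrightarrow> f \<in> alg_hom K B A \<Longrightarrow>
          (\<And>i. f (\<xi> i) = c i x) \<Longrightarrow> f b = f b') \<Longrightarrow> b = b') \<Longrightarrow>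
      \<exists>x\<in>pts X B. \<forall>i. c i x = \<xi> i"
    and enc_inj: "inj_on enc {t. term_consts t \<subseteq> carrier K}"
begin

definition terms :: "'k alg_term set" where
  "terms = {t. term_consts t \<subseteq> carrier K}"

text \<open>Terms are identified when they define the same function on the points of X over all
  algebras. The equations of X thus enter through its points, without generators of an
  ideal.\<close>

definition equiv_terms :: "'k alg_term \<Rightarrow> 'k alg_term \<Rightarrow> bool" where
  "equiv_terms s t \<longleftrightarrow> (\<forall>A x. algebra K A \<longrightarrow> x \<in> pts X A \<longrightarrow>
     eval_term A (\<lambda>i. c i x) s = eval_term A (\<lambda>i. c i x) t)"

text \<open>A class has to be an element of \<open>'u\<close>, so it is the code of a chosen
  representative; the choice depends only on the class, since equivalent terms define the same
  predicate under \<open>SOME\<close>.\<close>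

definition cls :: "'k alg_term \<Rightarrow> 'u" where
  "cls t = enc (SOME s. s \<in> terms \<and> equiv_terms s t)"

definition rep :: "'u \<Rightarrow> 'k alg_term" where
  "rep b = (SOME t. t \<in> terms \<and> cls t = b)"

definition coord_alg :: "('k, 'u) module" where
  "coord_alg = \<lparr>carrier = cls ` terms, monoid.mult = (\<lambda>a b. cls (TMult (rep a) (rep b))),
     one = cls (TConst \<one>\<^bsub>K\<^esub>), zero = cls (TConst \<zero>\<^bsub>K\<^esub>),
     add = (\<lambda>a b. cls (TAdd (rep a) (rep b))),
     smult = (\<lambda>k b. cls (TMult (TConst k) (rep b)))\<rparr>"

lemma terms_simps [simp]:
  "TVar n \<in> terms" "TConst k \<in> terms \<longleftrightarrow> k \<in> carrier K"
  "TAdd s t \<in> terms \<longleftrightarrow> s \<in> terms \<and> t \<in> terms"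
  "TMult s t \<in> terms \<longleftrightarrow> s \<in> terms \<and> t \<in> terms"
  "TNeg t \<in> terms \<longleftrightarrow> t \<in> terms"
  by (auto simp: terms_def)

lemma equiv_termsI:
  "(\<And>A x. algebra K A \<Longrightarrow> x \<in> pts X A \<Longrightarrow>
     eval_term A (\<lambda>i. c i x) s = eval_term A (\<lambda>i. c i x) t) \<Longrightarrow> equiv_terms s t"
  by (simp add: equiv_terms_def)

lemma cls_eq_iff:
  assumes "s \<in> terms" "t \<in> terms"
  shows "cls s = cls t \<longleftrightarrow> equiv_terms s t"
proof
  have some: "(SOME s. s \<in> terms \<and> equiv_terms s t) \<in> terms \<and>
      equiv_terms (SOME s. s \<in> terms \<and> equiv_terms s t) t" if "t \<in> terms" for t
    by (rule someI[of "\<lambda>s. s \<in> terms \<and> equiv_terms s t" t]) (use that in \<open>auto simp: equiv_terms_def\<close>)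
  show "equiv_terms s t" if "cls s = cls t"
  proof -
    have "(SOME r. r \<in> terms \<and> equiv_terms r s) = (SOME r. r \<in> terms \<and> equiv_terms r t)"
      using that some[OF assms(1)] some[OF assms(2)] enc_inj
      unfolding cls_def terms_def[symmetric] by (auto dest: inj_onD)
    then show ?thesis
      using some[OF assms(1)] some[OF assms(2)] by (simp add: equiv_terms_def)
  qed
  show "cls s = cls t" if "equiv_terms s t"
  proof -
    have "(\<lambda>r. r \<in> terms \<and> equiv_terms r s) = (\<lambda>r. r \<in> terms \<and> equiv_terms r t)"
      using that by (auto simp: equiv_terms_def)
    then show ?thesis by (simp add: cls_def)
  qed
qed

lemma rep_cls:
  assumes "t \<in> terms"
  shows "rep (cls t) \<in> terms" "equiv_terms (rep (cls t)) t"
proof -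
  have "rep (cls t) \<in> terms \<and> cls (rep (cls t)) = cls t"
    unfolding rep_def by (rule someI[of _ t]) (use assms in auto)
  then show "rep (cls t) \<in> terms" "equiv_terms (rep (cls t)) t"
    using cls_eq_iff assms by auto
qed

lemma coord_alg_simps:
  "carrier coord_alg = cls ` terms"
  "\<one>\<^bsub>coord_alg\<^esub> = cls (TConst \<one>\<^bsub>K\<^esub>)"
  "\<zero>\<^bsub>coord_alg\<^esub> = cls (TConst \<zero>\<^bsub>K\<^esub>)"
  "s \<in> terms \<Longrightarrow> t \<in> terms \<Longrightarrow> cls s \<otimes>\<^bsub>coord_alg\<^esub> cls t = cls (TMult s t)"
  "s \<in> terms \<Longrightarrow> t \<in> terms \<Longrightarrow> cls s \<oplus>\<^bsub>coord_alg\<^esub> cls t = cls (TAdd s t)"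
  "k \<in> carrier K \<Longrightarrow> t \<in> terms \<Longrightarrow> k \<odot>\<^bsub>coord_alg\<^esub> cls t = cls (TMult (TConst k) t)"
proof -
  have e: "eval_term A (\<lambda>i. c i x) (rep (cls t)) = eval_term A (\<lambda>i. c i x) t"
    if "t \<in> terms" "algebra K A" "x \<in> pts X A" for A x t
    using rep_cls(2)[OF that(1)] that(2,3) by (simp add: equiv_terms_def)
  show "carrier coord_alg = cls ` terms" "\<one>\<^bsub>coord_alg\<^esub> = cls (TConst \<one>\<^bsub>K\<^esub>)"
    "\<zero>\<^bsub>coord_alg\<^esub> = cls (TConst \<zero>\<^bsub>K\<^esub>)"
    by (simp_all add: coord_alg_def)
  show "cls s \<otimes>\<^bsub>coord_alg\<^esub> cls t = cls (TMult s t)" if "s \<in> terms" "t \<in> terms"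
    using that by (auto simp: coord_alg_def cls_eq_iff rep_cls e intro!: equiv_termsI)
  show "cls s \<oplus>\<^bsub>coord_alg\<^esub> cls t = cls (TAdd s t)" if "s \<in> terms" "t \<in> terms"
    using that by (auto simp: coord_alg_def cls_eq_iff rep_cls e intro!: equiv_termsI)
  show "k \<odot>\<^bsub>coord_alg\<^esub> cls t = cls (TMult (TConst k) t)" if "k \<in> carrier K" "t \<in> terms"
    using that by (auto simp: coord_alg_def cls_eq_iff rep_cls e intro!: equiv_termsI)
qed

text \<open>Agreement under all valuations implies agreement at the points of X, and it is what the
  algebra axioms provide.\<close>

lemma cls_eqI:
  assumes "s \<in> terms" "t \<in> terms"
    and "\<And>(A :: ('k, 'u) module) v. algebra K A \<Longrightarrow> (\<And>i. v i \<in> carrier A) \<Longrightarrow>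
      eval_term A v s = eval_term A v t"
  shows "cls s = cls t"
  unfolding cls_eq_iff[OF assms(1,2)]
  by (rule equiv_termsI, rule assms(3)) (simp_all add: coord_closed)

lemma cls_identities:
  shows "r \<in> terms \<Longrightarrow> s \<in> terms \<Longrightarrow> t \<in> terms \<Longrightarrow>
      cls (TAdd (TAdd r s) t) = cls (TAdd r (TAdd s t))"
    "s \<in> terms \<Longrightarrow> t \<in> terms \<Longrightarrow>
      cls (TAdd s t) = cls (TAdd t s)"
    "t \<in> terms \<Longrightarrow>
      cls (TAdd (TConst \<zero>\<^bsub>K\<^esub>) t) = cls t"
    "t \<in> terms \<Longrightarrow>
      cls (TAdd (TNeg t) t) = cls (TConst \<zero>\<^bsub>K\<^esub>)"
    "r \<in> terms \<Longrightarrow> s \<in> terms \<Longrightarrow> t \<in> terms \<Longrightarrow>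
      cls (TMult (TMult r s) t) = cls (TMult r (TMult s t))"
    "s \<in> terms \<Longrightarrow> t \<in> terms \<Longrightarrow>
      cls (TMult s t) = cls (TMult t s)"
    "t \<in> terms \<Longrightarrow>
      cls (TMult (TConst \<one>\<^bsub>K\<^esub>) t) = cls t"
    "r \<in> terms \<Longrightarrow> s \<in> terms \<Longrightarrow> t \<in> terms \<Longrightarrow>
      cls (TMult (TAdd r s) t) = cls (TAdd (TMult r t) (TMult s t))"
    "r \<in> terms \<Longrightarrow> s \<in> terms \<Longrightarrow> t \<in> terms \<Longrightarrow>
      cls (TMult r (TAdd s t)) = cls (TAdd (TMult r s) (TMult r t))"
    "t \<in> terms \<Longrightarrow> k \<in> carrier K \<Longrightarrow> l \<in> carrier K \<Longrightarrow>
      cls (TMult (TConst (k \<oplus>\<^bsub>K\<^esub> l)) t) = cls (TAdd (TMult (TConst k) t) (TMult (TConst l) t))"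
    "t \<in> terms \<Longrightarrow> k \<in> carrier K \<Longrightarrow> l \<in> carrier K \<Longrightarrow>
      cls (TMult (TConst (k \<otimes>\<^bsub>K\<^esub> l)) t) = cls (TMult (TConst k) (TMult (TConst l) t))"
    "k \<in> carrier K \<Longrightarrow>
      cls (TConst k) = cls (TMult (TConst k) (TConst \<one>\<^bsub>K\<^esub>))"
proof -
  interpret K: cring K by (rule K_cring)
  show "r \<in> terms \<Longrightarrow> s \<in> terms \<Longrightarrow> t \<in> terms \<Longrightarrow>
      cls (TAdd (TAdd r s) t) = cls (TAdd r (TAdd s t))"
    "s \<in> terms \<Longrightarrow> t \<in> terms \<Longrightarrow>
      cls (TAdd s t) = cls (TAdd t s)"
    "t \<in> terms \<Longrightarrow>
      cls (TAdd (TConst \<zero>\<^bsub>K\<^esub>) t) = cls t"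
    "t \<in> terms \<Longrightarrow>
      cls (TAdd (TNeg t) t) = cls (TConst \<zero>\<^bsub>K\<^esub>)"
    "r \<in> terms \<Longrightarrow> s \<in> terms \<Longrightarrow> t \<in> terms \<Longrightarrow>
      cls (TMult (TMult r s) t) = cls (TMult r (TMult s t))"
    "s \<in> terms \<Longrightarrow> t \<in> terms \<Longrightarrow>
      cls (TMult s t) = cls (TMult t s)"
    "t \<in> terms \<Longrightarrow>
      cls (TMult (TConst \<one>\<^bsub>K\<^esub>) t) = cls t"
    "r \<in> terms \<Longrightarrow> s \<in> terms \<Longrightarrow> t \<in> terms \<Longrightarrow>
      cls (TMult (TAdd r s) t) = cls (TAdd (TMult r t) (TMult s t))"
    "r \<in> terms \<Longrightarrow> s \<in> terms \<Longrightarrow> t \<in> terms \<Longrightarrow>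
      cls (TMult r (TAdd s t)) = cls (TAdd (TMult r s) (TMult r t))"
    "t \<in> terms \<Longrightarrow> k \<in> carrier K \<Longrightarrow> l \<in> carrier K \<Longrightarrow>
      cls (TMult (TConst (k \<oplus>\<^bsub>K\<^esub> l)) t) = cls (TAdd (TMult (TConst k) t) (TMult (TConst l) t))"
    "t \<in> terms \<Longrightarrow> k \<in> carrier K \<Longrightarrow> l \<in> carrier K \<Longrightarrow>
      cls (TMult (TConst (k \<otimes>\<^bsub>K\<^esub> l)) t) = cls (TMult (TConst k) (TMult (TConst l) t))"
    "k \<in> carrier K \<Longrightarrow>
      cls (TConst k) = cls (TMult (TConst k) (TConst \<one>\<^bsub>K\<^esub>))"
    by (intro cls_eqI eval_term_identities; auto simp: terms_def)+
qed

lemma coord_algebra: "algebra K coord_alg"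
proof -
  interpret K: cring K by (rule K_cring)
  note S = coord_alg_simps
  have inv: "\<exists>y\<in>carrier coord_alg. y \<oplus>\<^bsub>coord_alg\<^esub> x = \<zero>\<^bsub>coord_alg\<^esub>"
    if x: "x \<in> carrier coord_alg" for x
  proof -
    obtain t where t: "t \<in> terms" "x = cls t" using x by (auto simp: S)
    then show ?thesis
      by (intro bexI[of _ "cls (TNeg t)"]) (auto simp: S intro: cls_identities)
  qed
  have "abelian_group coord_alg"
    by (rule abelian_groupI; (erule inv | auto simp: S intro: cls_identities))
  moreover have "comm_monoid coord_alg"
    by (rule comm_monoidI) (auto simp: S intro: cls_identities)
  ultimately have "cring coord_alg"
    by (rule cringI) (auto simp: S intro: cls_identities)
  then show ?thesis
    by (rule algebraI[OF K_cring])
      (auto simp: S intro: cls_identities cls_identities(5,9)[OF terms_simps(2)[THEN iffD2]])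
qed

definition point_hom :: "('k, 'u) module \<Rightarrow> 'x \<Rightarrow> 'u \<Rightarrow> 'u" where
  "point_hom A x b = eval_term A (\<lambda>i. c i x) (rep b)"

lemma point_hom_cls:
  assumes "algebra K A" "x \<in> pts X A" "t \<in> terms"
  shows "point_hom A x (cls t) = eval_term A (\<lambda>i. c i x) t"
  using rep_cls(2)[OF assms(3)] assms(1,2) by (simp add: point_hom_def equiv_terms_def)

lemma point_hom:
  assumes "algebra K A" "x \<in> pts X A"
  shows "point_hom A x \<in> alg_hom K coord_alg A"
proof -
  interpret K: cring K by (rule K_cring)
  interpret C: cring A using assms(1) by (rule algebra.M_cring)
  interpret A: algebra K A by fact
  have "eval_term A (\<lambda>i. c i x) t \<in> carrier A" if "t \<in> terms" for t
    using that assms by (intro eval_term_closed) (auto simp: terms_def coord_closed)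
  then show ?thesis
    by (auto simp: alg_hom_def ring_hom_def coord_alg_simps point_hom_cls[OF assms] A.smult_assoc2)
qed

text \<open>The universal point has the classes of the variables as its coordinates, and the
  homomorphism belonging to a point x evaluates terms at x.\<close>

theorem representable: "is_affine_scheme K X"
proof -
  define \<xi> where "\<xi> i = cls (TVar i)" for i
  \<comment> \<open>Classes with equal values under all \<open>point_hom A x\<close> are equal by
    the definition of \<open>equiv_terms\<close>; this is the joint injectivity that
    \<open>closed\<close> asks for, so the classes of the variables form a point.\<close>
  have "\<exists>u\<in>pts X coord_alg. \<forall>i. c i u = \<xi> i"
  proof (rule closed[OF coord_algebra])
    show "\<xi> i \<in> carrier coord_alg" for i by (simp add: \<xi>_def coord_alg_simps)
    show "b = b'"
      if b: "b \<in> carrier coord_alg" "b' \<in> carrier coord_alg" and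
        eq: "\<And>A f x. algebra K A \<Longrightarrow> x \<in> pts X A \<Longrightarrow> f \<in> alg_hom K coord_alg A \<Longrightarrow>
            (\<And>i. f (\<xi> i) = c i x) \<Longrightarrow> f b = f b'" for b b'
    proof -
      obtain s t where st: "s \<in> terms" "t \<in> terms" "b = cls s" "b' = cls t"
        using b by (auto simp: coord_alg_simps)
      have "eval_term A (\<lambda>i. c i x) s = eval_term A (\<lambda>i. c i x) t"
        if "algebra K A" "x \<in> pts X A" for A x
        using eq[OF that point_hom[OF that]] that st by (simp add: \<xi>_def point_hom_cls)
      then show ?thesis using st by (simp add: cls_eq_iff equiv_terms_def)
    qed
  qed
  then obtain u where u: "u \<in> pts X coord_alg" "\<And>i. c i u = \<xi> i" by blast
  have mor: "mor X f \<in> pts X A \<rightarrow> pts X B"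
    if "algebra K A" "algebra K B" "f \<in> alg_hom K A B" for A B f
    using is_functor that unfolding is_set_functor_def by blast
  have "\<exists>f\<in>alg_hom K coord_alg A. mor X f u = x \<and>
      (\<forall>g\<in>alg_hom K coord_alg A. mor X g u = x \<longrightarrow> (\<forall>b\<in>carrier coord_alg. g b = f b))"
    if A: "algebra K A" and x: "x \<in> pts X A" for A x
  proof (intro bexI[of _ "point_hom A x"] conjI ballI impI)
    note f = point_hom[OF A x]
    show "mor X (point_hom A x) u = x"
      using mor[OF coord_algebra A f] u A x
      by (intro coord_inj[OF A]) (auto simp: coord_mor[OF coord_algebra A f] \<xi>_def point_hom_cls)
    show "g b = point_hom A x b"
      if g: "g \<in> alg_hom K coord_alg A" "mor X g u = x" and b: "b \<in> carrier coord_alg" for g b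
    proof -
      interpret ring_hom_cring coord_alg A g by (rule alg_hom_ring_hom_ring[OF coord_algebra A g(1)])
      have v: "g (\<xi> i) = c i x" for i
        using coord_mor[OF coord_algebra A g(1) u(1)] g(2) u(2) by metis
      obtain t where t: "t \<in> terms" "b = cls t" using b by (auto simp: coord_alg_simps)
      \<comment> \<open>Each class is the value of its own term at the universal coordinates, so a
        homomorphism is fixed by its values on them.\<close>
      have "eval_term coord_alg \<xi> t = cls t" if "t \<in> terms" for t
        using that
      proof (induction t)
        case (TConst k)
        interpret K: cring K by (rule K_cring)
        show ?case using TConst
          by (auto simp: coord_alg_simps K.one_closed intro: cls_identities(12)[symmetric])
      next
        case (TNeg t)
        \<comment> \<open>The record \<open>coord_alg\<close> specifies no negation, so the class of
          \<open>TNeg t\<close> is recognised as the additive inverse by the equation that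
          characterises it.\<close>
        have "cls (TNeg t) \<oplus>\<^bsub>coord_alg\<^esub> cls t = \<zero>\<^bsub>coord_alg\<^esub>"
          using TNeg.prems cring.axioms(1)[OF K_cring]
          by (auto simp: coord_alg_simps ring.ring_simprules intro: cls_identities)
        then have "cls (TNeg t) = \<ominus>\<^bsub>coord_alg\<^esub> cls t"
          using TNeg.prems by (intro R.minus_equality[symmetric]) (auto simp: coord_alg_simps)
        then show ?case using TNeg by simp
      qed (auto simp: \<xi>_def coord_alg_simps)
      then have "b = eval_term coord_alg \<xi> t" using t by simp
      then have "g b = eval_term A (\<lambda>i. c i x) t"
        using eval_term_hom[OF coord_algebra A g(1), of \<xi> t] t v
        by (auto simp: terms_def \<xi>_def coord_alg_simps)
      then show ?thesis using t A x by (simp add: point_hom_cls)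
    qed
    show "point_hom A x \<in> alg_hom K coord_alg A" by fact
  qed
  then show ?thesis
    unfolding is_affine_scheme_def using is_functor coord_algebra u(1) by blast
qed

end

lemma term_encoding_exists:
  fixes C :: "'k set"
  assumes "infinite (UNIV :: 'u set)" "\<exists>e :: 'k \<Rightarrow> 'u. inj_on e C"
  obtains enc :: "'k alg_term \<Rightarrow> 'u" where "inj_on enc {t. term_consts t \<subseteq> C}"
proof -
  obtain pr :: "'u \<times> 'u \<Rightarrow> 'u" where "inj pr" using infinite_pairing[OF assms(1)] by blast
  moreover obtain d :: "nat \<Rightarrow> 'u" where "inj d"
    using infinite_countable_subset[OF assms(1)] by blast
  ultimately show ?thesis using that encode_term_inj assms(2) by blast
qed

section \<open>Finite free extensions are faithfully flat\<close>

lemma (in abelian_monoid) finsum_cartesian_product: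
  assumes "finite A" "finite B" "f \<in> A \<times> B \<rightarrow> carrier G"
  shows "(\<Oplus>a\<in>A. \<Oplus>b\<in>B. f (a, b)) = (\<Oplus>x\<in>A \<times> B. f x)"
  using assms(1,3)
proof (induction A)
  case (insert a A)
  have "(\<Oplus>x\<in>insert a A \<times> B. f x) = (\<Oplus>x\<in>Pair a ` B \<union> A \<times> B. f x)"
    by (rule arg_cong[where f = "finsum G f"]) auto
  also have "\<dots> = (\<Oplus>x\<in>Pair a ` B. f x) \<oplus> (\<Oplus>x\<in>A \<times> B. f x)"
    using insert assms(2) by (intro finsum_Un_disjoint) auto
  also have "(\<Oplus>x\<in>Pair a ` B. f x) = (\<Oplus>b\<in>B. f (a, b))"
    using insert by (intro finsum_reindex) (auto simp: inj_on_def)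
  also have "(\<Oplus>x\<in>A \<times> B. f x) = (\<Oplus>a\<in>A. \<Oplus>b\<in>B. f (a, b))"
    using insert by (intro insert.IH[symmetric]) auto
  finally show ?case
    using insert by (subst finsum_insert) (auto intro!: finsum_closed)
qed auto

text \<open>S is free over R with basis \<open>d\<close>. The coordinate functions \<open>co\<close>
  are part of the data, so freeness is expressed by equations in the two rings, without a module
  structure on S. \<open>nonempty_J\<close> rules out rank 0 and enters in the proof of
  faithfulness.\<close>

locale finite_free_hom = ring_hom_cring R S h
  for R (structure) and S (structure) and h +
  fixes J :: "'j set" and d :: "'j \<Rightarrow> 'c" and co :: "'j \<Rightarrow> 'c \<Rightarrow> 'a"
  assumes finite_J: "finite J" and nonempty_J: "J \<noteq> {}"
    and d_closed: "j \<in> J \<Longrightarrow> d j \<in> carrier S"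
    and co_closed: "j \<in> J \<Longrightarrow> b \<in> carrier S \<Longrightarrow> co j b \<in> carrier R"
    and co_add: "j \<in> J \<Longrightarrow> b \<in> carrier S \<Longrightarrow> b' \<in> carrier S \<Longrightarrow> co j (b \<oplus>\<^bsub>S\<^esub> b') = co j b \<oplus> co j b'"
    and co_smult: "j \<in> J \<Longrightarrow> a \<in> carrier R \<Longrightarrow> b \<in> carrier S \<Longrightarrow> co j (h a \<otimes>\<^bsub>S\<^esub> b) = a \<otimes> co j b"
    and co_basis: "i \<in> J \<Longrightarrow> j \<in> J \<Longrightarrow> co j (d i) = (if i = j then \<one> else \<zero>)"
    and repr: "b \<in> carrier S \<Longrightarrow> b = (\<Oplus>\<^bsub>S\<^esub>j\<in>J. h (co j b) \<otimes>\<^bsub>S\<^esub> d j)"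
begin

lemma co_zero: "j \<in> J \<Longrightarrow> co j \<zero>\<^bsub>S\<^esub> = \<zero>"
  using co_smult[of j \<zero> "\<zero>\<^bsub>S\<^esub>"] co_closed by simp

lemma co_finsum:
  assumes "finite I" "r \<in> I \<rightarrow> carrier R" "b \<in> I \<rightarrow> carrier S" "j \<in> J"
  shows "co j (\<Oplus>\<^bsub>S\<^esub>i\<in>I. h (r i) \<otimes>\<^bsub>S\<^esub> b i) = (\<Oplus>i\<in>I. r i \<otimes> co j (b i))"
  using assms
proof (induction I)
  case empty
  then show ?case by (simp add: co_zero)
next
  case (insert i I)
  have 1: "(\<Oplus>\<^bsub>S\<^esub>i\<in>insert i I. h (r i) \<otimes>\<^bsub>S\<^esub> b i) = h (r i) \<otimes>\<^bsub>S\<^esub> b i \<oplus>\<^bsub>S\<^esub> (\<Oplus>\<^bsub>S\<^esub>i\<in>I. h (r i) \<otimes>\<^bsub>S\<^esub> b i)"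
    using insert by (intro S.finsum_insert) auto
  have 2: "(\<Oplus>i\<in>insert i I. r i \<otimes> co j (b i)) = r i \<otimes> co j (b i) \<oplus> (\<Oplus>i\<in>I. r i \<otimes> co j (b i))"
    using insert by (intro R.finsum_insert) (auto intro!: co_closed)
  have 3: "(\<Oplus>\<^bsub>S\<^esub>i\<in>I. h (r i) \<otimes>\<^bsub>S\<^esub> b i) \<in> carrier S"
    using insert by (intro S.finsum_closed) auto
  show ?case
    unfolding 1 2 using insert 3 by (simp add: co_add co_smult)
qed

text \<open>Each \<open>b i\<close> is the combination of the basis with coefficients
  \<open>co j (b i)\<close>, and applying \<open>co j\<close> to the given relation produces the
  required relations in R. The bijection \<open>e\<close> numbers the basis as the criterion
  demands.\<close>

lemma flat: "flat_hom R S h"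
  unfolding flat_hom_def
proof (intro conjI allI impI)
  show "h \<in> ring_hom R S" by (rule homh)
  fix n :: nat and r :: "nat \<Rightarrow> 'a" and b :: "nat \<Rightarrow> 'c"
  assume r: "r \<in> {..<n} \<rightarrow> carrier R" and b: "b \<in> {..<n} \<rightarrow> carrier S"
    and rel: "(\<Oplus>\<^bsub>S\<^esub>i\<in>{..<n}. h (r i) \<otimes>\<^bsub>S\<^esub> b i) = \<zero>\<^bsub>S\<^esub>"
  obtain e where e: "bij_betw e {..<card J} J"
    using ex_bij_betw_nat_finite[OF finite_J] by (auto simp: atLeast0LessThan)
  then have eJ: "e j \<in> J" if "j < card J" for j
    using that by (auto simp: bij_betw_def)
  show "\<exists>(m::nat) c d. (\<forall>i<n. \<forall>j<m. c i j \<in> carrier R) \<and> d \<in> {..<m} \<rightarrow> carrier S \<and>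
           (\<forall>i<n. b i = (\<Oplus>\<^bsub>S\<^esub>j\<in>{..<m}. h (c i j) \<otimes>\<^bsub>S\<^esub> d j)) \<and>
           (\<forall>j<m. (\<Oplus>i\<in>{..<n}. r i \<otimes> c i j) = \<zero>)"
  proof (rule exI[of _ "card J"], rule exI[of _ "\<lambda>i j. co (e j) (b i)"],
      rule exI[of _ "\<lambda>j. d (e j)"], intro conjI allI impI)
    show "co (e j) (b i) \<in> carrier R" if "i < n" "j < card J" for i j
      using that b eJ by (auto intro!: co_closed)
    show "(\<lambda>j. d (e j)) \<in> {..<card J} \<rightarrow> carrier S"
      using eJ by (auto intro!: d_closed)
    show "b i = (\<Oplus>\<^bsub>S\<^esub>j\<in>{..<card J}. h (co (e j) (b i)) \<otimes>\<^bsub>S\<^esub> d (e j))" if "i < n" for i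
    proof -
      have bi: "b i \<in> carrier S" using b that by auto
      have "b i = (\<Oplus>\<^bsub>S\<^esub>j\<in>e ` {..<card J}. h (co j (b i)) \<otimes>\<^bsub>S\<^esub> d j)"
        using repr[OF bi] e by (simp add: bij_betw_def)
      also have "\<dots> = (\<Oplus>\<^bsub>S\<^esub>j\<in>{..<card J}. h (co (e j) (b i)) \<otimes>\<^bsub>S\<^esub> d (e j))"
        using e eJ bi by (intro S.finsum_reindex) (auto simp: bij_betw_def intro!: co_closed d_closed)
      finally show ?thesis .
    qed
    show "(\<Oplus>i\<in>{..<n}. r i \<otimes> co (e j) (b i)) = \<zero>" if "j < card J" for j
      using co_finsum[OF _ r b eJ[OF that]] rel co_zero[OF eJ[OF that]] by simp
  qed
qed

text \<open>This set is the extension of M to S, written in coordinates. It absorbs multiplication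
  because x b is the sum of the elements co_i(b) x d_i, whose coordinates lie in M.\<close>

lemma extended_ideal:
  assumes "ideal M R"
  shows "ideal {b \<in> carrier S. \<forall>j\<in>J. co j b \<in> M} S"
proof -
  interpret M: ideal M R by fact
  have M_finsum: "(\<Oplus>i\<in>I. g i) \<in> M" if "finite I" "\<And>i. i \<in> I \<Longrightarrow> g i \<in> M" for I :: "'j set" and g
    using that
  proof (induction I)
    case (insert i I)
    then have "(\<Oplus>i\<in>insert i I. g i) = g i \<oplus> (\<Oplus>i\<in>I. g i)"
      by (intro R.finsum_insert) (auto intro: M.Icarr)
    then show ?case using insert by (auto intro: M.a_closed)
  qed auto
  have minus: "co j (\<ominus>\<^bsub>S\<^esub> b) = \<ominus> co j b" if "j \<in> J" "b \<in> carrier S" for j b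
  proof -
    have "co j (\<ominus>\<^bsub>S\<^esub> b) \<oplus> co j b = \<zero>"
      using that by (simp add: co_add[symmetric] S.l_neg co_zero)
    then show ?thesis using that by (intro R.minus_equality[symmetric]) (auto intro: co_closed)
  qed
  have mult: "co j (x \<otimes>\<^bsub>S\<^esub> b) \<in> M"
    if "x \<in> carrier S" "b \<in> carrier S" "\<forall>j\<in>J. co j b \<in> M" "j \<in> J" for x b j
  proof -
    have "x \<otimes>\<^bsub>S\<^esub> b = x \<otimes>\<^bsub>S\<^esub> (\<Oplus>\<^bsub>S\<^esub>i\<in>J. h (co i b) \<otimes>\<^bsub>S\<^esub> d i)"
      using repr[OF that(2)] by simp
    also have "\<dots> = (\<Oplus>\<^bsub>S\<^esub>i\<in>J. x \<otimes>\<^bsub>S\<^esub> (h (co i b) \<otimes>\<^bsub>S\<^esub> d i))"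
      using that by (intro S.finsum_rdistr finite_J) (auto intro!: co_closed d_closed)
    also have "\<dots> = (\<Oplus>\<^bsub>S\<^esub>i\<in>J. h (co i b) \<otimes>\<^bsub>S\<^esub> (x \<otimes>\<^bsub>S\<^esub> d i))"
      using that by (intro S.finsum_cong') (auto simp: S.m_lcomm co_closed d_closed)
    finally have "co j (x \<otimes>\<^bsub>S\<^esub> b) = (\<Oplus>i\<in>J. co i b \<otimes> co j (x \<otimes>\<^bsub>S\<^esub> d i))"
      using co_finsum[OF finite_J, of "\<lambda>i. co i b" "\<lambda>i. x \<otimes>\<^bsub>S\<^esub> d i" j] that
      by (simp add: co_closed d_closed Pi_def)
    then show ?thesis
      using that M_finsum[OF finite_J] by (simp add: M.I_r_closed co_closed d_closed)
  qed
  show ?thesis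
  proof (rule idealI)
    show "subgroup {b \<in> carrier S. \<forall>j\<in>J. co j b \<in> M} (add_monoid S)"
      by (rule S.add.subgroupI)
        (auto simp: co_zero co_add minus M.a_closed M.a_inv_closed intro!: exI[of _ "\<zero>\<^bsub>S\<^esub>"])
    show "x \<otimes>\<^bsub>S\<^esub> b \<in> {b \<in> carrier S. \<forall>j\<in>J. co j b \<in> M}"
      and "b \<otimes>\<^bsub>S\<^esub> x \<in> {b \<in> carrier S. \<forall>j\<in>J. co j b \<in> M}"
      if "b \<in> {b \<in> carrier S. \<forall>j\<in>J. co j b \<in> M}" "x \<in> carrier S" for b x
      using that mult[of x b] by (auto simp: S.m_comm[of b x])
  qed (rule S.ring_axioms)
qed

lemma faithfully_flat: "faithfully_flat_hom R S h"
  unfolding faithfully_flat_hom_def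
proof (intro conjI allI impI flat)
  fix M assume M: "maximalideal M R"
  interpret M: maximalideal M R by fact
  let ?I = "{b \<in> carrier S. \<forall>j\<in>J. co j b \<in> M}"
  have "co j (h m) \<in> M" if "m \<in> M" "j \<in> J" for m j
    using co_smult[of j m "\<one>\<^bsub>S\<^esub>"] that M.Icarr[OF that(1)] by (simp add: M.I_r_closed co_closed)
  then have "h ` M \<subseteq> ?I" using M.Icarr by auto
  then have "Idl\<^bsub>S\<^esub> (h ` M) \<subseteq> ?I"
    by (intro S.genideal_minimal extended_ideal M.is_ideal)
  moreover obtain j where j: "j \<in> J" using nonempty_J by auto
  moreover have "\<one> \<notin> M"
    using M.I_notcarr M.one_imp_carrier by auto
  \<comment> \<open>A basis vector \<open>d j\<close> has 1 as its j-th coordinate, which is not in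
    M.\<close>
  ultimately show "Idl\<^bsub>S\<^esub> (h ` M) \<noteq> carrier S"
    using d_closed[OF j] co_basis[OF j j] j by force
qed

end

lemma finite_free_hom_comp:
  assumes "finite_free_hom A B f J d co" "finite_free_hom B C g L e cp"
  shows "finite_free_hom A C (\<lambda>a. g (f a)) (J \<times> L) (\<lambda>(j, l). g (d j) \<otimes>\<^bsub>C\<^esub> e l) (\<lambda>(j, l) c. co j (cp l c))"
proof -
  interpret F: finite_free_hom A B f J d co by fact
  interpret G: finite_free_hom B C g L e cp by fact
  have hom: "(\<lambda>a. g (f a)) \<in> ring_hom A C"
    using F.homh G.homh by (auto simp: ring_hom_def Pi_def)
  interpret H: ring_hom_cring A C "\<lambda>a. g (f a)"
    by (intro ring_hom_cring.intro F.R.is_cring G.S.is_cring ring_hom_cring_axioms.intro hom)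
  show ?thesis
  proof (intro finite_free_hom.intro finite_free_hom_axioms.intro H.ring_hom_cring_axioms)
    fix c assume c: "c \<in> carrier C"
    have term_closed: "g (f (co j (cp l c))) \<otimes>\<^bsub>C\<^esub> (g (d j) \<otimes>\<^bsub>C\<^esub> e l) \<in> carrier C"
      if "j \<in> J" "l \<in> L" for j l
      using c that by (intro G.S.m_closed G.hom_closed F.hom_closed F.co_closed G.co_closed F.d_closed G.d_closed)
    have "c = (\<Oplus>\<^bsub>C\<^esub>l\<in>L. g (cp l c) \<otimes>\<^bsub>C\<^esub> e l)" by (rule G.repr[OF c])
    also have "\<dots> = (\<Oplus>\<^bsub>C\<^esub>l\<in>L. \<Oplus>\<^bsub>C\<^esub>j\<in>J. g (f (co j (cp l c))) \<otimes>\<^bsub>C\<^esub> (g (d j) \<otimes>\<^bsub>C\<^esub> e l))"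
    proof (rule G.S.finsum_cong')
      fix l assume l: "l \<in> L"
      have "g (cp l c) = (\<Oplus>\<^bsub>C\<^esub>j\<in>J. g (f (co j (cp l c)) \<otimes>\<^bsub>B\<^esub> d j))"
        using F.repr[OF G.co_closed[OF l c]] c l
        by (subst (1) F.repr[OF G.co_closed[OF l c]], subst G.hom_finsum)
          (auto intro!: F.co_closed G.co_closed F.d_closed simp: o_def)
      then have "g (cp l c) \<otimes>\<^bsub>C\<^esub> e l = (\<Oplus>\<^bsub>C\<^esub>j\<in>J. g (f (co j (cp l c)) \<otimes>\<^bsub>B\<^esub> d j)) \<otimes>\<^bsub>C\<^esub> e l"
        by simp
      also have "\<dots> = (\<Oplus>\<^bsub>C\<^esub>j\<in>J. g (f (co j (cp l c)) \<otimes>\<^bsub>B\<^esub> d j) \<otimes>\<^bsub>C\<^esub> e l)"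
        using c l by (intro G.S.finsum_ldistr F.finite_J) (auto intro!: F.co_closed G.co_closed F.d_closed G.d_closed)
      also have "\<dots> = (\<Oplus>\<^bsub>C\<^esub>j\<in>J. g (f (co j (cp l c))) \<otimes>\<^bsub>C\<^esub> (g (d j) \<otimes>\<^bsub>C\<^esub> e l))"
        using c l by (intro G.S.finsum_cong')
          (auto simp: G.S.m_assoc F.co_closed G.co_closed F.d_closed G.d_closed)
      finally show "g (cp l c) \<otimes>\<^bsub>C\<^esub> e l = (\<Oplus>\<^bsub>C\<^esub>j\<in>J. g (f (co j (cp l c))) \<otimes>\<^bsub>C\<^esub> (g (d j) \<otimes>\<^bsub>C\<^esub> e l))" .
    qed (use c in \<open>auto intro!: G.S.finsum_closed F.co_closed G.co_closed F.d_closed G.d_closed\<close>)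
    also have "\<dots> = (\<Oplus>\<^bsub>C\<^esub>x\<in>L \<times> J. (case x of (l, j) \<Rightarrow> g (f (co j (cp l c))) \<otimes>\<^bsub>C\<^esub> (g (d j) \<otimes>\<^bsub>C\<^esub> e l)))"
      by (subst G.S.finsum_cartesian_product[symmetric])
        (auto simp: F.finite_J G.finite_J intro!: term_closed)
    \<comment> \<open>The double sum comes out ordered by (l, j), whereas the basis is indexed by
      (j, l).\<close>
    also have "\<dots> = (\<Oplus>\<^bsub>C\<^esub>x\<in>prod.swap ` (J \<times> L). (case x of (l, j) \<Rightarrow> g (f (co j (cp l c))) \<otimes>\<^bsub>C\<^esub> (g (d j) \<otimes>\<^bsub>C\<^esub> e l)))"
      by (simp add: product_swap)
    also have "\<dots> = (\<Oplus>\<^bsub>C\<^esub>x\<in>J \<times> L. g (f ((case x of (j, l) \<Rightarrow> \<lambda>c. co j (cp l c)) c)) \<otimes>\<^bsub>C\<^esub>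
        (case x of (j, l) \<Rightarrow> g (d j) \<otimes>\<^bsub>C\<^esub> e l))"
      by (subst G.S.finsum_reindex)
        (auto intro!: term_closed G.S.finsum_cong')
    finally show "c = (\<Oplus>\<^bsub>C\<^esub>x\<in>J \<times> L. g (f ((case x of (j, l) \<Rightarrow> \<lambda>c. co j (cp l c)) c)) \<otimes>\<^bsub>C\<^esub>
        (case x of (j, l) \<Rightarrow> g (d j) \<otimes>\<^bsub>C\<^esub> e l))" .
  next
    fix x y assume "x \<in> J \<times> L" "y \<in> J \<times> L"
    then show "(case y of (j, l) \<Rightarrow> \<lambda>c. co j (cp l c)) (case x of (j, l) \<Rightarrow> g (d j) \<otimes>\<^bsub>C\<^esub> e l) =
        (if x = y then \<one>\<^bsub>A\<^esub> else \<zero>\<^bsub>A\<^esub>)"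
      by (auto simp: G.co_smult G.co_basis F.co_basis F.d_closed G.d_closed F.co_zero split: if_splits)
  qed (use F.finite_J G.finite_J F.nonempty_J G.nonempty_J in
      \<open>auto simp: F.d_closed G.d_closed F.co_closed G.co_closed F.co_add G.co_add F.co_smult G.co_smult\<close>)
qed

section \<open>Adjoining a root\<close>

lemma algebra_of_ring_hom:
  assumes "cring K" "cring B" "h \<in> ring_hom K B"
  shows "algebra K \<lparr>carrier = carrier B, monoid.mult = monoid.mult B, one = one B, zero = zero B,
    add = ring.add B, smult = (\<lambda>k b. h k \<otimes>\<^bsub>B\<^esub> b)\<rparr>" (is "algebra K ?B")
proof -
  interpret K: cring K by fact
  interpret B: cring B by fact
  interpret h: ring_hom_cring K B h
    by (intro ring_hom_cring.intro assms ring_hom_cring_axioms.intro)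
  have "abelian_group ?B"
    by (rule abelian_groupI) (auto simp: B.a_ac intro: B.l_neg bexI[of _ "\<ominus>\<^bsub>B\<^esub> x" for x])
  moreover have "comm_monoid ?B"
    by (rule comm_monoidI) (auto simp: B.m_ac)
  ultimately have "cring ?B"
    by (rule cringI) (auto simp: B.l_distr)
  then show ?thesis
    by (rule algebraI[OF K.is_cring]) (auto simp: B.l_distr B.r_distr B.m_assoc)
qed

text \<open>This codes the tuple r 0, ..., r (n - 1) by nested pairs; the \<open>r 0\<close> of the
  base case is a filler, since the empty tuple needs some value in \<open>'u\<close> too.\<close>

primrec encode_fun :: "('u \<times> 'u \<Rightarrow> 'u) \<Rightarrow> nat \<Rightarrow> (nat \<Rightarrow> 'u) \<Rightarrow> 'u" where
  "encode_fun pr 0 r = r 0"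
| "encode_fun pr (Suc n) r = pr (r n, encode_fun pr n r)"

lemma encode_fun_inj:
  assumes "inj pr" "encode_fun pr n r = encode_fun pr n s" "i < n"
  shows "r i = s i"
  using assms(2,3) by (induction n) (auto dest!: injD[OF assms(1)] simp: less_Suc_eq)

text \<open>The ring under construction is A[T] / (T^n - a). Its elements are represented by
  remainders of degree below n, and \<open>code\<close> carries these into the intended carrier
  type, which keeps the extension inside the universe.\<close>

locale adjoin_root = UP_cring A P for A :: "('a, 'm) ring_scheme" (structure) and P +
  fixes a :: 'a and n :: nat and code :: "(nat \<Rightarrow> 'a) \<Rightarrow> 'b"
  assumes a_closed: "a \<in> carrier A" and n_pos: "n > 0"
    and code_inj: "inj_on code {r \<in> carrier P. \<forall>k\<ge>n. coeff P r k = \<zero>}"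
begin

definition relator :: "nat \<Rightarrow> 'a" where
  "relator = monom P \<one> n \<ominus>\<^bsub>P\<^esub> monom P a 0"

definition low :: "(nat \<Rightarrow> 'a) set" where
  "low = {r \<in> carrier P. \<forall>k\<ge>n. coeff P r k = \<zero>}"

abbreviation I :: "(nat \<Rightarrow> 'a) set" where
  "I \<equiv> PIdl\<^bsub>P\<^esub> relator"

lemma relator_closed: "relator \<in> carrier P"
  by (simp add: relator_def a_closed)

lemma I_ideal: "ideal I P"
  by (rule P.cgenideal_ideal[OF relator_closed])

lemma diff_self_I: "q \<in> carrier P \<Longrightarrow> q \<ominus>\<^bsub>P\<^esub> q \<in> I"
  using additive_subgroup.zero_closed[OF ideal.axioms(1)[OF I_ideal]] by (simp add: a_minus_def P.r_neg)

text \<open>At m = deg q the second term vanishes, as n > 0, so the leading coefficient of q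
  survives in degree m + n. This works over rings with zero divisors because T^n - a is monic, and
  it makes remainders unique.\<close>

lemma coeff_relator_mult:
  assumes "q \<in> carrier P"
  shows "coeff P (q \<otimes>\<^bsub>P\<^esub> relator) (m + n) = coeff P q m \<ominus> a \<otimes> coeff P q (m + n)"
proof -
  have "q \<otimes>\<^bsub>P\<^esub> relator = monom P \<one> n \<otimes>\<^bsub>P\<^esub> q \<ominus>\<^bsub>P\<^esub> monom P a 0 \<otimes>\<^bsub>P\<^esub> q"
    unfolding relator_def using assms a_closed
    by (simp add: a_minus_def P.r_distr P.r_minus P.m_comm)
  also have "monom P a 0 \<otimes>\<^bsub>P\<^esub> q = a \<odot>\<^bsub>P\<^esub> q"
    using a_closed assms by (rule monom_mult_is_smult)
  finally show ?thesis
    using assms a_closed by (simp add: coeff_minus coeff_monom_mult del: coeff_mult)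
qed

lemma low_unique:
  assumes "r \<in> low" "s \<in> low" "r \<ominus>\<^bsub>P\<^esub> s \<in> I"
  shows "r = s"
proof -
  have P: "r \<in> carrier P" "s \<in> carrier P" and van: "\<And>k. k \<ge> n \<Longrightarrow> coeff P (r \<ominus>\<^bsub>P\<^esub> s) k = \<zero>"
    using assms(1,2) by (auto simp: low_def coeff_minus)
  obtain q where q: "q \<in> carrier P" "r \<ominus>\<^bsub>P\<^esub> s = q \<otimes>\<^bsub>P\<^esub> relator"
    using assms(3) by (auto simp: cgenideal_def)
  have "q = \<zero>\<^bsub>P\<^esub>"
  proof (rule ccontr)
    assume "q \<noteq> \<zero>\<^bsub>P\<^esub>"
    then have "coeff P q (deg A q) \<noteq> \<zero>"
      using q(1) by (rule lcoeff_nonzero2[rotated])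
    moreover have "coeff P q (deg A q + n) = \<zero>"
      using q(1) n_pos by (intro deg_aboveD) auto
    ultimately show False
      using van[of "deg A q + n"] coeff_relator_mult[OF q(1), of "deg A q"] q a_closed
      by (simp add: a_minus_def)
  qed
  then have "r \<ominus>\<^bsub>P\<^esub> s = \<zero>\<^bsub>P\<^esub>" using q(2) relator_closed by simp
  then show ?thesis using P by simp
qed

lemma low_exists:
  assumes "q \<in> carrier P"
  shows "\<exists>r\<in>low. q \<ominus>\<^bsub>P\<^esub> r \<in> I"
\<comment> \<open>Over the zero ring \<open>relator\<close> does not have degree n; there all
  coefficients vanish and every polynomial is its own remainder.\<close>
proof (cases "carrier A = {\<zero>}")
  case True
  then have "q \<in> low" using assms coeff_closed[OF assms] by (auto simp: low_def)
  moreover have "q \<ominus>\<^bsub>P\<^esub> q \<in> I"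
    using assms by (rule diff_self_I)
  ultimately show ?thesis by blast
next
  case False
  then have nontriv: "\<one> \<noteq> \<zero>" using R.carrier_one_not_zero by blast
  have coeff: "coeff P relator k = (if k = n then \<one> else if k = 0 then \<ominus> a else \<zero>)" for k
    using a_closed n_pos by (auto simp: relator_def coeff_minus a_minus_def)
  have deg: "deg A relator = n"
  proof (rule antisym)
    show "deg A relator \<le> n" by (rule deg_aboveI) (auto simp: coeff relator_closed)
    show "n \<le> deg A relator" by (rule deg_belowI) (auto simp: coeff relator_closed nontriv)
  qed
  have "relator \<noteq> \<zero>\<^bsub>P\<^esub>"
    using deg n_pos by auto
  \<comment> \<open>Division multiplies the dividend by a power of the leading coefficient of the
    divisor, here 1.\<close>
  from long_div_theorem[OF relator_closed assms this]
  obtain s r and k :: nat where sr: "s \<in> carrier P" "r \<in> carrier P"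
    "\<one> [^] k \<odot>\<^bsub>P\<^esub> q = relator \<otimes>\<^bsub>P\<^esub> s \<oplus>\<^bsub>P\<^esub> r" "r = \<zero>\<^bsub>P\<^esub> \<or> deg A r < n"
    unfolding deg using coeff[of n] by auto
  have "r \<in> low" using sr(2,4) by (auto simp: low_def intro: deg_aboveD)
  moreover have "q \<ominus>\<^bsub>P\<^esub> r = s \<otimes>\<^bsub>P\<^esub> relator"
    using sr(1-3) assms relator_closed
    by (simp add: a_minus_def P.a_assoc P.r_neg P.m_comm)
  ultimately show ?thesis
    using sr(1) by (auto simp: cgenideal_def)
qed

definition rem :: "(nat \<Rightarrow> 'a) \<Rightarrow> nat \<Rightarrow> 'a" where
  "rem q = (SOME r. r \<in> low \<and> q \<ominus>\<^bsub>P\<^esub> r \<in> I)"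

lemma rem:
  assumes "q \<in> carrier P"
  shows "rem q \<in> low" "q \<ominus>\<^bsub>P\<^esub> rem q \<in> I"
  using someI_ex[of "\<lambda>r. r \<in> low \<and> q \<ominus>\<^bsub>P\<^esub> r \<in> I"] low_exists[OF assms] unfolding rem_def by blast+

lemma low_closed: "r \<in> low \<Longrightarrow> r \<in> carrier P"
  by (simp add: low_def)

lemma I_trans:
  assumes "q \<in> carrier P" "r \<in> carrier P" "s \<in> carrier P" "q \<ominus>\<^bsub>P\<^esub> r \<in> I" "r \<ominus>\<^bsub>P\<^esub> s \<in> I"
  shows "q \<ominus>\<^bsub>P\<^esub> s \<in> I"
proof -
  interpret I: ideal I P by (rule I_ideal)
  have "q \<ominus>\<^bsub>P\<^esub> s = (q \<ominus>\<^bsub>P\<^esub> r) \<oplus>\<^bsub>P\<^esub> (r \<ominus>\<^bsub>P\<^esub> s)"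
    using assms(1-3) by (simp add: a_minus_def P.a_assoc P.r_neg1)
  then show ?thesis using assms(4,5) I.a_closed by simp
qed

lemma I_sym:
  assumes "q \<in> carrier P" "r \<in> carrier P" "q \<ominus>\<^bsub>P\<^esub> r \<in> I"
  shows "r \<ominus>\<^bsub>P\<^esub> q \<in> I"
proof -
  interpret I: ideal I P by (rule I_ideal)
  have "r \<ominus>\<^bsub>P\<^esub> q = \<ominus>\<^bsub>P\<^esub> (q \<ominus>\<^bsub>P\<^esub> r)"
    using assms(1,2) by (simp add: a_minus_def P.minus_add P.a_comm)
  then show ?thesis using assms(3) I.a_inv_closed by simp
qed

lemma rem_eqI:
  assumes "q \<in> carrier P" "r \<in> low" "q \<ominus>\<^bsub>P\<^esub> r \<in> I"
  shows "rem q = r"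
  using rem[OF assms(1)] assms low_closed
  by (intro low_unique) (auto intro: I_trans[of _ q] I_sym)

lemma rem_eq_iff:
  assumes "q \<in> carrier P" "r \<in> carrier P"
  shows "rem q = rem r \<longleftrightarrow> q \<ominus>\<^bsub>P\<^esub> r \<in> I"
proof
  assume "rem q = rem r"
  then show "q \<ominus>\<^bsub>P\<^esub> r \<in> I"
    using rem[OF assms(1)] rem[OF assms(2)] assms low_closed
    by (auto intro: I_trans[of _ "rem r"] I_sym)
next
  assume "q \<ominus>\<^bsub>P\<^esub> r \<in> I"
  then show "rem q = rem r"
    using rem[OF assms(2)] assms low_closed by (auto intro!: rem_eqI intro: I_trans[of _ r])
qed

lemma rem_low: "r \<in> low \<Longrightarrow> rem r = r"
  by (intro rem_eqI) (auto simp: low_closed diff_self_I)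

lemma rem_add:
  assumes "q \<in> carrier P" "r \<in> carrier P"
  shows "rem (q \<oplus>\<^bsub>P\<^esub> r) = rem q \<oplus>\<^bsub>P\<^esub> rem r"
proof (rule rem_eqI)
  interpret I: ideal I P by (rule I_ideal)
  note R = rem[OF assms(1)] rem[OF assms(2)]
  show "rem q \<oplus>\<^bsub>P\<^esub> rem r \<in> low" using R by (auto simp: low_def)
  have "(q \<oplus>\<^bsub>P\<^esub> r) \<ominus>\<^bsub>P\<^esub> (rem q \<oplus>\<^bsub>P\<^esub> rem r) = (q \<ominus>\<^bsub>P\<^esub> rem q) \<oplus>\<^bsub>P\<^esub> (r \<ominus>\<^bsub>P\<^esub> rem r)"
    using assms R low_closed by (simp add: a_minus_def P.minus_add P.a_ac)
  then show "(q \<oplus>\<^bsub>P\<^esub> r) \<ominus>\<^bsub>P\<^esub> (rem q \<oplus>\<^bsub>P\<^esub> rem r) \<in> I"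
    using R I.a_closed by simp
qed (use assms in simp)

lemma rem_smult:
  assumes "c \<in> carrier A" "q \<in> carrier P"
  shows "rem (c \<odot>\<^bsub>P\<^esub> q) = c \<odot>\<^bsub>P\<^esub> rem q"
proof (rule rem_eqI)
  interpret I: ideal I P by (rule I_ideal)
  note R = rem[OF assms(2)]
  show "c \<odot>\<^bsub>P\<^esub> rem q \<in> low" using R assms by (auto simp: low_def)
  have "c \<odot>\<^bsub>P\<^esub> q \<ominus>\<^bsub>P\<^esub> c \<odot>\<^bsub>P\<^esub> rem q = monom P c 0 \<otimes>\<^bsub>P\<^esub> (q \<ominus>\<^bsub>P\<^esub> rem q)"
    using assms R low_closed
    by (simp add: a_minus_def P.r_distr P.r_minus monom_mult_is_smult[symmetric])
  then show "c \<odot>\<^bsub>P\<^esub> q \<ominus>\<^bsub>P\<^esub> c \<odot>\<^bsub>P\<^esub> rem q \<in> I"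
    using R assms I.I_l_closed by simp
qed (use assms in simp)

definition proj :: "(nat \<Rightarrow> 'a) \<Rightarrow> 'b" where
  "proj q = code (rem q)"

lemma proj_eq_iff:
  assumes "q \<in> carrier P" "r \<in> carrier P"
  shows "proj q = proj r \<longleftrightarrow> q \<ominus>\<^bsub>P\<^esub> r \<in> I"
  using code_inj rem[OF assms(1)] rem[OF assms(2)] unfolding low_def[symmetric]
  by (auto simp: proj_def rem_eq_iff[OF assms, symmetric] dest: inj_onD)

text \<open>The fibres of \<open>proj\<close> are the cosets of I, so the ring operations of P
  descend to its image; this image is A[T] / I with carrier in \<open>'b\<close>.\<close>

definition B :: "'b ring" where
  "B = image_ring proj P"

lemma proj_hom: "ring_hom_cring P B proj"
proof -
  have w: "weak_ring_morphism proj I P"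
    using I_ideal proj_eq_iff by (rule weak_ring_morphismI)
  interpret h: ring_hom_ring P B proj
    unfolding B_def by (rule P.weak_ring_morphism_ring_hom[OF w])
  have "x \<otimes>\<^bsub>B\<^esub> y = y \<otimes>\<^bsub>B\<^esub> x" if "x \<in> carrier B" "y \<in> carrier B" for x y
  proof -
    obtain q r where "q \<in> carrier P" "r \<in> carrier P" "x = proj q" "y = proj r"
      using \<open>x \<in> carrier B\<close> \<open>y \<in> carrier B\<close> by (auto simp: B_def image_ring_carrier)
    then show ?thesis using P.m_comm[of q r] h.hom_mult[of q r] h.hom_mult[of r q] by simp
  qed
  then have "cring B"
    by (intro cring.intro h.S.ring_axioms comm_monoid.intro h.S.monoid_axioms comm_monoid_axioms.intro)
  then show ?thesis
    by (intro ring_hom_cring.intro P.is_cring ring_hom_cring_axioms.intro h.homh)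
qed

sublocale proj: ring_hom_cring P B proj
  by (rule proj_hom)

lemma B_carrier: "carrier B = proj ` carrier P"
  by (simp add: B_def image_ring_carrier)

definition embed :: "'a \<Rightarrow> 'b" where
  "embed x = proj (monom P x 0)"

definition root :: 'b where
  "root = proj (monom P \<one> 1)"

definition co :: "nat \<Rightarrow> 'b \<Rightarrow> 'a" where
  "co j b = coeff P (inv_into low code b) j"

lemma co_proj:
  assumes "q \<in> carrier P"
  shows "co j (proj q) = coeff P (rem q) j"
  using rem[OF assms] code_inj unfolding low_def[symmetric] by (simp add: co_def proj_def)

lemma embed_hom: "embed \<in> ring_hom A B"
  using ring_hom_trans[OF const_ring_hom proj.homh] by (simp add: embed_def[abs_def] o_def)

lemma root_pow: "root \<in> carrier B" "root [^]\<^bsub>B\<^esub> n = embed a"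
proof -
  show "root \<in> carrier B" by (simp add: root_def)
  have "root [^]\<^bsub>B\<^esub> n = proj (monom P \<one> 1 [^]\<^bsub>P\<^esub> n)"
    by (simp add: root_def proj.hom_pow)
  also have "monom P \<one> 1 [^]\<^bsub>P\<^esub> n = monom P \<one> n"
    using monom_pow[of \<one> 1 n] by simp
  also have "proj (monom P \<one> n) = proj (monom P a 0)"
    using a_closed P.cgenideal_self[OF relator_closed] by (simp add: proj_eq_iff relator_def[symmetric])
  finally show "root [^]\<^bsub>B\<^esub> n = embed a" by (simp add: embed_def)
qed

text \<open>The basis is 1, T, ..., T^(n-1), and the coordinates are the coefficients of the
  remainder, which are A-linear since \<open>rem\<close> is.\<close>

lemma embed_free: "finite_free_hom A B embed {..<n} (\<lambda>j. proj (monom P \<one> j)) co"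
proof (intro finite_free_hom.intro finite_free_hom_axioms.intro ring_hom_cring.intro
    ring_hom_cring_axioms.intro embed_hom is_cring proj.S.is_cring)
  fix j b assume j: "j \<in> {..<n}" and b: "b \<in> carrier B"
  obtain q where q: "q \<in> carrier P" "b = proj q" using b by (auto simp: B_carrier)
  show "co j b \<in> carrier A"
    using q rem low_closed by (simp add: co_proj)
  show "co j (embed x \<otimes>\<^bsub>B\<^esub> b) = x \<otimes> co j b" if "x \<in> carrier A" for x
  proof -
    have "embed x \<otimes>\<^bsub>B\<^esub> b = proj (x \<odot>\<^bsub>P\<^esub> q)"
      using q that by (simp add: embed_def proj.hom_mult[symmetric] monom_mult_is_smult del: proj.hom_mult)
    then show ?thesis
      using q that rem(1)[OF q(1)] low_closed by (simp add: co_proj rem_smult)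
  qed
  show "co j (b \<oplus>\<^bsub>B\<^esub> b') = co j b \<oplus> co j b'" if "b' \<in> carrier B" for b'
  proof -
    obtain q' where q': "q' \<in> carrier P" "b' = proj q'" using \<open>b' \<in> carrier B\<close> by (auto simp: B_carrier)
    then have "b \<oplus>\<^bsub>B\<^esub> b' = proj (q \<oplus>\<^bsub>P\<^esub> q')" using q by simp
    then show ?thesis
      using q q' rem(1)[OF q(1)] rem(1)[OF q'(1)] low_closed by (simp add: co_proj rem_add del: proj.hom_add)
  qed
next
  fix b assume "b \<in> carrier B"
  then obtain q where q: "q \<in> carrier P" "b = proj q" by (auto simp: B_carrier)
  define r where "r = rem q"
  have r: "r \<in> carrier P" "\<And>k. k \<ge> n \<Longrightarrow> coeff P r k = \<zero>"
    using rem(1)[OF q(1)] by (auto simp: r_def low_def)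
  have "deg A r \<le> n - 1"
    using r n_pos by (intro deg_aboveI) auto
  \<comment> \<open>The expansion runs up to a bound on the degree; with the bound n - 1 and n > 0
    its indices are those below n.\<close>
  then have "r = (\<Oplus>\<^bsub>P\<^esub>j\<in>{..n - 1}. monom P (coeff P r j) j)"
    using up_repr_le[OF _ r(1)] by simp
  also have "{..n - 1} = {..<n}" using n_pos by auto
  also have "(\<Oplus>\<^bsub>P\<^esub>j\<in>{..<n}. monom P (coeff P r j) j) =
      (\<Oplus>\<^bsub>P\<^esub>j\<in>{..<n}. monom P (coeff P r j) 0 \<otimes>\<^bsub>P\<^esub> monom P \<one> j)"
    using r(1) by (intro P.finsum_cong') (auto simp: monom_mult[symmetric] simp del: monom_mult)
  finally have "proj r = proj (\<Oplus>\<^bsub>P\<^esub>j\<in>{..<n}. monom P (coeff P r j) 0 \<otimes>\<^bsub>P\<^esub> monom P \<one> j)"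
    by (rule arg_cong)
  also have "\<dots> = (\<Oplus>\<^bsub>B\<^esub>j\<in>{..<n}. proj (monom P (coeff P r j) 0 \<otimes>\<^bsub>P\<^esub> monom P \<one> j))"
    using r(1) by (subst proj.hom_finsum) (auto simp: o_def simp del: monom_mult)
  also have "\<dots> = (\<Oplus>\<^bsub>B\<^esub>j\<in>{..<n}. embed (coeff P r j) \<otimes>\<^bsub>B\<^esub> proj (monom P \<one> j))"
    using r(1) by (intro proj.S.finsum_cong') (auto simp: embed_def simp del: monom_mult)
  finally have "proj r = (\<Oplus>\<^bsub>B\<^esub>j\<in>{..<n}. embed (coeff P r j) \<otimes>\<^bsub>B\<^esub> proj (monom P \<one> j))" .
  moreover have "proj r = b"
    using q rem[OF q(1)] low_closed by (simp add: r_def proj_def rem_low)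
  ultimately show "b = (\<Oplus>\<^bsub>B\<^esub>j\<in>{..<n}. embed (co j b) \<otimes>\<^bsub>B\<^esub> proj (monom P \<one> j))"
    using q by (simp add: co_proj r_def)
next
  fix i j assume "i \<in> {..<n}" "j \<in> {..<n}"
  moreover from this have "monom P \<one> i \<in> low" by (auto simp: low_def)
  ultimately show "co j (proj (monom P \<one> i)) = (if i = j then \<one> else \<zero>)"
    by (simp add: co_proj rem_low)
qed (use n_pos in \<open>auto intro: R.cring_axioms\<close>)

end

lemma adjoin_root_exists:
  fixes A :: "('k, 'u) module"
  assumes A: "algebra K A" and inf: "infinite (UNIV :: 'u set)" and a: "a \<in> carrier A" and n: "(n :: nat) > 0"
  shows "\<exists>(B :: ('k, 'u) module) f t d co. algebra K B \<and> f \<in> alg_hom K A B \<and> t \<in> carrier B \<and>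
    t [^]\<^bsub>B\<^esub> n = f a \<and> finite_free_hom A B f {..<n} d co"
proof -
  interpret AC: cring A using A by (rule algebra.M_cring)
  interpret A: algebra K A by (rule A)
  interpret U: UP_cring A "UP A" by (intro UP_cring.intro AC.is_cring)
  obtain pr :: "'u \<times> 'u \<Rightarrow> 'u" where pr: "inj pr" using infinite_pairing[OF inf] by blast
  \<comment> \<open>The first n coefficients are recovered from the code, and the others are
    zero.\<close>
  have "inj_on (encode_fun pr n) {r \<in> carrier (UP A). \<forall>k\<ge>n. coeff (UP A) r k = \<zero>\<^bsub>A\<^esub>}"
  proof (rule inj_onI, rule U.up_eqI)
    fix r s k
    assume r: "r \<in> {r \<in> carrier (UP A). \<forall>k\<ge>n. coeff (UP A) r k = \<zero>\<^bsub>A\<^esub>}"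
      and s: "s \<in> {r \<in> carrier (UP A). \<forall>k\<ge>n. coeff (UP A) r k = \<zero>\<^bsub>A\<^esub>}"
      and eq: "encode_fun pr n r = encode_fun pr n s"
    show "coeff (UP A) r k = coeff (UP A) s k"
    proof (cases "k < n")
      case True
      then have "r k = s k" by (rule encode_fun_inj[OF pr eq])
      then show ?thesis using r s by (simp add: UP_def)
    qed (use r s in auto)
  qed auto
  then interpret R: adjoin_root A "UP A" a n "encode_fun pr n"
    by (intro adjoin_root.intro adjoin_root_axioms.intro U.UP_cring_axioms a n)
  define h where "h k = R.embed (k \<odot>\<^bsub>A\<^esub> \<one>\<^bsub>A\<^esub>)" for k
  define B :: "('k, 'u) module" where "B = \<lparr>carrier = carrier R.B, monoid.mult = monoid.mult R.B,
    one = one R.B, zero = zero R.B, add = ring.add R.B, smult = (\<lambda>k b. h k \<otimes>\<^bsub>R.B\<^esub> b)\<rparr>"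
  have E: "ring_hom_cring A R.B R.embed"
    by (intro ring_hom_cring.intro ring_hom_cring_axioms.intro R.embed_hom AC.is_cring R.proj.S.is_cring)
  then interpret E: ring_hom_cring A R.B R.embed .
  have "h \<in> ring_hom K R.B"
    by (rule ring_hom_memI)
      (simp_all add: h_def A.smult_l_distr A.smult_assoc1 A.smult_assoc2 flip: E.hom_mult)
  then have alg: "algebra K B"
    unfolding B_def by (intro algebra_of_ring_hom A.R.is_cring R.proj.S.is_cring)
  interpret BC: cring B using alg by (rule algebra.M_cring)
  have hom: "R.embed \<in> alg_hom K A B"
    using R.embed_hom
    by (auto simp: alg_hom_def B_def ring_hom_def Pi_def h_def A.smult_assoc2 simp flip: E.hom_mult)
  \<comment> \<open>\<open>B\<close> is \<open>R.B\<close> enlarged by a scalar multiplication,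
    hence a record of another type: powers and finite sums, which refer to the whole record, are
    carried over by induction.\<close>
  have pow: "x [^]\<^bsub>B\<^esub> (m::nat) = x [^]\<^bsub>R.B\<^esub> m" for x m
    by (induction m) (simp_all add: B_def)
  have sum: "finsum B g S = finsum R.B g S" if "finite S" "g \<in> S \<rightarrow> carrier B" for g and S :: "nat set"
    using that
  proof (induction S)
    case empty
    show ?case using BC.finsum_empty R.proj.S.finsum_empty by (simp add: B_def)
  next
    case (insert x S)
    then have "g \<in> S \<rightarrow> carrier R.B" "g x \<in> carrier R.B" by (auto simp: B_def)
    then show ?case
      using insert BC.finsum_insert[of S x g] R.proj.S.finsum_insert[of S x g] by (simp add: B_def)
  qed
  interpret F: finite_free_hom A R.B R.embed "{..<n}" "\<lambda>j. R.proj (monom (UP A) \<one>\<^bsub>A\<^esub> j)" R.co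
    by (rule R.embed_free)
  have "finite_free_hom A B R.embed {..<n} (\<lambda>j. R.proj (monom (UP A) \<one>\<^bsub>A\<^esub> j)) R.co"
  proof (intro finite_free_hom.intro finite_free_hom_axioms.intro ring_hom_cring.intro
    ring_hom_cring_axioms.intro alg_homD(1)[OF hom] AC.is_cring BC.is_cring)
    fix b assume b: "b \<in> carrier B"
    have "(\<Oplus>\<^bsub>B\<^esub>j\<in>{..<n}. R.embed (R.co j b) \<otimes>\<^bsub>B\<^esub> R.proj (monom (UP A) \<one>\<^bsub>A\<^esub> j)) =
        (\<Oplus>\<^bsub>R.B\<^esub>j\<in>{..<n}. R.embed (R.co j b) \<otimes>\<^bsub>R.B\<^esub> R.proj (monom (UP A) \<one>\<^bsub>A\<^esub> j))"
      using b F.co_closed F.d_closed by (subst sum) (auto simp: B_def)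
    then show "b = (\<Oplus>\<^bsub>B\<^esub>j\<in>{..<n}. R.embed (R.co j b) \<otimes>\<^bsub>B\<^esub> R.proj (monom (UP A) \<one>\<^bsub>A\<^esub> j))"
      using F.repr[of b] b by (simp add: B_def)
  qed (use n F.d_closed F.co_closed F.co_add F.co_smult F.co_basis in \<open>auto simp: B_def\<close>)
  moreover have "R.root \<in> carrier B" "R.root [^]\<^bsub>B\<^esub> n = R.embed a"
    using R.root_pow by (auto simp: pow) (simp add: B_def)
  ultimately show ?thesis using alg hom by blast
qed

section \<open>The group \<open>U\<^sub>2\<close> and its torsor\<close>

lemma (in char_p_ring) torsor_ptI:
  assumes "y \<in> carrier R" "w \<in> carrier R" "y [^] (p ^ 2) = a" "w [^] p = b"
  shows "torsor_pt a b y (w \<oplus> y \<otimes> y [^] p)"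
  using assms by (auto simp: torsor_pt_def frob_simps m_comm)

text \<open>The identity is free of rank 1, with basis 1. It serves where two points already lie in
  one orbit over A itself.\<close>

lemma identity_flat_cover:
  assumes "algebra K A"
  shows "flat_cover K A A (\<lambda>x. x)"
proof -
  interpret A: cring A using assms by (rule algebra.M_cring)
  have "finite_free_hom A A (\<lambda>x. x) {()} (\<lambda>_. \<one>\<^bsub>A\<^esub>) (\<lambda>_ x. x)"
    by (unfold_locales) (auto simp: ring_hom_def)
  then show ?thesis
    using assms by (auto simp: flat_cover_def alg_hom_def ring_hom_def dest: finite_free_hom.faithfully_flat)
qed

lemma is_action_prod:
  assumes "is_action K G X a" "is_action K G Y b"
  shows "is_action K G (prod_functor X Y) (\<lambda>A g (x, y). (a A g x, b A g y))"
  using assms unfolding is_action_def nat_trans_def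
  by (simp add: prod_functor_def underlying_def Pi_def split_beta)

lemma group_add_group:
  assumes "abelian_group A"
  shows "group (add_group A)"
proof -
  interpret A: abelian_group A by fact
  show ?thesis
    by (rule groupI) (auto simp: add_group_def A.a_ac intro: A.l_neg bexI[of _ "\<ominus>\<^bsub>A\<^esub> x" for x])
qed

lemma U2_elem_simps [simp]:
  "U2_elem A l m 0 = \<one>\<^bsub>A\<^esub>" "U2_elem A l m (Suc 0) = l" "U2_elem A l m 2 = m"
  by (simp_all add: U2_elem_def)

text \<open>The encoding \<open>enc\<close> is kept as a parameter: it turns terms over K into
  elements of \<open>'u\<close> and so underlies each representing algebra.\<close>

locale u2_twist =
  fixes K :: "'k ring" and p :: nat and \<alpha> \<beta> :: 'k and enc :: "'k alg_term \<Rightarrow> 'u"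
  assumes field_K: "field K" and prime_p: "prime p" and char_K: "[p] \<cdot>\<^bsub>K\<^esub> \<one>\<^bsub>K\<^esub> = \<zero>\<^bsub>K\<^esub>"
    and \<alpha>_closed: "\<alpha> \<in> carrier K" and \<beta>_closed: "\<beta> \<in> carrier K"
    and infinite_univ: "infinite (UNIV :: 'u set)"
    and enc_inj: "inj_on enc {t. term_consts t \<subseteq> carrier K}"
begin

sublocale K: field K by (rule field_K)

text \<open>The condition is p 1 = 0, not minimality of p, so the zero ring among the algebras is
  covered.\<close>

lemma char_p_algebra:
  assumes "algebra K (A :: ('k, 'u) module)"
  shows "char_p_ring A p"
proof -
  interpret C: cring A using assms by (rule algebra.M_cring)
  interpret A: algebra K A by fact
  have "[n] \<cdot>\<^bsub>A\<^esub> \<one>\<^bsub>A\<^esub> = ([n] \<cdot>\<^bsub>K\<^esub> \<one>\<^bsub>K\<^esub>) \<odot>\<^bsub>A\<^esub> \<one>\<^bsub>A\<^esub>" for n :: nat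
    by (induction n) (simp_all add: A.smult_l_distr)
  then show ?thesis
    by (unfold_locales) (simp_all add: prime_p char_K)
qed

lemma scalar_closed [simp]:
  assumes "algebra K (A :: ('k, 'u) module)"
  shows "c \<in> carrier K \<Longrightarrow> c \<odot>\<^bsub>A\<^esub> \<one>\<^bsub>A\<^esub> \<in> carrier A"
proof -
  interpret C: cring A using assms by (rule algebra.M_cring)
  interpret A: algebra K A by fact
  show "c \<in> carrier K \<Longrightarrow> c \<odot>\<^bsub>A\<^esub> \<one>\<^bsub>A\<^esub> \<in> carrier A" by simp
qed

lemma scalar_hom:
  assumes "algebra K (A :: ('k, 'u) module)" "f \<in> alg_hom K A B" "c \<in> carrier K"
  shows "f (c \<odot>\<^bsub>A\<^esub> \<one>\<^bsub>A\<^esub>) = c \<odot>\<^bsub>B\<^esub> \<one>\<^bsub>B\<^esub>"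
proof -
  interpret C: cring A using assms(1) by (rule algebra.M_cring)
  show ?thesis using assms(3) by (simp add: alg_homD[OF assms(2)])
qed

lemma pts_P:
  assumes "algebra K (A :: ('k, 'u) module)"
  shows "(y, z) \<in> pts (P_torsor p \<alpha> \<beta>) A \<longleftrightarrow>
    char_p_ring.torsor_pt A p (\<alpha> \<odot>\<^bsub>A\<^esub> \<one>\<^bsub>A\<^esub>) (\<beta> \<odot>\<^bsub>A\<^esub> \<one>\<^bsub>A\<^esub>) y z"
proof -
  interpret C: char_p_ring A p using assms by (rule char_p_algebra)
  interpret A: algebra K A by fact
  show ?thesis
    by (auto simp: P_torsor_def C.torsor_pt_def A.smult_assoc2 \<alpha>_closed)
qed

section \<open>The group of points of U_2\<close>

lemma carrier_U2:
  assumes "algebra K (A :: ('k, 'u) module)"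
  shows "g \<in> carrier (grp (U2 p) A) \<longleftrightarrow> (\<exists>l m. char_p_ring.u2_pt A p l m \<and> g = U2_elem A l m)"
proof -
  interpret C: char_p_ring A p using assms by (rule char_p_algebra)
  show ?thesis by (auto simp: U2_def C.u2_pt_def)
qed

lemma U2_one:
  assumes "algebra K (A :: ('k, 'u) module)"
  shows "\<one>\<^bsub>grp (U2 p) A\<^esub> = U2_elem A \<zero>\<^bsub>A\<^esub> \<zero>\<^bsub>A\<^esub>"
  by (auto simp: U2_def units_of_def skew_poly_ring_def U2_elem_def)

text \<open>The convolution of coefficients is compared degree by degree. From degree 3 on only l
  m'^p, m l'^(p^2) and m m'^(p^2) could survive, and these vanish by the conditions on U_2.\<close>

lemma U2_mult:
  assumes A: "algebra K (A :: ('k, 'u) module)"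
    and lm: "char_p_ring.u2_pt A p l m" "char_p_ring.u2_pt A p l' m'"
  shows "U2_elem A l m \<otimes>\<^bsub>grp (U2 p) A\<^esub> U2_elem A l' m' =
    U2_elem A (l \<oplus>\<^bsub>A\<^esub> l') (m \<oplus>\<^bsub>A\<^esub> m' \<oplus>\<^bsub>A\<^esub> l \<otimes>\<^bsub>A\<^esub> l' [^]\<^bsub>A\<^esub> p)"
proof
  interpret C: char_p_ring A p using A by (rule char_p_algebra)
  have c: "l \<in> carrier A" "m \<in> carrier A" "l' \<in> carrier A" "m' \<in> carrier A"
    and z: "m' [^]\<^bsub>A\<^esub> p = \<zero>\<^bsub>A\<^esub>" "l' [^]\<^bsub>A\<^esub> (p ^ 2) = \<zero>\<^bsub>A\<^esub>"
    "m' [^]\<^bsub>A\<^esub> (p ^ 2) = \<zero>\<^bsub>A\<^esub>"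
    using lm by (auto simp: C.u2_pt_def C.frob_simps)
  have closed: "U2_elem A l m i \<in> carrier A" "U2_elem A l' m' i \<in> carrier A" for i
    using c by (auto simp: U2_elem_def)
  have zero_pow: "\<zero>\<^bsub>A\<^esub> [^]\<^bsub>A\<^esub> (p ^ i) = \<zero>\<^bsub>A\<^esub>" for i :: nat
    using prime_p by (intro C.nat_pow_zero) (simp add: prime_gt_0_nat)
  let ?s = "\<lambda>n i. U2_elem A l m i \<otimes>\<^bsub>A\<^esub> U2_elem A l' m' (n - i) [^]\<^bsub>A\<^esub> (p ^ i)"
  fix n
  have "(U2_elem A l m \<otimes>\<^bsub>grp (U2 p) A\<^esub> U2_elem A l' m') n = (\<Oplus>\<^bsub>A\<^esub>i\<in>{..n}. ?s n i)"
    by (simp add: U2_def units_of_def skew_poly_ring_def)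
  also have "\<dots> = U2_elem A (l \<oplus>\<^bsub>A\<^esub> l') (m \<oplus>\<^bsub>A\<^esub> m' \<oplus>\<^bsub>A\<^esub> l \<otimes>\<^bsub>A\<^esub> l' [^]\<^bsub>A\<^esub> p) n"
  proof -
    consider "n = 0" | "n = 1" | "n = 2" | "n \<ge> 3" by linarith
    then show ?thesis
    proof cases
      case 1
      then show ?thesis by simp
    next
      case 2
      have "(\<Oplus>\<^bsub>A\<^esub>i\<in>{..Suc 0}. g i) = g (Suc 0) \<oplus>\<^bsub>A\<^esub> g 0" if "range g \<subseteq> carrier A" for g
        using that by (simp add: C.finsum_Suc Pi_def image_subset_iff)
      from this[of "?s (Suc 0)"] show ?thesis using c closed 2 by (simp add: image_subset_iff)
    next
      case 3
      have "(\<Oplus>\<^bsub>A\<^esub>i\<in>{..Suc (Suc 0)}. g i) = g (Suc (Suc 0)) \<oplus>\<^bsub>A\<^esub> (g (Suc 0) \<oplus>\<^bsub>A\<^esub> g 0)"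
        if "range g \<subseteq> carrier A" for g
        using that by (simp add: C.finsum_Suc Pi_def image_subset_iff)
      from this[of "?s 2"] show ?thesis using c closed 3
        by (simp add: image_subset_iff C.a_ac numeral_2_eq_2[symmetric])
    next
      case 4
      have "?s n i = \<zero>\<^bsub>A\<^esub>" if "i \<in> {..n}" for i
      proof -
        consider "i = 0" | "i = 1" | "i = 2" | "i \<ge> 3" by linarith
        then show ?thesis
          using 4 c z zero_pow[of 1] zero_pow[of 2] by cases (auto simp: U2_elem_def)
      qed
      then have "(\<Oplus>\<^bsub>A\<^esub>i\<in>{..n}. ?s n i) = (\<Oplus>\<^bsub>A\<^esub>i\<in>{..n}. \<zero>\<^bsub>A\<^esub>)"
        by (intro C.finsum_cong') auto
      then show ?thesis using 4 by (simp add: U2_elem_def)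
    qed
  qed
  finally show "(U2_elem A l m \<otimes>\<^bsub>grp (U2 p) A\<^esub> U2_elem A l' m') n =
    U2_elem A (l \<oplus>\<^bsub>A\<^esub> l') (m \<oplus>\<^bsub>A\<^esub> m' \<oplus>\<^bsub>A\<^esub> l \<otimes>\<^bsub>A\<^esub> l' [^]\<^bsub>A\<^esub> p) n" .
qed

text \<open>All axioms are verified in coordinates. Associativity comes down to (l' + l'')^p = l'^p
  + l''^p in the coefficient of F^2.\<close>

lemma group_U2:
  assumes A: "algebra K (A :: ('k, 'u) module)"
  shows "group (grp (U2 p) A)"
proof -
  interpret C: char_p_ring A p using A by (rule char_p_algebra)
  show ?thesis
  proof (rule groupI)
    show "\<one>\<^bsub>grp (U2 p) A\<^esub> \<in> carrier (grp (U2 p) A)"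
      using C.u2_pt_zero by (auto simp: carrier_U2[OF A] U2_one[OF A])
  next
    fix x y assume "x \<in> carrier (grp (U2 p) A)" "y \<in> carrier (grp (U2 p) A)"
    then show "x \<otimes>\<^bsub>grp (U2 p) A\<^esub> y \<in> carrier (grp (U2 p) A)"
      by (auto simp: carrier_U2[OF A] U2_mult[OF A]) (blast dest: C.u2_pt_mult)
  next
    fix x y z
    assume "x \<in> carrier (grp (U2 p) A)" "y \<in> carrier (grp (U2 p) A)" "z \<in> carrier (grp (U2 p) A)"
    then obtain l m l' m' l'' m'' where lm: "C.u2_pt l m" "C.u2_pt l' m'" "C.u2_pt l'' m''"
      and xyz: "x = U2_elem A l m" "y = U2_elem A l' m'" "z = U2_elem A l'' m''"
      by (auto simp: carrier_U2[OF A])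
    have c: "l \<in> carrier A" "m \<in> carrier A" "l' \<in> carrier A" "m' \<in> carrier A"
      "l'' \<in> carrier A" "m'' \<in> carrier A"
      using lm by (auto simp: C.u2_pt_def)
    show "x \<otimes>\<^bsub>grp (U2 p) A\<^esub> y \<otimes>\<^bsub>grp (U2 p) A\<^esub> z = x \<otimes>\<^bsub>grp (U2 p) A\<^esub> (y \<otimes>\<^bsub>grp (U2 p) A\<^esub> z)"
      using lm c unfolding xyz
      by (simp add: U2_mult[OF A] C.u2_pt_mult C.frob_add)
        (rule arg_cong2[where f = "U2_elem A"], simp_all add: C.frob_simps C.l_distr C.r_distr C.a_ac C.m_ac lm[unfolded C.u2_pt_def])
  next
    fix x assume "x \<in> carrier (grp (U2 p) A)"
    then obtain l m where lm: "C.u2_pt l m" and x: "x = U2_elem A l m"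
      by (auto simp: carrier_U2[OF A])
    then show "\<one>\<^bsub>grp (U2 p) A\<^esub> \<otimes>\<^bsub>grp (U2 p) A\<^esub> x = x"
      by (simp add: U2_one[OF A] U2_mult[OF A] C.u2_pt_zero) (simp add: C.u2_pt_def)
    have c: "l \<in> carrier A" "m \<in> carrier A" using lm by (auto simp: C.u2_pt_def)
    have "l \<otimes>\<^bsub>A\<^esub> l [^]\<^bsub>A\<^esub> p \<ominus>\<^bsub>A\<^esub> m \<oplus>\<^bsub>A\<^esub> m \<oplus>\<^bsub>A\<^esub> (\<ominus>\<^bsub>A\<^esub> l) \<otimes>\<^bsub>A\<^esub> l [^]\<^bsub>A\<^esub> p = \<zero>\<^bsub>A\<^esub>"
      using c by (simp add: a_minus_def C.a_assoc C.l_neg C.l_minus C.r_neg)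
    then have "U2_elem A (\<ominus>\<^bsub>A\<^esub> l) (l \<otimes>\<^bsub>A\<^esub> l [^]\<^bsub>A\<^esub> p \<ominus>\<^bsub>A\<^esub> m) \<otimes>\<^bsub>grp (U2 p) A\<^esub> x = \<one>\<^bsub>grp (U2 p) A\<^esub>"
      using lm c by (simp add: x U2_mult[OF A] C.u2_pt_inv U2_one[OF A] C.l_neg)
    then show "\<exists>y\<in>carrier (grp (U2 p) A). y \<otimes>\<^bsub>grp (U2 p) A\<^esub> x = \<one>\<^bsub>grp (U2 p) A\<^esub>"
      by (intro bexI[of _ "U2_elem A (\<ominus>\<^bsub>A\<^esub> l) (l \<otimes>\<^bsub>A\<^esub> l [^]\<^bsub>A\<^esub> p \<ominus>\<^bsub>A\<^esub> m)"])
        (use C.u2_pt_inv[OF lm] in \<open>auto simp: carrier_U2[OF A]\<close>)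
  qed
qed

lemma U2_elem_hom:
  assumes "algebra K (A :: ('k, 'u) module)" "algebra K B" "f \<in> alg_hom K A B"
  shows "f \<circ> U2_elem A l m = U2_elem B (f l) (f m)"
proof -
  interpret f: ring_hom_cring A B f using assms by (rule alg_hom_ring_hom_ring)
  show ?thesis by (auto simp: U2_elem_def)
qed

lemma u2_pt_hom:
  assumes "algebra K (A :: ('k, 'u) module)" "algebra K B" "f \<in> alg_hom K A B"
    and "char_p_ring.u2_pt A p l m"
  shows "char_p_ring.u2_pt B p (f l) (f m)"
proof -
  interpret f: ring_hom_cring A B f using assms(1-3) by (rule alg_hom_ring_hom_ring)
  interpret A: char_p_ring A p using assms(1) by (rule char_p_algebra)
  interpret B: char_p_ring B p using assms(2) by (rule char_p_algebra)
  show ?thesis using assms(4) by (auto simp: A.u2_pt_def B.u2_pt_def simp flip: f.hom_pow)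
qed

lemma torsor_pt_hom:
  assumes "algebra K (A :: ('k, 'u) module)" "algebra K B" "f \<in> alg_hom K A B"
    and "(y, z) \<in> pts (P_torsor p \<alpha> \<beta>) A"
  shows "(f y, f z) \<in> pts (P_torsor p \<alpha> \<beta>) B"
proof -
  interpret f: ring_hom_cring A B f using assms(1-3) by (rule alg_hom_ring_hom_ring)
  interpret A: char_p_ring A p using assms(1) by (rule char_p_algebra)
  interpret B: char_p_ring B p using assms(2) by (rule char_p_algebra)
  note sc = scalar_hom[OF assms(1,3)]
  have "y \<in> carrier A" "z \<in> carrier A" "f (y [^]\<^bsub>A\<^esub> (p ^ 2)) = \<alpha> \<odot>\<^bsub>B\<^esub> \<one>\<^bsub>B\<^esub>"
    "f (z [^]\<^bsub>A\<^esub> p) = \<beta> \<odot>\<^bsub>B\<^esub> \<one>\<^bsub>B\<^esub> \<oplus>\<^bsub>B\<^esub> \<alpha> \<odot>\<^bsub>B\<^esub> \<one>\<^bsub>B\<^esub> \<otimes>\<^bsub>B\<^esub> f y [^]\<^bsub>B\<^esub> p"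
    using assms(1,4) by (auto simp: pts_P A.torsor_pt_def sc \<alpha>_closed \<beta>_closed)
  then show ?thesis
    by (simp add: pts_P[OF assms(2)] B.torsor_pt_def)
qed


section \<open>Representability of G_a, U_2 and P\<close>

lemma coordinate_functorI:
  fixes X :: "('k, 'u, 'x) set_functor" and c :: "nat \<Rightarrow> 'x \<Rightarrow> 'u"
  assumes "is_set_functor K X"
    and "\<And>(A :: ('k, 'u) module) x i. algebra K A \<Longrightarrow> x \<in> pts X A \<Longrightarrow> c i x \<in> carrier A"
    and "\<And>(A :: ('k, 'u) module) (B :: ('k, 'u) module) f x i. algebra K A \<Longrightarrow> algebra K B \<Longrightarrow>
      f \<in> alg_hom K A B \<Longrightarrow> x \<in> pts X A \<Longrightarrow> c i (mor X f x) = f (c i x)"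
    and "\<And>(A :: ('k, 'u) module) x y. algebra K A \<Longrightarrow> x \<in> pts X A \<Longrightarrow> y \<in> pts X A \<Longrightarrow>
      (\<And>i. c i x = c i y) \<Longrightarrow> x = y"
    and "\<And>(B :: ('k, 'u) module) \<xi>. algebra K B \<Longrightarrow> (\<And>i. \<xi> i \<in> carrier B) \<Longrightarrow>
      (\<And>b b'. b \<in> carrier B \<Longrightarrow> b' \<in> carrier B \<Longrightarrow>
        (\<And>(A :: ('k, 'u) module) f x. algebra K A \<Longrightarrow> x \<in> pts X A \<Longrightarrow> f \<in> alg_hom K B A \<Longrightarrow>
          ring_hom_cring B A f \<Longrightarrow> (\<And>i. f (\<xi> i) = c i x) \<Longrightarrow> f b = f b') \<Longrightarrow> b = b') \<Longrightarrow>
      \<exists>x\<in>pts X B. \<forall>i. c i x = \<xi> i"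
  shows "is_affine_scheme K X"
proof -
  interpret coordinate_functor K X c enc
  proof (unfold_locales, goal_cases)
    case (5 B \<xi>)
    show ?case
    proof (rule assms(5)[OF 5(1,2)])
      fix b b' assume b: "b \<in> carrier B" "b' \<in> carrier B"
        and eq: "\<And>(A :: ('k, 'u) module) f x. algebra K A \<Longrightarrow> x \<in> pts X A \<Longrightarrow> f \<in> alg_hom K B A \<Longrightarrow>
          ring_hom_cring B A f \<Longrightarrow> (\<And>i. f (\<xi> i) = c i x) \<Longrightarrow> f b = f b'"
      show "b = b'"
        by (rule 5(3)[OF b], rule eq) (auto intro: alg_hom_ring_hom_ring 5(1))
    qed
  qed (use assms(1-4) enc_inj in blast)+
  show ?thesis by (rule representable)
qed

text \<open>The single coordinate is repeated at every index; joint injectivity then forces \<xi> to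
  be constant.\<close>

lemma affine_Ga: "is_affine_scheme K (underlying (Ga :: ('k, 'u, 'u) group_functor))"
proof (rule coordinate_functorI[of _ "\<lambda>i x. x"])
  show "is_set_functor K (underlying (Ga :: ('k, 'u, 'u) group_functor))"
    by (auto simp: is_set_functor_def underlying_def Ga_def add_group_def alg_homD)
  fix B :: "('k, 'u) module" and \<xi> :: "nat \<Rightarrow> 'u"
  assume B: "algebra K B" and \<xi>: "\<And>i. \<xi> i \<in> carrier B"
    and eq: "\<And>b b'. b \<in> carrier B \<Longrightarrow> b' \<in> carrier B \<Longrightarrow>
        (\<And>(A :: ('k, 'u) module) f x. algebra K A \<Longrightarrow> x \<in> pts (underlying Ga) A \<Longrightarrow> f \<in> alg_hom K B A \<Longrightarrow>
          ring_hom_cring B A f \<Longrightarrow> (\<And>i::nat. f (\<xi> i) = x) \<Longrightarrow> f b = f b') \<Longrightarrow> b = b'"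
  have "\<xi> 0 = \<xi> i" for i by (rule eq) (auto simp: \<xi>)
  then show "\<exists>x\<in>pts (underlying Ga) B. \<forall>i. x = \<xi> i"
    using \<xi> by (auto simp: underlying_def Ga_def add_group_def)
qed (auto simp: underlying_def Ga_def add_group_def)

text \<open>The coordinates of a point are its coefficients. Each defining equation, \<xi> 0 = 1,
  \<xi> i = 0 for i \<ge> 3, (\<xi> 1)^(p^2) = 0 and (\<xi> 2)^p = 0, holds after every homomorphism
  that makes \<xi> a point, hence in B by joint injectivity.\<close>

lemma affine_U2: "is_affine_scheme K (underlying (U2 p :: ('k, 'u, nat \<Rightarrow> 'u) group_functor))"
proof (rule coordinate_functorI[of _ "\<lambda>i x. x i"])
  have pts: "pts (underlying (U2 p)) A = carrier (grp (U2 p) A)" for A :: "('k, 'u) module"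
    by (simp add: underlying_def)
  have mor: "mor (underlying (U2 p :: ('k, 'u, nat \<Rightarrow> 'u) group_functor)) f = (\<lambda>a. f \<circ> a)" for f
    by (simp add: underlying_def U2_def)
  have closed: "x i \<in> carrier A"
    if "algebra K A" "x \<in> carrier (grp (U2 p) A)" for A :: "('k, 'u) module" and x i
  proof -
    interpret C: char_p_ring A p using that(1) by (rule char_p_algebra)
    show ?thesis using that by (auto simp: carrier_U2 C.u2_pt_def U2_elem_def)
  qed
  show "x i \<in> carrier A"
    if "algebra K A" "x \<in> pts (underlying (U2 p)) A" for A :: "('k, 'u) module" and x i
    using closed that unfolding pts by blast
  show "is_set_functor K (underlying (U2 p :: ('k, 'u, nat \<Rightarrow> 'u) group_functor))"
    unfolding is_set_functor_def pts mor
  proof (intro conjI allI impI)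
    show "(\<circ>) f \<in> carrier (grp (U2 p) A) \<rightarrow> carrier (grp (U2 p) B)"
      if "algebra K A" "algebra K B" "f \<in> alg_hom K A B" for A B :: "('k, 'u) module" and f
      using that u2_pt_hom[OF that] by (auto simp: carrier_U2 U2_elem_hom[OF that]) blast
  qed (use closed in \<open>auto simp: fun_eq_iff\<close>)
  fix B :: "('k, 'u) module" and \<xi> :: "nat \<Rightarrow> 'u"
  assume B: "algebra K B" and \<xi>: "\<And>i. \<xi> i \<in> carrier B"
    and eq: "\<And>b b'. b \<in> carrier B \<Longrightarrow> b' \<in> carrier B \<Longrightarrow>
        (\<And>(A :: ('k, 'u) module) f x. algebra K A \<Longrightarrow> x \<in> pts (underlying (U2 p)) A \<Longrightarrow> f \<in> alg_hom K B A \<Longrightarrow>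
          ring_hom_cring B A f \<Longrightarrow> (\<And>i. f (\<xi> i) = x i) \<Longrightarrow> f b = f b') \<Longrightarrow> b = b'"
  interpret B: char_p_ring B p using B by (rule char_p_algebra)
  have eq': "b = b'"
    if b: "b \<in> carrier B" "b' \<in> carrier B"
      and h: "\<And>(A :: ('k, 'u) module) f. algebra K A \<Longrightarrow> f \<in> alg_hom K B A \<Longrightarrow>
        (\<lambda>i. f (\<xi> i)) \<in> carrier (grp (U2 p) A) \<Longrightarrow> f b = f b'" for b b'
  proof (rule eq[OF b])
    fix A :: "('k, 'u) module" and f x
    assume "algebra K A" "x \<in> pts (underlying (U2 p)) A" "f \<in> alg_hom K B A"
      and x: "\<And>i. f (\<xi> i) = x i"
    moreover from x have "(\<lambda>i. f (\<xi> i)) = x" by auto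
    ultimately show "f b = f b'" by (intro h) (auto simp: pts)
  qed
  have h: "f (\<xi> 0) = f \<one>\<^bsub>B\<^esub>" "i \<ge> 3 \<Longrightarrow> f (\<xi> i) = f \<zero>\<^bsub>B\<^esub>"
    "f (\<xi> 1 [^]\<^bsub>B\<^esub> (p ^ 2)) = f \<zero>\<^bsub>B\<^esub>" "f (\<xi> 2 [^]\<^bsub>B\<^esub> p) = f \<zero>\<^bsub>B\<^esub>"
    if A: "algebra K A" and f: "f \<in> alg_hom K B A" and pt: "(\<lambda>i. f (\<xi> i)) \<in> carrier (grp (U2 p) A)"
    for A :: "('k, 'u) module" and f i
  proof -
    interpret f: ring_hom_cring B A f using B A f by (rule alg_hom_ring_hom_ring)
    interpret A: char_p_ring A p using A by (rule char_p_algebra)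
    obtain l m where lm: "A.u2_pt l m" and "(\<lambda>i. f (\<xi> i)) = U2_elem A l m"
      using pt by (auto simp: carrier_U2[OF A])
    then have "f (\<xi> i) = U2_elem A l m i" for i by (auto dest: fun_cong)
    then show "f (\<xi> 0) = f \<one>\<^bsub>B\<^esub>" "i \<ge> 3 \<Longrightarrow> f (\<xi> i) = f \<zero>\<^bsub>B\<^esub>"
      "f (\<xi> 1 [^]\<^bsub>B\<^esub> (p ^ 2)) = f \<zero>\<^bsub>B\<^esub>" "f (\<xi> 2 [^]\<^bsub>B\<^esub> p) = f \<zero>\<^bsub>B\<^esub>"
      using lm by (simp_all add: \<xi> U2_elem_def A.u2_pt_def)
  qed
  have "\<xi> 0 = \<one>\<^bsub>B\<^esub>"
    by (rule eq') (simp add: \<xi>, simp, rule h(1))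
  moreover have "\<xi> i = \<zero>\<^bsub>B\<^esub>" if "i \<ge> 3" for i
    by (rule eq') (simp add: \<xi>, simp, rule h(2)[OF _ _ _ that])
  moreover have "\<xi> 1 [^]\<^bsub>B\<^esub> (p ^ 2) = \<zero>\<^bsub>B\<^esub>"
    by (rule eq') (simp add: \<xi>, simp, rule h(3))
  moreover have "\<xi> 2 [^]\<^bsub>B\<^esub> p = \<zero>\<^bsub>B\<^esub>"
    by (rule eq') (simp add: \<xi>, simp, rule h(4))
  ultimately have "B.u2_pt (\<xi> 1) (\<xi> 2)" "\<And>i. U2_elem B (\<xi> 1) (\<xi> 2) i = \<xi> i"
    using \<xi> by (auto simp: B.u2_pt_def U2_elem_def)
  then show "\<exists>x\<in>pts (underlying (U2 p)) B. \<forall>i. x i = \<xi> i"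
    unfolding pts using carrier_U2[OF B] by blast
qed (auto simp: underlying_def U2_def)

text \<open>A pair is given the coordinate sequence \<open>y, z, z, z, \<dots>\<close>.\<close>

lemma affine_planeI:
  fixes X :: "('k, 'u, 'u \<times> 'u) set_functor"
  assumes mor: "\<And>f. mor X f = map_prod f f"
    and closed: "\<And>A y z. algebra K A \<Longrightarrow> (y, z) \<in> pts X A \<Longrightarrow> y \<in> carrier A \<and> z \<in> carrier A"
    and hom: "\<And>A B f y z. algebra K A \<Longrightarrow> algebra K B \<Longrightarrow> f \<in> alg_hom K A B \<Longrightarrow>
      (y, z) \<in> pts X A \<Longrightarrow> (f y, f z) \<in> pts X B"
    and eq: "\<And>B y z. algebra K B \<Longrightarrow> y \<in> carrier B \<Longrightarrow> z \<in> carrier B \<Longrightarrow>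
      (\<And>b b'. b \<in> carrier B \<Longrightarrow> b' \<in> carrier B \<Longrightarrow>
        (\<And>A f. algebra K A \<Longrightarrow> f \<in> alg_hom K B A \<Longrightarrow> ring_hom_cring B A f \<Longrightarrow>
          (f y, f z) \<in> pts X A \<Longrightarrow> f b = f b') \<Longrightarrow> b = b') \<Longrightarrow>
      (y, z) \<in> pts X B"
  shows "is_affine_scheme K X"
proof (rule coordinate_functorI[of _ "\<lambda>i x. if i = 0 then fst x else snd x"])
  show "is_set_functor K X"
    unfolding is_set_functor_def mor
  proof (intro conjI allI impI)
    show "map_prod f f \<in> pts X A \<rightarrow> pts X B"
      if "algebra K A" "algebra K B" "f \<in> alg_hom K A B" for A B f
      using hom[OF that] by auto
  qed (use closed in force)+
  show "(if i = 0 then fst x else snd x) \<in> carrier A" if "algebra K A" "x \<in> pts X A" for A x and i :: nat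
    using closed[OF that(1), of "fst x" "snd x"] that(2) by auto
  show "(if i = 0 then fst (mor X f x) else snd (mor X f x)) = f (if i = 0 then fst x else snd x)"
    for f x and i :: nat
    by (simp add: mor)
  show "x = y" if "\<And>i::nat. (if i = 0 then fst x else snd x) = (if i = 0 then fst y else snd y)" for x y :: "'u \<times> 'u"
    using that[of 0] that[of 1] by (simp add: prod_eq_iff)
  fix B :: "('k, 'u) module" and \<xi> :: "nat \<Rightarrow> 'u"
  assume B: "algebra K B" and \<xi>: "\<And>i. \<xi> i \<in> carrier B"
    and inj: "\<And>b b'. b \<in> carrier B \<Longrightarrow> b' \<in> carrier B \<Longrightarrow>
        (\<And>(A :: ('k, 'u) module) f x. algebra K A \<Longrightarrow> x \<in> pts X A \<Longrightarrow> f \<in> alg_hom K B A \<Longrightarrow>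
          ring_hom_cring B A f \<Longrightarrow> (\<And>i. f (\<xi> i) = (if i = 0 then fst x else snd x)) \<Longrightarrow> f b = f b') \<Longrightarrow> b = b'"
  have const: "\<xi> i = \<xi> 1" if "i \<noteq> 0" for i
    by (rule inj) (use that in \<open>auto simp: \<xi>\<close>)
  have "(\<xi> 0, \<xi> 1) \<in> pts X B"
  proof (rule eq[OF B])
    fix b b' assume b: "b \<in> carrier B" "b' \<in> carrier B" and
      h: "\<And>A f. algebra K A \<Longrightarrow> f \<in> alg_hom K B A \<Longrightarrow> ring_hom_cring B A f \<Longrightarrow>
          (f (\<xi> 0), f (\<xi> 1)) \<in> pts X A \<Longrightarrow> f b = f b'"
    show "b = b'"
    proof (rule inj[OF b])
      fix A :: "('k, 'u) module" and f x
      assume "algebra K A" "x \<in> pts X A" "f \<in> alg_hom K B A" "ring_hom_cring B A f"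
        and x: "\<And>i. f (\<xi> i) = (if i = 0 then fst x else snd x)"
      then show "f b = f b'" using x[of 0] x[of 1] by (intro h) auto
    qed
  qed (simp_all add: \<xi>)
  then show "\<exists>x\<in>pts X B. \<forall>i. (if i = 0 then fst x else snd x) = \<xi> i"
  proof (rule bexI[rotated], intro allI)
    show "(if i = 0 then fst (\<xi> 0, \<xi> 1) else snd (\<xi> 0, \<xi> 1)) = \<xi> i" for i
      using const[of i] by (cases "i = 0") simp_all
  qed
qed

lemma affine_P: "is_affine_scheme K (P_torsor p \<alpha> \<beta> :: ('k, 'u, 'u \<times> 'u) set_functor)"
proof (rule affine_planeI)
  fix A :: "('k, 'u) module" and y z
  assume "algebra K A" "(y, z) \<in> pts (P_torsor p \<alpha> \<beta>) A"
  then show "y \<in> carrier A \<and> z \<in> carrier A" by (simp add: P_torsor_def)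
next
  fix B :: "('k, 'u) module" and y z
  assume B: "algebra K B" and c: "y \<in> carrier B" "z \<in> carrier B" and
    eq: "\<And>b b'. b \<in> carrier B \<Longrightarrow> b' \<in> carrier B \<Longrightarrow>
        (\<And>(A :: ('k, 'u) module) f. algebra K A \<Longrightarrow> f \<in> alg_hom K B A \<Longrightarrow> ring_hom_cring B A f \<Longrightarrow>
          (f y, f z) \<in> pts (P_torsor p \<alpha> \<beta>) A \<Longrightarrow> f b = f b') \<Longrightarrow> b = b'"
  interpret B: char_p_ring B p using B by (rule char_p_algebra)
  let ?a = "\<alpha> \<odot>\<^bsub>B\<^esub> \<one>\<^bsub>B\<^esub>" and ?b = "\<beta> \<odot>\<^bsub>B\<^esub> \<one>\<^bsub>B\<^esub>"
  have ab: "?a \<in> carrier B" "?b \<in> carrier B" using B \<alpha>_closed \<beta>_closed by auto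
  have "f (y [^]\<^bsub>B\<^esub> (p ^ 2)) = f ?a \<and> f (z [^]\<^bsub>B\<^esub> p) = f (?b \<oplus>\<^bsub>B\<^esub> ?a \<otimes>\<^bsub>B\<^esub> y [^]\<^bsub>B\<^esub> p)"
    if A: "algebra K A" and f: "f \<in> alg_hom K B A" "ring_hom_cring B A f"
      and pt: "(f y, f z) \<in> pts (P_torsor p \<alpha> \<beta>) A" for A :: "('k, 'u) module" and f
  proof -
    interpret f: ring_hom_cring B A f by fact
    interpret A: char_p_ring A p using A by (rule char_p_algebra)
    show ?thesis
      using pt c ab by (simp add: pts_P[OF A] A.torsor_pt_def scalar_hom[OF B f(1)] \<alpha>_closed \<beta>_closed)
  qed
  note h = this
  have "y [^]\<^bsub>B\<^esub> (p ^ 2) = ?a" by (rule eq) (use h c ab in auto)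
  moreover have "z [^]\<^bsub>B\<^esub> p = ?b \<oplus>\<^bsub>B\<^esub> ?a \<otimes>\<^bsub>B\<^esub> y [^]\<^bsub>B\<^esub> p" by (rule eq) (use h c ab in auto)
  ultimately show "(y, z) \<in> pts (P_torsor p \<alpha> \<beta>) B"
    using c by (simp add: pts_P[OF B] B.torsor_pt_def)
qed (use torsor_pt_hom in \<open>auto simp: P_torsor_def\<close>)

end

section \<open>The twist\<close>

context u2_twist
begin

section \<open>The additive polynomials and the kernel they define\<close>

definition \<Phi> :: "nat \<Rightarrow> 'k" where
  "\<Phi> = monom (UP K) \<one>\<^bsub>K\<^esub> (p ^ 2)"

definition \<Psi> :: "nat \<Rightarrow> 'k" where
  "\<Psi> = monom (UP K) \<one>\<^bsub>K\<^esub> 1 \<ominus>\<^bsub>UP K\<^esub> monom (UP K) \<alpha> p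
     \<ominus>\<^bsub>UP K\<^esub> monom (UP K) (\<beta> [^]\<^bsub>K\<^esub> p) (p ^ 2)"

sublocale UP: UP_cring K "UP K"
  by (intro UP_cring.intro K.is_cring)

lemma \<Phi>_closed: "\<Phi> \<in> carrier (UP K)"
  by (simp add: \<Phi>_def)

lemma \<Psi>_closed: "\<Psi> \<in> carrier (UP K)"
  by (simp add: \<Psi>_def \<alpha>_closed \<beta>_closed)

lemma additive_\<Phi>: "additive_poly p K \<Phi>"
  using \<Phi>_closed by (auto simp: additive_poly_def \<Phi>_def split: if_splits)

lemma additive_\<Psi>: "additive_poly p K \<Psi>"
  unfolding additive_poly_def
proof (intro conjI allI impI \<Psi>_closed)
  fix n assume n: "coeff (UP K) \<Psi> n \<noteq> \<zero>\<^bsub>K\<^esub>"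
  have "n = 1 \<or> n = p \<or> n = p ^ 2"
  proof (rule ccontr)
    assume "\<not> ?thesis"
    then have "coeff (UP K) \<Psi> n = \<zero>\<^bsub>K\<^esub>"
      by (simp add: \<Psi>_def UP.coeff_minus \<alpha>_closed \<beta>_closed)
    then show False using n by simp
  qed
  then show "\<exists>i. n = p ^ i"
    using power_0[of p] power_one_right[of p] by metis
qed

lemma eval_in_poly:
  assumes A: "algebra K (A :: ('k, 'u) module)" and u: "u \<in> carrier A"
  shows "eval_in K A \<Phi> u = u [^]\<^bsub>A\<^esub> (p ^ 2)"
    and "eval_in K A \<Psi> u = u \<ominus>\<^bsub>A\<^esub> (\<alpha> \<odot>\<^bsub>A\<^esub> \<one>\<^bsub>A\<^esub>) \<otimes>\<^bsub>A\<^esub> u [^]\<^bsub>A\<^esub> p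
      \<ominus>\<^bsub>A\<^esub> (\<beta> \<odot>\<^bsub>A\<^esub> \<one>\<^bsub>A\<^esub>) [^]\<^bsub>A\<^esub> p \<otimes>\<^bsub>A\<^esub> u [^]\<^bsub>A\<^esub> (p ^ 2)"
proof -
  interpret C: char_p_ring A p using A by (rule char_p_algebra)
  interpret A: algebra K A by fact
  let ?h = "\<lambda>c. c \<odot>\<^bsub>A\<^esub> \<one>\<^bsub>A\<^esub>"
  interpret h: ring_hom_cring K A ?h
    by (intro ring_hom_cring.intro ring_hom_cring_axioms.intro K.is_cring C.is_cring ring_hom_memI)
      (simp_all add: A.smult_l_distr A.smult_assoc1 A.smult_assoc2)
  interpret E: UP_pre_univ_prop K A ?h "UP K"
    by (intro UP_pre_univ_prop.intro h.ring_hom_cring_axioms UP.UP_cring_axioms)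
  interpret ev: ring_hom_cring "UP K" A "eval K A ?h u"
    by (intro ring_hom_cring.intro ring_hom_cring_axioms.intro UP.P.is_cring C.is_cring E.eval_ring_hom u)
  show "eval_in K A \<Phi> u = u [^]\<^bsub>A\<^esub> (p ^ 2)"
    using u by (simp add: eval_in_def \<Phi>_def E.eval_monom)
  have minus: "eval K A ?h u (q \<ominus>\<^bsub>UP K\<^esub> r) = eval K A ?h u q \<ominus>\<^bsub>A\<^esub> eval K A ?h u r"
    if "q \<in> carrier (UP K)" "r \<in> carrier (UP K)" for q r
    using that by (simp add: a_minus_def)
  show "eval_in K A \<Psi> u = u \<ominus>\<^bsub>A\<^esub> ?h \<alpha> \<otimes>\<^bsub>A\<^esub> u [^]\<^bsub>A\<^esub> p
      \<ominus>\<^bsub>A\<^esub> ?h \<beta> [^]\<^bsub>A\<^esub> p \<otimes>\<^bsub>A\<^esub> u [^]\<^bsub>A\<^esub> (p ^ 2)"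
    using u \<alpha>_closed \<beta>_closed
    by (simp add: eval_in_def \<Psi>_def minus E.eval_monom h.hom_pow)
qed

lemma carrier_U_ker:
  assumes A: "algebra K (A :: ('k, 'u) module)"
  shows "(u, v) \<in> carrier (grp (U_ker K \<Phi> \<Psi>) A) \<longleftrightarrow> u \<in> carrier A \<and> v \<in> carrier A \<and>
    u [^]\<^bsub>A\<^esub> (p ^ 2) = v \<ominus>\<^bsub>A\<^esub> (\<alpha> \<odot>\<^bsub>A\<^esub> \<one>\<^bsub>A\<^esub>) \<otimes>\<^bsub>A\<^esub> v [^]\<^bsub>A\<^esub> p
      \<ominus>\<^bsub>A\<^esub> (\<beta> \<odot>\<^bsub>A\<^esub> \<one>\<^bsub>A\<^esub>) [^]\<^bsub>A\<^esub> p \<otimes>\<^bsub>A\<^esub> v [^]\<^bsub>A\<^esub> (p ^ 2)"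
proof -
  interpret C: char_p_ring A p using A by (rule char_p_algebra)
  show ?thesis
    using scalar_closed[OF A \<alpha>_closed] scalar_closed[OF A \<beta>_closed]
    by (auto simp: U_ker_def kernel_def add_group_def DirProd_def eval_in_poly[OF A])
qed

lemma U_ker_mult:
  "(u, v) \<otimes>\<^bsub>grp (U_ker K \<Phi> \<Psi>) A\<^esub> (u', v') = (u \<oplus>\<^bsub>A\<^esub> u', v \<oplus>\<^bsub>A\<^esub> v')"
  by (simp add: U_ker_def add_group_def DirProd_def)

text \<open>On an algebra of characteristic p, \<Phi> and \<Psi> are additive by the Frobenius
  identities, so \<open>U_ker\<close> carries the group structure of the kernel of a
  homomorphism.\<close>

lemma group_U_ker:
  assumes A: "algebra K (A :: ('k, 'u) module)"
  shows "group (grp (U_ker K \<Phi> \<Psi>) A)"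
proof -
  interpret C: char_p_ring A p using A by (rule char_p_algebra)
  have G: "group (add_group A)" by (rule group_add_group) (rule C.abelian_group_axioms)
  let ?f = "\<lambda>(u, v). eval_in K A \<Phi> u \<ominus>\<^bsub>A\<^esub> eval_in K A \<Psi> v"
  let ?a = "\<alpha> \<odot>\<^bsub>A\<^esub> \<one>\<^bsub>A\<^esub>" and ?b = "\<beta> \<odot>\<^bsub>A\<^esub> \<one>\<^bsub>A\<^esub>"
  have ab: "?a \<in> carrier A" "?b \<in> carrier A" using A \<alpha>_closed \<beta>_closed by auto
  have "?f \<in> hom (add_group A \<times>\<times> add_group A) (add_group A)"
    by (rule homI)
      (use ab in \<open>auto simp: add_group_def DirProd_def eval_in_poly[OF A] C.frob_simps a_minus_def
        C.r_distr C.minus_add C.a_ac\<close>)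
  then interpret f: group_hom "add_group A \<times>\<times> add_group A" "add_group A" ?f
    by (intro group_hom.intro group_hom_axioms.intro DirProd_group G)
  show ?thesis
    using subgroup.subgroup_is_group[OF f.subgroup_kernel f.G.is_group] by (simp add: U_ker_def)
qed

lemma U_ker_hom:
  assumes A: "algebra K (A :: ('k, 'u) module)" and B: "algebra K B" and f: "f \<in> alg_hom K A B"
    and uv: "(u, v) \<in> carrier (grp (U_ker K \<Phi> \<Psi>) A)"
  shows "(f u, f v) \<in> carrier (grp (U_ker K \<Phi> \<Psi>) B)"
proof -
  interpret f: ring_hom_cring A B f using A B f by (rule alg_hom_ring_hom_ring)
  have c: "u \<in> carrier A" "v \<in> carrier A" and
    "f (u [^]\<^bsub>A\<^esub> (p ^ 2)) = f (v \<ominus>\<^bsub>A\<^esub> (\<alpha> \<odot>\<^bsub>A\<^esub> \<one>\<^bsub>A\<^esub>) \<otimes>\<^bsub>A\<^esub> v [^]\<^bsub>A\<^esub> p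
      \<ominus>\<^bsub>A\<^esub> (\<beta> \<odot>\<^bsub>A\<^esub> \<one>\<^bsub>A\<^esub>) [^]\<^bsub>A\<^esub> p \<otimes>\<^bsub>A\<^esub> v [^]\<^bsub>A\<^esub> (p ^ 2))"
    using uv by (auto simp: carrier_U_ker[OF A])
  then show ?thesis
    using A \<alpha>_closed \<beta>_closed
    by (simp add: carrier_U_ker[OF B] a_minus_def scalar_hom[OF A f])
qed

lemma affine_U_ker: "is_affine_scheme K (underlying (U_ker K \<Phi> \<Psi> :: ('k, 'u, 'u \<times> 'u) group_functor))"
proof (rule affine_planeI)
  have pts: "pts (underlying (U_ker K \<Phi> \<Psi>)) A = carrier (grp (U_ker K \<Phi> \<Psi>) A)" for A :: "('k, 'u) module"
    by (simp add: underlying_def)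
  show "mor (underlying (U_ker K \<Phi> \<Psi>)) f = map_prod f f" for f :: "'u \<Rightarrow> 'u"
    by (simp add: underlying_def U_ker_def)
  show "y \<in> carrier A \<and> z \<in> carrier A"
    if "algebra K A" "(y, z) \<in> pts (underlying (U_ker K \<Phi> \<Psi>)) A" for A :: "('k, 'u) module" and y z
    using that by (simp add: pts carrier_U_ker)
  show "(f y, f z) \<in> pts (underlying (U_ker K \<Phi> \<Psi>)) B"
    if "algebra K A" "algebra K B" "f \<in> alg_hom K A B" "(y, z) \<in> pts (underlying (U_ker K \<Phi> \<Psi>)) A"
    for A B :: "('k, 'u) module" and f y z
    using U_ker_hom that by (simp add: pts)
  fix B :: "('k, 'u) module" and u v
  assume B: "algebra K B" and c: "u \<in> carrier B" "v \<in> carrier B" and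
    eq: "\<And>b b'. b \<in> carrier B \<Longrightarrow> b' \<in> carrier B \<Longrightarrow>
        (\<And>(A :: ('k, 'u) module) f. algebra K A \<Longrightarrow> f \<in> alg_hom K B A \<Longrightarrow> ring_hom_cring B A f \<Longrightarrow>
          (f u, f v) \<in> pts (underlying (U_ker K \<Phi> \<Psi>)) A \<Longrightarrow> f b = f b') \<Longrightarrow> b = b'"
  interpret B: char_p_ring B p using B by (rule char_p_algebra)
  let ?r = "v \<ominus>\<^bsub>B\<^esub> (\<alpha> \<odot>\<^bsub>B\<^esub> \<one>\<^bsub>B\<^esub>) \<otimes>\<^bsub>B\<^esub> v [^]\<^bsub>B\<^esub> p
      \<ominus>\<^bsub>B\<^esub> (\<beta> \<odot>\<^bsub>B\<^esub> \<one>\<^bsub>B\<^esub>) [^]\<^bsub>B\<^esub> p \<otimes>\<^bsub>B\<^esub> v [^]\<^bsub>B\<^esub> (p ^ 2)"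
  have ab: "\<alpha> \<odot>\<^bsub>B\<^esub> \<one>\<^bsub>B\<^esub> \<in> carrier B" "\<beta> \<odot>\<^bsub>B\<^esub> \<one>\<^bsub>B\<^esub> \<in> carrier B"
    using B \<alpha>_closed \<beta>_closed by auto
  have "u [^]\<^bsub>B\<^esub> (p ^ 2) = ?r"
  proof (rule eq)
    fix A :: "('k, 'u) module" and f
    assume A: "algebra K A" and f: "f \<in> alg_hom K B A" "ring_hom_cring B A f"
      and pt: "(f u, f v) \<in> pts (underlying (U_ker K \<Phi> \<Psi>)) A"
    interpret f: ring_hom_cring B A f by fact
    show "f (u [^]\<^bsub>B\<^esub> (p ^ 2)) = f ?r"
      using pt c ab
      by (simp add: pts carrier_U_ker[OF A] scalar_hom[OF B f(1)] \<alpha>_closed \<beta>_closed a_minus_def)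
  qed (use c ab in auto)
  then show "(u, v) \<in> pts (underlying (U_ker K \<Phi> \<Psi>)) B"
    using c by (simp add: pts carrier_U_ker[OF B])
qed

section \<open>Group scheme structures on G_a, the kernel and U_2\<close>

lemma group_scheme_Ga: "is_affine_group_scheme K (Ga :: ('k, 'u, 'u) group_functor)"
  unfolding is_affine_group_scheme_def
proof (intro conjI allI impI affine_Ga)
  show "group (grp Ga A)" if "algebra K A" for A :: "('k, 'u) module"
    using cring.axioms(1)[OF algebra.M_cring[OF that]]
    by (auto simp: Ga_def intro!: group_add_group ring.is_abelian_group)
  show "gmor Ga f \<in> hom (grp Ga A) (grp Ga B)" if "f \<in> alg_hom K A B" for A B :: "('k, 'u) module" and f
    using alg_homD[OF that] by (auto simp: Ga_def add_group_def hom_def)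
qed

lemma group_scheme_U_ker: "is_affine_group_scheme K (U_ker K \<Phi> \<Psi> :: ('k, 'u, 'u \<times> 'u) group_functor)"
  unfolding is_affine_group_scheme_def
proof (intro conjI allI impI affine_U_ker group_U_ker)
  fix A B :: "('k, 'u) module" and f
  assume h: "algebra K A" "algebra K B" "f \<in> alg_hom K A B"
  have mor: "gmor (U_ker K \<Phi> \<Psi>) f = map_prod f f" by (simp add: U_ker_def)
  show "gmor (U_ker K \<Phi> \<Psi>) f \<in> hom (grp (U_ker K \<Phi> \<Psi>) A) (grp (U_ker K \<Phi> \<Psi>) B)"
    unfolding mor using U_ker_hom[OF h]
    by (intro homI) (auto simp: U_ker_mult alg_homD[OF h(3)] carrier_U_ker[OF h(1)])
qed

lemma group_scheme_U2: "is_affine_group_scheme K (U2 p :: ('k, 'u, nat \<Rightarrow> 'u) group_functor)"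
  unfolding is_affine_group_scheme_def
proof (intro conjI allI impI affine_U2 group_U2)
  fix A B :: "('k, 'u) module" and f
  assume h: "algebra K A" "algebra K B" "f \<in> alg_hom K A B"
  interpret A: char_p_ring A p using h(1) by (rule char_p_algebra)
  interpret f: ring_hom_cring A B f using h by (rule alg_hom_ring_hom_ring)
  have mor: "gmor (U2 p) f = (\<lambda>a. f \<circ> a)" by (simp add: U2_def)
  show "gmor (U2 p) f \<in> hom (grp (U2 p) A) (grp (U2 p) B)"
    unfolding mor
  proof (rule homI)
    fix x y assume "x \<in> carrier (grp (U2 p) A)" "y \<in> carrier (grp (U2 p) A)"
    then obtain l m l' m' where lm: "A.u2_pt l m" "A.u2_pt l' m'"
      and xy: "x = U2_elem A l m" "y = U2_elem A l' m'"
      by (auto simp: carrier_U2[OF h(1)])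
    show "f \<circ> x \<in> carrier (grp (U2 p) B)"
      using u2_pt_hom[OF h lm(1)] by (auto simp: xy carrier_U2[OF h(2)] U2_elem_hom[OF h])
    show "f \<circ> x \<otimes>\<^bsub>grp (U2 p) A\<^esub> y = (f \<circ> x) \<otimes>\<^bsub>grp (U2 p) B\<^esub> (f \<circ> y)"
      using lm unfolding xy
      by (simp add: U2_mult[OF h(1)] U2_mult[OF h(2)] U2_elem_hom[OF h] u2_pt_hom[OF h])
        (simp add: A.u2_pt_def)
  qed
qed

section \<open>The actions of U_2 on G_a and on P\<close>

lemma U2_act_Ga_elem:
  assumes "algebra K (A :: ('k, 'u) module)"
  shows "U2_act_Ga p A (U2_elem A l m) x = char_p_ring.u2_act A p l m x"
proof -
  interpret A: char_p_ring A p using assms by (rule char_p_algebra)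
  show ?thesis by (simp add: U2_act_Ga_def A.u2_act_def)
qed

lemma U2_act_P_elem:
  "U2_act_P p A (U2_elem A l m) (y, z) = (l \<oplus>\<^bsub>A\<^esub> y, m \<oplus>\<^bsub>A\<^esub> z \<oplus>\<^bsub>A\<^esub> l \<otimes>\<^bsub>A\<^esub> y [^]\<^bsub>A\<^esub> p)"
  by (simp add: U2_act_P_def)

lemma pts_Ga: "pts (underlying Ga) A = carrier A"
  by (simp add: underlying_def Ga_def add_group_def)

lemma action_Ga: "is_action K (U2 p) (underlying (Ga :: ('k, 'u, 'u) group_functor)) (U2_act_Ga p)"
  unfolding is_action_def
proof (intro conjI allI impI)
  show "nat_trans K (prod_functor (underlying (U2 p)) (underlying (Ga :: ('k, 'u, 'u) group_functor)))
      (underlying Ga) (\<lambda>A (g, x). U2_act_Ga p A g x)"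
    unfolding nat_trans_def
  proof (intro conjI allI impI)
    show "(\<lambda>(g, x). U2_act_Ga p A g x) \<in>
        pts (prod_functor (underlying (U2 p)) (underlying Ga)) A \<rightarrow> pts (underlying Ga) A"
      if A: "algebra K A" for A :: "('k, 'u) module"
    proof -
      interpret A: char_p_ring A p using A by (rule char_p_algebra)
      show ?thesis
        by (auto simp: prod_functor_def pts_Ga underlying_def[of "U2 p"] carrier_U2[OF A]
            U2_act_Ga_elem[OF A] A.u2_pt_def)
    qed
    fix A B :: "('k, 'u) module" and f x
    assume h: "algebra K A" "algebra K B" "f \<in> alg_hom K A B"
      and x: "x \<in> pts (prod_functor (underlying (U2 p)) (underlying Ga)) A"
    interpret A: char_p_ring A p using h(1) by (rule char_p_algebra)
    interpret B: char_p_ring B p using h(2) by (rule char_p_algebra)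
    interpret f: ring_hom_cring A B f using h by (rule alg_hom_ring_hom_ring)
    obtain l m t where lm: "A.u2_pt l m" and t: "t \<in> carrier A" and x: "x = (U2_elem A l m, t)"
      using x by (auto simp: prod_functor_def pts_Ga underlying_def[of "U2 p"] carrier_U2[OF h(1)])
    have mor: "mor (prod_functor (underlying (U2 p)) (underlying Ga)) f x = (U2_elem B (f l) (f m), f t)"
      using U2_elem_hom[OF h] by (simp add: x prod_functor_def underlying_def U2_def Ga_def)
    show "(case mor (prod_functor (underlying (U2 p)) (underlying Ga)) f x of
        (g, x) \<Rightarrow> U2_act_Ga p B g x) = mor (underlying Ga) f (case x of (g, x) \<Rightarrow> U2_act_Ga p A g x)"
      unfolding mor using lm t by (simp add: x U2_act_Ga_elem[OF h(1)] U2_act_Ga_elem[OF h(2)] A.u2_act_def B.u2_act_def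
          underlying_def Ga_def A.u2_pt_def)
  qed
next
  fix A :: "('k, 'u) module" and x
  assume A: "algebra K A" and x: "x \<in> pts (underlying Ga) A"
  interpret A: char_p_ring A p using A by (rule char_p_algebra)
  show "U2_act_Ga p A \<one>\<^bsub>grp (U2 p) A\<^esub> x = x"
    using x by (simp add: U2_one[OF A] U2_act_Ga_elem[OF A] A.u2_act_zero pts_Ga)
next
  fix A :: "('k, 'u) module" and g h x
  assume A: "algebra K A" and gh: "g \<in> carrier (grp (U2 p) A)" "h \<in> carrier (grp (U2 p) A)"
    and x: "x \<in> pts (underlying Ga) A"
  interpret A: char_p_ring A p using A by (rule char_p_algebra)
  show "U2_act_Ga p A (g \<otimes>\<^bsub>grp (U2 p) A\<^esub> h) x = U2_act_Ga p A g (U2_act_Ga p A h x)"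
    using gh x by (auto simp: carrier_U2[OF A] U2_mult[OF A] U2_act_Ga_elem[OF A] A.u2_act_mult pts_Ga)
qed

lemma automorphisms_Ga:
  "acts_by_group_automorphisms K (U2 p) (Ga :: ('k, 'u, 'u) group_functor) (U2_act_Ga p)"
  unfolding acts_by_group_automorphisms_def
proof (intro conjI allI impI ballI action_Ga)
  fix A :: "('k, 'u) module" and g
  assume A: "algebra K A" and g: "g \<in> carrier (grp (U2 p) A)"
  interpret A: char_p_ring A p using A by (rule char_p_algebra)
  interpret G: group "grp (U2 p) A" using A by (rule group_U2)
  have car: "carrier (grp Ga A) = carrier A" by (simp add: Ga_def add_group_def)
  have closed: "U2_act_Ga p A g x \<in> carrier A" if "g \<in> carrier (grp (U2 p) A)" "x \<in> carrier A" for g x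
    using that by (auto simp: carrier_U2[OF A] U2_act_Ga_elem[OF A] A.u2_pt_def)
  have act_mult: "U2_act_Ga p A (g \<otimes>\<^bsub>grp (U2 p) A\<^esub> h) x = U2_act_Ga p A g (U2_act_Ga p A h x)"
    and act_one: "U2_act_Ga p A \<one>\<^bsub>grp (U2 p) A\<^esub> x = x"
    if "g \<in> carrier (grp (U2 p) A)" "h \<in> carrier (grp (U2 p) A)" "x \<in> carrier A" for g h x
    subgoal using action_Ga A that unfolding is_action_def pts_Ga by blast
    subgoal using action_Ga A that unfolding is_action_def pts_Ga by blast
    done
  \<comment> \<open>Bijectivity comes from the action itself: the inverse group element provides the
    inverse map.\<close>
  have inverse: "U2_act_Ga p A g (U2_act_Ga p A (inv\<^bsub>grp (U2 p) A\<^esub> g) x) = x"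
    "U2_act_Ga p A (inv\<^bsub>grp (U2 p) A\<^esub> g) (U2_act_Ga p A g x) = x" if "x \<in> carrier A" for x
    using act_mult[OF g G.inv_closed[OF g] that] act_mult[OF G.inv_closed[OF g] g that]
      act_one[OF g g that] G.r_inv[OF g] G.l_inv[OF g] by (simp_all only:)
  show "U2_act_Ga p A g \<in> iso (grp Ga A) (grp Ga A)"
  proof (rule isoI)
    show "U2_act_Ga p A g \<in> hom (grp Ga A) (grp Ga A)"
    proof -
      obtain l m where lm: "A.u2_pt l m" "g = U2_elem A l m" using g by (auto simp: carrier_U2[OF A])
      then have "l \<in> carrier A" "m \<in> carrier A" by (auto simp: A.u2_pt_def)
      then show ?thesis
        unfolding lm(2) hom_def by (simp add: U2_act_Ga_elem[OF A] Ga_def add_group_def A.u2_act_add)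
    qed
    show "bij_betw (U2_act_Ga p A g) (carrier (grp Ga A)) (carrier (grp Ga A))"
      unfolding car using closed g G.inv_closed[OF g] inverse
      by (intro bij_betw_byWitness[where f' = "U2_act_Ga p A (inv\<^bsub>grp (U2 p) A\<^esub> g)"]) auto
  qed
qed

text \<open>The formula is that of the product in U_2 with (y, z) in place of (l', m'), so
  compatibility with products is the same computation as associativity there.\<close>

lemma action_P: "is_action K (U2 p) (P_torsor p \<alpha> \<beta> :: ('k, 'u, 'u \<times> 'u) set_functor) (U2_act_P p)"
  unfolding is_action_def
proof (intro conjI allI impI)
  show "nat_trans K (prod_functor (underlying (U2 p)) (P_torsor p \<alpha> \<beta> :: ('k, 'u, 'u \<times> 'u) set_functor))
      (P_torsor p \<alpha> \<beta>) (\<lambda>A (g, x). U2_act_P p A g x)"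
    unfolding nat_trans_def
  proof (intro conjI allI impI)
    show "(\<lambda>(g, x). U2_act_P p A g x) \<in>
        pts (prod_functor (underlying (U2 p)) (P_torsor p \<alpha> \<beta>)) A \<rightarrow> pts (P_torsor p \<alpha> \<beta>) A"
      if A: "algebra K A" for A :: "('k, 'u) module"
    proof -
      interpret A: char_p_ring A p using A by (rule char_p_algebra)
      show ?thesis
        by (auto simp: prod_functor_def pts_P[OF A] underlying_def[of "U2 p"] carrier_U2[OF A]
            U2_act_P_elem A \<alpha>_closed \<beta>_closed intro!: A.torsor_pt_act)
    qed
    fix A B :: "('k, 'u) module" and f x
    assume h: "algebra K A" "algebra K B" "f \<in> alg_hom K A B"
      and x: "x \<in> pts (prod_functor (underlying (U2 p)) (P_torsor p \<alpha> \<beta>)) A"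
    interpret A: char_p_ring A p using h(1) by (rule char_p_algebra)
    interpret f: ring_hom_cring A B f using h by (rule alg_hom_ring_hom_ring)
    obtain l m y z where lm: "A.u2_pt l m" and yz: "y \<in> carrier A" "z \<in> carrier A"
      and x: "x = (U2_elem A l m, (y, z))"
      using x by (auto simp: prod_functor_def pts_P[OF h(1)] underlying_def[of "U2 p"] carrier_U2[OF h(1)]
          A.torsor_pt_def)
    have "mor (prod_functor (underlying (U2 p)) (P_torsor p \<alpha> \<beta>)) f x = (U2_elem B (f l) (f m), (f y, f z))"
      using U2_elem_hom[OF h] by (simp add: x prod_functor_def underlying_def U2_def P_torsor_def)
    then show "(case mor (prod_functor (underlying (U2 p)) (P_torsor p \<alpha> \<beta>)) f x of
        (g, x) \<Rightarrow> U2_act_P p B g x) = mor (P_torsor p \<alpha> \<beta>) f (case x of (g, x) \<Rightarrow> U2_act_P p A g x)"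
      using lm yz by (simp add: x U2_act_P_elem P_torsor_def A.u2_pt_def)
  qed
next
  fix A :: "('k, 'u) module" and x
  assume A: "algebra K A" and x: "x \<in> pts (P_torsor p \<alpha> \<beta>) A"
  interpret A: char_p_ring A p using A by (rule char_p_algebra)
  show "U2_act_P p A \<one>\<^bsub>grp (U2 p) A\<^esub> x = x"
    using x by (cases x) (simp add: U2_one[OF A] U2_act_P_elem pts_P[OF A] A.torsor_pt_def)
next
  fix A :: "('k, 'u) module" and g h x
  assume A: "algebra K A" and gh: "g \<in> carrier (grp (U2 p) A)" "h \<in> carrier (grp (U2 p) A)"
    and x: "x \<in> pts (P_torsor p \<alpha> \<beta>) A"
  interpret A: char_p_ring A p using A by (rule char_p_algebra)
  show "U2_act_P p A (g \<otimes>\<^bsub>grp (U2 p) A\<^esub> h) x = U2_act_P p A g (U2_act_P p A h x)"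
    using gh x
    by (cases x) (auto simp: carrier_U2[OF A] U2_mult[OF A] U2_act_P_elem pts_P[OF A] A.u2_pt_def
        A.torsor_pt_def A.frob_simps A.l_distr A.r_distr A.a_ac)
qed

section \<open>The torsor property of P\<close>

lemma P_transitive:
  assumes A: "algebra K (A :: ('k, 'u) module)"
    and s: "s \<in> pts (P_torsor p \<alpha> \<beta>) A" and t: "t \<in> pts (P_torsor p \<alpha> \<beta>) A"
  shows "\<exists>!g. g \<in> carrier (grp (U2 p) A) \<and> U2_act_P p A g s = t"
proof -
  interpret A: char_p_ring A p using A by (rule char_p_algebra)
  let ?a = "\<alpha> \<odot>\<^bsub>A\<^esub> \<one>\<^bsub>A\<^esub>" and ?b = "\<beta> \<odot>\<^bsub>A\<^esub> \<one>\<^bsub>A\<^esub>"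
  have ab: "?a \<in> carrier A" "?b \<in> carrier A" using A \<alpha>_closed \<beta>_closed by auto
  obtain y z y' z' where st: "s = (y, z)" "t = (y', z')" by (metis surj_pair)
  have pt: "A.torsor_pt ?a ?b y z" "A.torsor_pt ?a ?b y' z'" using s t by (auto simp: st pts_P[OF A])
  then have c: "y \<in> carrier A" "z \<in> carrier A" "y' \<in> carrier A" "z' \<in> carrier A"
    by (auto simp: A.torsor_pt_def)
  define l where "l = y' \<ominus>\<^bsub>A\<^esub> y"
  define m where "m = z' \<ominus>\<^bsub>A\<^esub> z \<ominus>\<^bsub>A\<^esub> l \<otimes>\<^bsub>A\<^esub> y [^]\<^bsub>A\<^esub> p"
  have lm: "A.u2_pt l m" unfolding l_def m_def by (rule A.torsor_pt_diff[OF pt ab])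
  then have lmc: "l \<in> carrier A" "m \<in> carrier A" by (auto simp: A.u2_pt_def)
  \<comment> \<open>This serves once for l and twice for m: the equation for m' is solved by moving
    its two known summands across one at a time.\<close>
  have solve: "l' = y' \<ominus>\<^bsub>A\<^esub> y \<longleftrightarrow> l' \<oplus>\<^bsub>A\<^esub> y = y'" if "l' \<in> carrier A" "y \<in> carrier A" "y' \<in> carrier A" for l' y y'
    using that by (auto simp: a_minus_def A.a_assoc A.l_neg A.r_neg)
  have act: "U2_act_P p A (U2_elem A l' m') s = t \<longleftrightarrow> l' = l \<and> m' = m"
    if "l' \<in> carrier A" "m' \<in> carrier A" for l' m'
  proof -
    have "m' = m \<longleftrightarrow> m' \<oplus>\<^bsub>A\<^esub> z \<oplus>\<^bsub>A\<^esub> l \<otimes>\<^bsub>A\<^esub> y [^]\<^bsub>A\<^esub> p = z'"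
      using c lmc that solve[of m' "l \<otimes>\<^bsub>A\<^esub> y [^]\<^bsub>A\<^esub> p" "z' \<ominus>\<^bsub>A\<^esub> z"]
        solve[of "m' \<oplus>\<^bsub>A\<^esub> l \<otimes>\<^bsub>A\<^esub> y [^]\<^bsub>A\<^esub> p" z z'] by (simp add: m_def A.a_ac)
    then show ?thesis
      using c that solve[of l' y y'] by (auto simp: st U2_act_P_elem l_def)
  qed
  show ?thesis
  proof (rule ex1I[of _ "U2_elem A l m"])
    show "U2_elem A l m \<in> carrier (grp (U2 p) A) \<and> U2_act_P p A (U2_elem A l m) s = t"
      using act[OF lmc] lm by (auto simp: carrier_U2[OF A])
    show "g = U2_elem A l m" if "g \<in> carrier (grp (U2 p) A) \<and> U2_act_P p A g s = t" for g
      using that act by (auto simp: carrier_U2[OF A] A.u2_pt_def)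
  qed
qed

text \<open>
  Since \<open>(z - y\<^bsup>p+1\<^esup>)\<^bsup>p\<^esup> = \<beta>\<close> on \<open>P\<close>, it is enough to adjoin a \<open>p\<^sup>2\<close>-th root of \<open>\<alpha>\<close> and a
  \<open>p\<close>-th root of \<open>\<beta>\<close>.
\<close>

lemma P_locally_nonempty:
  assumes A: "algebra K (A :: ('k, 'u) module)"
  obtains B f s where "flat_cover K A B f" "s \<in> pts (P_torsor p \<alpha> \<beta>) B"
proof -
  have pos: "p > 0" "p ^ 2 > 0" using prime_p by (simp_all add: prime_gt_0_nat)
  obtain B :: "('k, 'u) module" and f y d co where B: "algebra K B" and f: "f \<in> alg_hom K A B"
    and y: "y \<in> carrier B" "y [^]\<^bsub>B\<^esub> (p ^ 2) = f (\<alpha> \<odot>\<^bsub>A\<^esub> \<one>\<^bsub>A\<^esub>)"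
    and free_f: "finite_free_hom A B f {..<p ^ 2} d co"
    using adjoin_root_exists[OF A infinite_univ scalar_closed[OF A \<alpha>_closed] pos(2)] by blast
  obtain C :: "('k, 'u) module" and g w e cp where C: "algebra K C" and g: "g \<in> alg_hom K B C"
    and w: "w \<in> carrier C" "w [^]\<^bsub>C\<^esub> p = g (\<beta> \<odot>\<^bsub>B\<^esub> \<one>\<^bsub>B\<^esub>)"
    and free_g: "finite_free_hom B C g {..<p} e cp"
    using adjoin_root_exists[OF B infinite_univ scalar_closed[OF B \<beta>_closed] pos(1)] by blast
  interpret g: ring_hom_cring B C g using B C g by (rule alg_hom_ring_hom_ring)
  interpret C: char_p_ring C p using C by (rule char_p_algebra)
  have "flat_cover K A C (\<lambda>a. g (f a))"
    using C alg_hom_comp[OF f g] finite_free_hom.faithfully_flat[OF finite_free_hom_comp[OF free_f free_g]]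
    by (simp add: flat_cover_def)
  moreover have "(g y, w \<oplus>\<^bsub>C\<^esub> g y \<otimes>\<^bsub>C\<^esub> g y [^]\<^bsub>C\<^esub> p) \<in> pts (P_torsor p \<alpha> \<beta>) C"
    unfolding pts_P[OF C]
    using y w by (intro C.torsor_ptI)
      (simp_all add: scalar_hom[OF A f] scalar_hom[OF B g] \<alpha>_closed \<beta>_closed flip: g.hom_pow)
  ultimately show ?thesis by (rule that)
qed

lemma torsor_P: "is_torsor K (U2 p) (P_torsor p \<alpha> \<beta> :: ('k, 'u, 'u \<times> 'u) set_functor) (U2_act_P p)"
  unfolding is_torsor_def using group_scheme_U2 affine_P action_P P_transitive P_locally_nonempty
  by (metis empty_iff)

section \<open>The quotient map and the group law of the twist\<close>

definition twist_proj :: "('k, 'u) module \<Rightarrow> ('u \<times> 'u) \<times> 'u \<Rightarrow> 'u \<times> 'u" where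
  "twist_proj A = (\<lambda>((y, z), x). (char_p_ring.proj_u A p y z x, x [^]\<^bsub>A\<^esub> (p ^ 2)))"

lemma twist_proj_closed:
  assumes A: "algebra K A" and s: "(y, z) \<in> pts (P_torsor p \<alpha> \<beta>) A" and x: "x \<in> carrier A"
  shows "twist_proj A ((y, z), x) \<in> carrier (grp (U_ker K \<Phi> \<Psi>) A)"
proof -
  interpret A: char_p_ring A p using A by (rule char_p_algebra)
  have "\<alpha> \<odot>\<^bsub>A\<^esub> \<one>\<^bsub>A\<^esub> \<in> carrier A" "\<beta> \<odot>\<^bsub>A\<^esub> \<one>\<^bsub>A\<^esub> \<in> carrier A" using A \<alpha>_closed \<beta>_closed by auto
  then show ?thesis
    using s x by (simp add: twist_proj_def carrier_U_ker[OF A] pts_P[OF A] A.proj_u_equation A.torsor_ptD)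
qed

text \<open>Two points with the same image lie in one orbit already over A: the torsor property
  moves one point of P to the other, and \<open>proj_u_inj\<close> then identifies the second
  components. A proper extension serves local surjectivity, where a point of P has to be
  created.\<close>

lemma quotient_twist:
  "is_quotient K (U2 p) (prod_functor (P_torsor p \<alpha> \<beta>) (underlying (Ga :: ('k, 'u, 'u) group_functor)))
     (\<lambda>A g (s, a). (U2_act_P p A g s, U2_act_Ga p A g a)) (underlying (U_ker K \<Phi> \<Psi>)) twist_proj"
  unfolding is_quotient_def
proof (intro conjI allI impI ballI)
  let ?X = "prod_functor (P_torsor p \<alpha> \<beta>) (underlying (Ga :: ('k, 'u, 'u) group_functor))"
  have pts_X: "((y, z), x) \<in> pts ?X A \<longleftrightarrow> (y, z) \<in> pts (P_torsor p \<alpha> \<beta>) A \<and> x \<in> carrier A"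
    for A :: "('k, 'u) module" and x y z
    by (simp add: prod_functor_def pts_Ga)
  have mor_X: "mor ?X f ((y, z), x) = ((f y, f z), f x)" for f x y z
    by (simp add: prod_functor_def underlying_def Ga_def P_torsor_def)
  have pts_U: "pts (underlying (U_ker K \<Phi> \<Psi>)) A = carrier (grp (U_ker K \<Phi> \<Psi>) A)" for A :: "('k, 'u) module"
    by (simp add: underlying_def)
  have mor_U: "mor (underlying (U_ker K \<Phi> \<Psi>)) f = map_prod f f" for f :: "'u \<Rightarrow> 'u"
    by (simp add: underlying_def U_ker_def)
  show "is_action K (U2 p) ?X (\<lambda>A g (s, a). (U2_act_P p A g s, U2_act_Ga p A g a))"
    by (rule is_action_prod[OF action_P action_Ga])
  show "is_affine_scheme K (underlying (U_ker K \<Phi> \<Psi> :: ('k, 'u, 'u \<times> 'u) group_functor))"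
    by (rule affine_U_ker)
  show "nat_trans K ?X (underlying (U_ker K \<Phi> \<Psi>)) twist_proj"
    unfolding nat_trans_def pts_U mor_U
  proof (intro conjI allI impI)
    show "twist_proj A \<in> pts ?X A \<rightarrow> carrier (grp (U_ker K \<Phi> \<Psi>) A)" if "algebra K A" for A
      using twist_proj_closed[OF that] by (auto simp: pts_X)
    fix A B :: "('k, 'u) module" and f r
    assume h: "algebra K A" "algebra K B" "f \<in> alg_hom K A B" and r: "r \<in> pts ?X A"
    interpret A: char_p_ring A p using h(1) by (rule char_p_algebra)
    interpret B: char_p_ring B p using h(2) by (rule char_p_algebra)
    interpret f: ring_hom_cring A B f using h by (rule alg_hom_ring_hom_ring)
    obtain y z x where "r = ((y, z), x)" by (metis surj_pair)
    moreover from this r have "y \<in> carrier A" "z \<in> carrier A" "x \<in> carrier A"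
      by (auto simp: pts_X pts_P[OF h(1)] A.torsor_pt_def)
    ultimately show "twist_proj B (mor ?X f r) = map_prod f f (twist_proj A r)"
      by (simp add: mor_X twist_proj_def A.proj_u_def B.proj_u_def a_minus_def)
  qed
  fix A :: "('k, 'u) module" assume A: "algebra K A"
  interpret A: char_p_ring A p using A by (rule char_p_algebra)
  let ?a = "\<alpha> \<odot>\<^bsub>A\<^esub> \<one>\<^bsub>A\<^esub>" and ?b = "\<beta> \<odot>\<^bsub>A\<^esub> \<one>\<^bsub>A\<^esub>"
  have ab: "?a \<in> carrier A" "?b \<in> carrier A" using A \<alpha>_closed \<beta>_closed by auto
  show invariant: "twist_proj A (case r of (s, a) \<Rightarrow> (U2_act_P p A g s, U2_act_Ga p A g a)) = twist_proj A r"
    if g: "g \<in> carrier (grp (U2 p) A)" and r: "r \<in> pts ?X A" for g r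
  proof -
    obtain l m where lm: "A.u2_pt l m" "g = U2_elem A l m" using g by (auto simp: carrier_U2[OF A])
    obtain y z x where "r = ((y, z), x)" by (metis surj_pair)
    moreover from this r have "y \<in> carrier A" "z \<in> carrier A" "x \<in> carrier A"
      by (auto simp: pts_X pts_P[OF A] A.torsor_pt_def)
    ultimately show ?thesis
      using lm by (simp add: twist_proj_def U2_act_P_elem U2_act_Ga_elem[OF A] A.proj_u_invariant A.u2_act_frob)
  qed
  show "\<exists>B f. flat_cover K A B f \<and> (\<exists>g\<in>carrier (grp (U2 p) B).
      (case mor ?X f r of (s, a) \<Rightarrow> (U2_act_P p B g s, U2_act_Ga p B g a)) = mor ?X f r')"
    if r: "r \<in> pts ?X A" and r': "r' \<in> pts ?X A" and eq: "twist_proj A r = twist_proj A r'" for r r'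
  proof -
    obtain y z x where rd: "r = ((y, z), x)" by (metis surj_pair)
    obtain y' z' x' where rd': "r' = ((y', z'), x')" by (metis surj_pair)
    have s: "(y, z) \<in> pts (P_torsor p \<alpha> \<beta>) A" "(y', z') \<in> pts (P_torsor p \<alpha> \<beta>) A"
      and x: "x \<in> carrier A" "x' \<in> carrier A"
      using r r' by (auto simp: rd rd' pts_X)
    obtain g where g: "g \<in> carrier (grp (U2 p) A)" "U2_act_P p A g (y, z) = (y', z')"
      using P_transitive[OF A s] by blast
    have x_closed: "U2_act_Ga p A g x \<in> carrier A"
      using g(1) x(1) by (auto simp: carrier_U2[OF A] U2_act_Ga_elem[OF A] A.u2_pt_def)
    have "twist_proj A ((y', z'), U2_act_Ga p A g x) = twist_proj A ((y', z'), x')"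
      using invariant[OF g(1) r] g(2) eq by (simp add: rd rd')
    then have "U2_act_Ga p A g x = x'"
      using s(2) by (intro A.proj_u_inj[OF _ ab x_closed x(2)]) (auto simp: twist_proj_def pts_P[OF A])
    then show ?thesis
      using identity_flat_cover[OF A] g
      by (intro exI[of _ A] exI[of _ "\<lambda>x. x"]) (auto simp: rd rd' mor_X)
  qed
  show "\<exists>B f. flat_cover K A B f \<and> (\<exists>r\<in>pts ?X B. twist_proj B r = mor (underlying (U_ker K \<Phi> \<Psi>)) f q)"
    if q: "q \<in> pts (underlying (U_ker K \<Phi> \<Psi>)) A" for q
  proof -
    obtain B f s where Bf: "flat_cover K A B f" and "s \<in> pts (P_torsor p \<alpha> \<beta>) B"
      using P_locally_nonempty[OF A] by blast
    then obtain y z where s: "(y, z) \<in> pts (P_torsor p \<alpha> \<beta>) B" by (cases s) auto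
    have B: "algebra K B" and f: "f \<in> alg_hom K A B" using Bf by (auto simp: flat_cover_def)
    interpret B: char_p_ring B p using B by (rule char_p_algebra)
    have abB: "\<alpha> \<odot>\<^bsub>B\<^esub> \<one>\<^bsub>B\<^esub> \<in> carrier B" "\<beta> \<odot>\<^bsub>B\<^esub> \<one>\<^bsub>B\<^esub> \<in> carrier B" using B \<alpha>_closed \<beta>_closed by auto
    obtain u v where uv: "q = (u, v)" by (cases q)
    have "(f u, f v) \<in> carrier (grp (U_ker K \<Phi> \<Psi>) B)"
      using q U_ker_hom[OF A B f] by (simp add: uv pts_U)
    then have e: "f u \<in> carrier B" "f v \<in> carrier B"
      "f u [^]\<^bsub>B\<^esub> (p ^ 2) = f v \<ominus>\<^bsub>B\<^esub> (\<alpha> \<odot>\<^bsub>B\<^esub> \<one>\<^bsub>B\<^esub>) \<otimes>\<^bsub>B\<^esub> f v [^]\<^bsub>B\<^esub> p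
      \<ominus>\<^bsub>B\<^esub> (\<beta> \<odot>\<^bsub>B\<^esub> \<one>\<^bsub>B\<^esub>) [^]\<^bsub>B\<^esub> p \<otimes>\<^bsub>B\<^esub> f v [^]\<^bsub>B\<^esub> (p ^ 2)"
      by (auto simp: carrier_U_ker[OF B])
    \<comment> \<open>Over a cover with a point (y, z) of P, the explicit inverse
      \<open>lift_x\<close> supplies a preimage of the image of (u, v).\<close>
    note L = B.lift_x_correct[OF s[unfolded pts_P[OF B]] abB e]
    show ?thesis
      using Bf s L
      by (intro exI[of _ B] exI[of _ f] conjI bexI[of _ "((y, z), B.lift_x (\<beta> \<odot>\<^bsub>B\<^esub> \<one>\<^bsub>B\<^esub>) y z (f u) (f v))"])
        (simp_all add: pts_X mor_U uv twist_proj_def)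
  qed
qed

text \<open>For a fixed point s both \<open>proj_u\<close> and x^(p^2) are additive in x, so
  componentwise addition in \<open>U_ker\<close> is the group law required of the twist.\<close>

lemma twist: "is_twist K (U2 p) (P_torsor p \<alpha> \<beta>) (U2_act_P p) (Ga :: ('k, 'u, 'u) group_functor)
    (U2_act_Ga p) (U_ker K \<Phi> \<Psi>)"
  unfolding is_twist_def
proof (intro conjI torsor_P group_scheme_Ga automorphisms_Ga group_scheme_U_ker exI[of _ twist_proj]
    quotient_twist allI impI ballI)
  fix A :: "('k, 'u) module" and s
  assume A: "algebra K A" and s: "s \<in> pts (P_torsor p \<alpha> \<beta>) A"
  interpret A: char_p_ring A p using A by (rule char_p_algebra)
  obtain y z where yz: "s = (y, z)" by (cases s)
  have c: "y \<in> carrier A" "z \<in> carrier A" using s by (auto simp: yz pts_P[OF A] A.torsor_pt_def)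
  show "(\<lambda>a. twist_proj A (s, a)) \<in> hom (grp Ga A) (grp (U_ker K \<Phi> \<Psi>) A)"
  proof (rule homI)
    show "twist_proj A (s, x) \<in> carrier (grp (U_ker K \<Phi> \<Psi>) A)" if "x \<in> carrier (grp Ga A)" for x
      using twist_proj_closed[OF A s[unfolded yz]] that by (simp add: yz Ga_def add_group_def)
    show "twist_proj A (s, x \<otimes>\<^bsub>grp Ga A\<^esub> x') = twist_proj A (s, x) \<otimes>\<^bsub>grp (U_ker K \<Phi> \<Psi>) A\<^esub> twist_proj A (s, x')"
      if "x \<in> carrier (grp Ga A)" "x' \<in> carrier (grp Ga A)" for x x'
      using that c
      by (simp add: yz Ga_def add_group_def twist_proj_def U_ker_mult A.proj_u_add A.frob_simps)
  qed
qed

end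

text \<open>The hypotheses on \<open>'u\<close> make the universe large enough: infinitude gives a
  pairing and countably many labels for terms, and the embedding of K labels the constants. The
  pairing also places the extensions that split P in \<open>'u\<close>.\<close>

theorem proposition11p6:
  fixes K :: "'k ring" and p :: nat and \<alpha> \<beta> :: 'k and \<Phi> \<Psi> :: "nat \<Rightarrow> 'k"
  assumes "field K" and "prime p" and "[p] \<cdot>\<^bsub>K\<^esub> \<one>\<^bsub>K\<^esub> = \<zero>\<^bsub>K\<^esub>"
    and "\<alpha> \<in> carrier K" and "\<beta> \<in> carrier K"
    and "infinite (UNIV :: 'u set)" and "\<exists>e :: 'k \<Rightarrow> 'u. inj_on e (carrier K)"
    and "\<Phi> = monom (UP K) \<one>\<^bsub>K\<^esub> (p ^ 2)"
    and "\<Psi> = monom (UP K) \<one>\<^bsub>K\<^esub> 1 \<ominus>\<^bsub>UP K\<^esub> monom (UP K) \<alpha> p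
               \<ominus>\<^bsub>UP K\<^esub> monom (UP K) (\<beta> [^]\<^bsub>K\<^esub> p) (p ^ 2)"
  shows "additive_poly p K \<Phi> \<and> additive_poly p K \<Psi> \<and>
    is_twist K (U2 p :: ('k, 'u, nat \<Rightarrow> 'u) group_functor)
      (P_torsor p \<alpha> \<beta>) (U2_act_P p) Ga (U2_act_Ga p) (U_ker K \<Phi> \<Psi>)"
proof -
  obtain enc :: "'k alg_term \<Rightarrow> 'u" where "inj_on enc {t. term_consts t \<subseteq> carrier K}"
    using term_encoding_exists[OF assms(6,7)] by blast
  then interpret T: u2_twist K p \<alpha> \<beta> enc
    using assms(1-6) by (intro u2_twist.intro)
  have "\<Phi> = T.\<Phi>" "\<Psi> = T.\<Psi>"
    by (simp_all add: assms(8,9) T.\<Phi>_def T.\<Psi>_def)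
  then show ?thesis
    using T.additive_\<Phi> T.additive_\<Psi> T.twist by simp
qed

end
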